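(* Consider the closed-loop tracking error system \[ \dot R_e = R_e\,\omega_e^{\times},\qquad J\dot\omega_e = C_K x_K + D_\theta e_R + D_\omega \omega_e,\qquad \dot x_K = A_K x_K + B_\theta e_R + B_\omega \omega_e \] on $\mathrm{SO}(3)\times\mathbb{R}^3\times\mathbb{R}^n$, and the function $V$ defined in the context. Suppose the Lyapunov coefficients satisfy \[ \mathcal{P}=\begin{bmatrix}p_{11}I&P_{21}^\top J&P_{31}^\top\\ JP_{21}&P_{22}J&JP_{32}^\top\\ P_{31}&P_{32}J&P_{33}\end{bmatrix}>0 \] and that there exist $\tau_1,\tau_2>0$ with $\mathcal{M}_1<0$, where $\mathcal{M}_1$ is defined in the context. Then: (1) the zero equilibrium of the errors $(e_R,\omega_e,x_K)$ is stable; (2) $(e_R,\omega_e,x_K)\to0$ as $t\to\infty$; hence $R_e(t)\to\{I\}\cup\{\exp(\pi\alpha^\times):\alpha\in\mathbb{S}^2\}$ and $(\omega_e,x_K)\to0$; (3) the undesired equilibria $(R_e,\omega_e,x_K)=(\exp(\pi\alpha^\times),0,0)$, $\alpha\in\mathbb{S}^2$, are unstable; (4) the desired equilibrium $(R_e,\omega_e,x_K)=(I,0,0)$ is almost globally asymptotically stable.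
   Context: $J\in\mathbb{R}^{3\times3}$ is symmetric positive definite. For $v\in\mathbb{R}^3$, $v^\times$ is the skew-symmetric matrix with $v^\times y=v\times y$, and $(\cdot)^\vee$ is its inverse. Every $R\in\mathrm{SO}(3)$ can be written $R=\exp(\theta\alpha^\times)=I+\sin\theta\,\alpha^\times+(1-\cos\theta)\alpha^\times\alpha^\times$ with $\alpha\in\mathbb{S}^2$, $\theta\in\mathbb{R}$. $\Psi(R_e)=\tfrac12\mathrm{tr}(I-R_e)$, $e_R=\tfrac12(R_e-R_e^\top)^\vee$. The controller matrices $A_K\in\mathbb{R}^{n\times n}$, $B_\theta,B_\omega\in\mathbb{R}^{n\times3}$, $C_K\in\mathbb{R}^{3\times n}$, $D_\theta,D_\omega\in\mathbb{R}^{3\times3}$ are given and form a minimal realization. $V(R_e,\omega_e,x_K)=2p_{11}\Psi(R_e)+\omega_e^\top P_{22}J\omega_e+2e_R^\top P_{21}^\top J\omega_e+x_K^\top P_{33}x_K+2x_K^\top P_{31}e_R+2x_K^\top P_{32}J\omega_e$, with $p_{11}\in\mathbb{R}$, $P_{21},P_{22}\in\mathbb{R}^{3\times3}$, $P_{31},P_{32}\in\mathbb{R}^{n\times3}$, $P_{33}\in\mathbb{R}^{n\times n}$, $P_{22},P_{33}$ symmetric and $P_{22}J=JP_{22}$. Define $M_{11}=P_{21}^\top D_\theta+D_\theta^\top P_{21}+P_{31}^\top B_\theta+B_\theta^\top P_{31}$, $M_{22}=P_{22}D_\omega+D_\omega^\top P_{22}+JP_{32}^\top B_\omega+B_\omega^\top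 P_{32}J$, $M_{21}=p_{11}I+P_{22}D_\theta+D_\omega^\top P_{21}+JP_{32}^\top B_\theta+B_\omega^\top P_{31}$, $M_{33}=P_{32}C_K+C_K^\top P_{32}^\top+P_{33}A_K+A_K^\top P_{33}$, $M_{31}=P_{32}D_\theta+C_K^\top P_{21}+A_K^\top P_{31}+P_{33}B_\theta$, $M_{32}=P_{32}D_\omega+C_K^\top P_{22}+A_K^\top P_{32}J+P_{33}B_\omega$, and $\mathcal{M}_1=\begin{bmatrix}M_{11}&M_{21}^\top&M_{31}^\top\\ M_{21}&\tilde M_{22}&M_{32}^\top\\ M_{31}&M_{32}&\tilde M_{33}\end{bmatrix}$ with $\tilde M_{22}=M_{22}+(\tau_1+\tau_2)I+\frac1{\tau_2}JP_{21}P_{21}^\top J$, $\tilde M_{33}=M_{33}+\frac1{\tau_1}P_{31}P_{31}^\top$. For symmetric matrices, $>0$ ($<0$) means positive (negative) definite. Almost global asymptotic stability means the equilibrium is stable and attracts all solutions except those starting in a set of Lebesgue (Riemannian) measure zero. *)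

theory Defs
  imports "HOL-Analysis.Analysis"
begin

text \<open>Hat map: skew v *v y = v cross y.\<close>
definition skew :: "real^3 \<Rightarrow> real^3^3" where
  "skew v = vector [vector [0, - v$3, v$2], vector [v$3, 0, - v$1], vector [- v$2, v$1, 0]]"

text \<open>Vee map, inverse of skew on skew-symmetric matrices.\<close>
definition vee :: "real^3^3 \<Rightarrow> real^3" where
  "vee M = vector [M$3$2, M$1$3, M$2$1]"

definition SO3 :: "(real^3^3) set" where
  "SO3 = {R. transpose R ** R = mat 1 \<and> det R = 1}"

text \<open>exp(theta alpha^x) via the Rodrigues formula of the paper.\<close>
definition rodrigues :: "real^3 \<Rightarrow> real \<Rightarrow> real^3^3" where
  "rodrigues \<alpha> \<theta> = mat 1 + sin \<theta> *\<^sub>R skew \<alpha> + (1 - cos \<theta>) *\<^sub>R (skew \<alpha> ** skew \<alpha>)"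

definition expso3 :: "real^3 \<Rightarrow> real^3^3" where
  "expso3 v = rodrigues (sgn v) (norm v)"

definition Psi :: "real^3^3 \<Rightarrow> real" where
  "Psi Rm = (1/2) * trace (mat 1 - Rm)"

definition eR :: "real^3^3 \<Rightarrow> real^3" where
  "eR Rm = vee ((1/2) *\<^sub>R (Rm - transpose Rm))"

primrec matpow :: "real^'n^'n \<Rightarrow> nat \<Rightarrow> real^'n^'n" where
  "matpow A 0 = mat 1"
| "matpow A (Suc k) = A ** matpow A k"

definition sym_mat :: "real^'n^'n \<Rightarrow> bool" where
  "sym_mat A \<longleftrightarrow> transpose A = A"

definition pos_def :: "real^'n^'n \<Rightarrow> bool" where
  "pos_def A \<longleftrightarrow> sym_mat A \<and> (\<forall>x. x \<noteq> 0 \<longrightarrow> x \<bullet> (A *v x) > 0)"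

definition neg_def :: "real^'n^'n \<Rightarrow> bool" where
  "neg_def A \<longleftrightarrow> pos_def (- A)"

definition hcat :: "real^'m^'n \<Rightarrow> real^'p^'n \<Rightarrow> real^('m + 'p)^'n" where
  "hcat B1 B2 = (\<chi> r c. case c of Inl a \<Rightarrow> B1$r$a | Inr b \<Rightarrow> B2$r$b)"

text \<open>Kalman rank condition: rank [B, AB, ..., A^(n-1) B] = n, i.e. the columns of
  the controllability matrix span R^n.\<close>
definition controllable :: "real^'n^'n \<Rightarrow> real^'m^'n \<Rightarrow> bool" where
  "controllable A B \<longleftrightarrow>
     span (\<Union>k<CARD('n). {column j (matpow A k ** B) | j. True}) = UNIV"

text \<open>Kalman rank condition: rank [C; CA; ...; C A^(n-1)] = n, i.e. the rows of the
  observability matrix span R^n.\<close>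
definition observable :: "real^'n^'n \<Rightarrow> real^'n^'q \<Rightarrow> bool" where
  "observable A C \<longleftrightarrow>
     span (\<Union>k<CARD('n). {row i (C ** matpow A k) | i. True}) = UNIV"

definition minimal_realization ::
  "real^'n^'n \<Rightarrow> real^3^'n \<Rightarrow> real^3^'n \<Rightarrow> real^'n^3 \<Rightarrow> bool" where
  "minimal_realization AK B\<theta> B\<omega> CK \<longleftrightarrow>
     controllable AK (hcat B\<theta> B\<omega>) \<and> observable AK CK"

definition block3 ::
  "real^'a^'a \<Rightarrow> real^'b^'a \<Rightarrow> real^'c^'a \<Rightarrow>
   real^'a^'b \<Rightarrow> real^'b^'b \<Rightarrow> real^'c^'b \<Rightarrow>
   real^'a^'c \<Rightarrow> real^'b^'c \<Rightarrow> real^'c^'c \<Rightarrow> real^('a + 'b + 'c)^('a + 'b + 'c)" where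
  "block3 A11 A12 A13 A21 A22 A23 A31 A32 A33 =
    (\<chi> i j. case i of
        Inl a \<Rightarrow> (case j of Inl a' \<Rightarrow> A11$a$a' | Inr (Inl b') \<Rightarrow> A12$a$b' | Inr (Inr c') \<Rightarrow> A13$a$c')
      | Inr (Inl b) \<Rightarrow> (case j of Inl a' \<Rightarrow> A21$b$a' | Inr (Inl b') \<Rightarrow> A22$b$b' | Inr (Inr c') \<Rightarrow> A23$b$c')
      | Inr (Inr c) \<Rightarrow> (case j of Inl a' \<Rightarrow> A31$c$a' | Inr (Inl b') \<Rightarrow> A32$c$b' | Inr (Inr c') \<Rightarrow> A33$c$c'))"

definition Pmat ::
  "real^3^3 \<Rightarrow> real \<Rightarrow> real^3^3 \<Rightarrow> real^3^3 \<Rightarrow> real^3^'n \<Rightarrow> real^3^'n \<Rightarrow> real^'n^'n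
   \<Rightarrow> real^(3 + 3 + 'n)^(3 + 3 + 'n)" where
  "Pmat J p11 P21 P22 P31 P32 P33 =
    block3 (p11 *\<^sub>R mat 1) (transpose P21 ** J) (transpose P31)
           (J ** P21) (P22 ** J) (J ** transpose P32)
           P31 (P32 ** J) P33"

definition M1mat ::
  "real^3^3 \<Rightarrow> real^'n^'n \<Rightarrow> real^3^'n \<Rightarrow> real^3^'n \<Rightarrow> real^'n^3 \<Rightarrow> real^3^3 \<Rightarrow> real^3^3
   \<Rightarrow> real \<Rightarrow> real^3^3 \<Rightarrow> real^3^3 \<Rightarrow> real^3^'n \<Rightarrow> real^3^'n \<Rightarrow> real^'n^'n
   \<Rightarrow> real \<Rightarrow> real \<Rightarrow> real^(3 + 3 + 'n)^(3 + 3 + 'n)" where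
  "M1mat J AK B\<theta> B\<omega> CK D\<theta> D\<omega> p11 P21 P22 P31 P32 P33 \<tau>1 \<tau>2 =
    (let M11 = transpose P21 ** D\<theta> + transpose D\<theta> ** P21 + transpose P31 ** B\<theta> + transpose B\<theta> ** P31;
         M22 = P22 ** D\<omega> + transpose D\<omega> ** P22 + J ** transpose P32 ** B\<omega> + transpose B\<omega> ** P32 ** J;
         M21 = p11 *\<^sub>R mat 1 + P22 ** D\<theta> + transpose D\<omega> ** P21 + J ** transpose P32 ** B\<theta> + transpose B\<omega> ** P31;
         M33 = P32 ** CK + transpose CK ** transpose P32 + P33 ** AK + transpose AK ** P33;
         M31 = P32 ** D\<theta> + transpose CK ** P21 + transpose AK ** P31 + P33 ** B\<theta>;
         M32 = P32 ** D\<omega> + transpose CK ** P22 + transpose AK ** P32 ** J + P33 ** B\<omega>;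
         M22t = M22 + (\<tau>1 + \<tau>2) *\<^sub>R mat 1 + (1 / \<tau>2) *\<^sub>R (J ** P21 ** transpose P21 ** J);
         M33t = M33 + (1 / \<tau>1) *\<^sub>R (P31 ** transpose P31)
     in block3 M11 (transpose M21) (transpose M31)
               M21 M22t (transpose M32)
               M31 M32 M33t)"

definition Vfun ::
  "real^3^3 \<Rightarrow> real \<Rightarrow> real^3^3 \<Rightarrow> real^3^3 \<Rightarrow> real^3^'n \<Rightarrow> real^3^'n \<Rightarrow> real^'n^'n
   \<Rightarrow> real^3^3 \<Rightarrow> real^3 \<Rightarrow> real^'n \<Rightarrow> real" where
  "Vfun J p11 P21 P22 P31 P32 P33 Rm w xK =
     2 * p11 * Psi Rm + w \<bullet> (P22 ** J *v w) + 2 * (eR Rm \<bullet> (transpose P21 ** J *v w))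
     + xK \<bullet> (P33 *v xK) + 2 * (xK \<bullet> (P31 *v eR Rm)) + 2 * (xK \<bullet> (P32 ** J *v w))"

definition is_sol ::
  "real^3^3 \<Rightarrow> real^'n^'n \<Rightarrow> real^3^'n \<Rightarrow> real^3^'n \<Rightarrow> real^'n^3 \<Rightarrow> real^3^3 \<Rightarrow> real^3^3
   \<Rightarrow> (real \<Rightarrow> real^3^3) \<Rightarrow> (real \<Rightarrow> real^3) \<Rightarrow> (real \<Rightarrow> real^'n) \<Rightarrow> bool" where
  "is_sol J AK B\<theta> B\<omega> CK D\<theta> D\<omega> Rm w xK \<longleftrightarrow>
     (\<forall>t\<ge>0. Rm t \<in> SO3
        \<and> (Rm has_vector_derivative (Rm t ** skew (w t))) (at t within {0..})
        \<and> ((\<lambda>s. J *v w s) has_vector_derivative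
             (CK *v xK t + D\<theta> *v eR (Rm t) + D\<omega> *v w t)) (at t within {0..})
        \<and> (xK has_vector_derivative
             (AK *v xK t + B\<theta> *v eR (Rm t) + B\<omega> *v w t)) (at t within {0..}))"

definition lyap_stable ::
  "real^3^3 \<Rightarrow> real^'n^'n \<Rightarrow> real^3^'n \<Rightarrow> real^3^'n \<Rightarrow> real^'n^3 \<Rightarrow> real^3^3 \<Rightarrow> real^3^3
   \<Rightarrow> real^3^3 \<Rightarrow> real^3 \<Rightarrow> real^'n \<Rightarrow> bool" where
  "lyap_stable J AK B\<theta> B\<omega> CK D\<theta> D\<omega> Req weq xeq \<longleftrightarrow>
     (\<forall>\<epsilon>>0. \<exists>\<delta>>0. \<forall>Rm w xK. is_sol J AK B\<theta> B\<omega> CK D\<theta> D\<omega> Rm w xK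
        \<and> dist (Rm 0, w 0, xK 0) (Req, weq, xeq) < \<delta>
        \<longrightarrow> (\<forall>t\<ge>0. dist (Rm t, w t, xK t) (Req, weq, xeq) < \<epsilon>))"

end

theory Submission
  imports Defs
begin

text \<open>
  With \<open>V\<close> and \<open>\<bar>e\<^sub>R\<bar>\<^sup>2 = \<Psi> (2 - \<Psi>)\<close>, the condition \<open>M\<^sub>1 < 0\<close> gives \<open>V' \<le> - k \<bar>z\<bar>\<^sup>2\<close> for
  \<open>z = (e\<^sub>R, \<omega>\<^sub>e, x\<^sub>K)\<close>, whence stability and, by Barbalat's argument, \<open>z \<rightarrow> 0\<close>; then \<open>\<Psi>\<close> tends to 0 or 2
  and \<open>V\<close> to 0 or \<open>4 p\<^sub>1\<^sub>1\<close>. Solutions starting next to an undesired equilibrium with \<open>V < 4 p\<^sub>1\<^sub>1\<close> converge to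
  the identity, so that equilibrium is unstable.

  A solution that does not converge to the identity has \<open>V \<ge> 4 p\<^sub>1\<^sub>1\<close>; then \<open>V - 4 p\<^sub>1\<^sub>1\<close> decays
  exponentially, \<open>R\<^sub>e\<close> has finite length, and the solution is eventually trapped near one undesired
  equilibrium. The second variation of \<open>V\<close> there is a strict, indefinite Lyapunov form for the
  linearization modulo the two center directions. It yields a cone of exponentially expanding
  differences, so two trapped solutions never differ by a vector in the cone, and the trapped states form
  a Lipschitz graph over a hyperplane. Pulling this back by the backward Lipschitz dependence on data and
  by a local inverse of the exponential shows that the exceptional data are a null set.
\<close>

subsection \<open>Scalar differential inequalities\<close>

text \<open>The undesired equilibria fill a surface, so approaching that set does not mean
  approaching a point, while a cone lives at one fixed half-turn; finite length of R_e bridges this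
  gap. The level \<open>4 * p11\<close> is the value of \<open>V\<close> at every half-turn at rest,
  where \<open>Psi = 2\<close> and the errors vanish. A cone of expanding differences takes the
  place of a center-stable manifold and needs only Lipschitz estimates on the vector field. That the
  hypothesis on M1 also governs the half-turns rests on two sign changes that cancel. Near
  \<open>Psi = 2\<close> the relation between \<open>Psi\<close> and e_R turns the attitude part of
  \<open>V\<close> into \<open>- p11 * |e|^2\<close>, and the linearized motion there satisfies e .
  e' = - e . w instead of e . w. Hence one algebraic inequality serves both the closed loop and its
  linearization. All radii and constants are uniform in \<alpha>. Countably many half-turns
  therefore suffice, and with integer entry times, orbit bounds and shells of the exponential the
  exceptional set is covered by countably many null sets.\<close>

lemma nondecreasing_if_deriv_nonneg:
  fixes g g' :: "real \<Rightarrow> real"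
  assumes "\<And>t. t \<in> {a..b} \<Longrightarrow> (g has_real_derivative g' t) (at t within S)"
    and "\<And>t. t \<in> {a..b} \<Longrightarrow> 0 \<le> g' t" and "{a..b} \<subseteq> S" and "a \<le> b"
  shows "g a \<le> g b"
proof (cases "a = b")
  case False
  with \<open>a \<le> b\<close> have "a < b" by simp
  have "\<exists>x\<in>{a<..<b}. g b - g a = g' x * (b - a)"
    using mvt_simple[OF \<open>a < b\<close>, of g "\<lambda>x h. g' x * h"] assms(1,3)
    by (metis atLeastAtMost_iff has_derivative_subset has_field_derivative_def)
  then obtain x where "x \<in> {a<..<b}" "g b - g a = g' x * (b - a)" by blast
  moreover have "0 \<le> g' x * (b - a)" using assms(2)[of x] \<open>x \<in> {a<..<b}\<close> \<open>a < b\<close> by auto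
  ultimately show ?thesis by linarith
qed simp

text \<open>Gronwall: \<open>Q t * exp (- \<kappa> * (t - a))\<close> is nondecreasing, so a
  positive initial value would outgrow every bound. This is the exclusion principle for differences
  inside the cone.\<close>

lemma bounded_exponential_growth_nonpos:
  fixes Q Q' :: "real \<Rightarrow> real"
  assumes der: "\<And>t. t \<ge> a \<Longrightarrow> (Q has_real_derivative Q' t) (at t within {a..})"
    and grow: "\<And>t. t \<ge> a \<Longrightarrow> Q' t \<ge> \<kappa> * Q t" and "\<kappa> > 0"
    and bnd: "\<And>t. t \<ge> a \<Longrightarrow> Q t \<le> B"
  shows "Q a \<le> 0"
proof (rule ccontr)
  assume "\<not> Q a \<le> 0"
  hence pos: "Q a > 0" by simp
  have mono: "Q a * exp (\<kappa> * (t - a)) \<le> Q t" if "t \<ge> a" for t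
  proof -
    have "Q a * exp (- \<kappa> * (a - a)) \<le> Q t * exp (- \<kappa> * (t - a))"
    proof (rule nondecreasing_if_deriv_nonneg[where g = "\<lambda>s. Q s * exp (- \<kappa> * (s - a))"])
      fix s assume s: "s \<in> {a..t}"
      show "((\<lambda>s. Q s * exp (- \<kappa> * (s - a))) has_real_derivative
          (Q' s - \<kappa> * Q s) * exp (- \<kappa> * (s - a))) (at s within {a..})"
        using s by (auto intro!: derivative_eq_intros der simp: algebra_simps)
      show "0 \<le> (Q' s - \<kappa> * Q s) * exp (- \<kappa> * (s - a))"
        using grow[of s] s by simp
    qed (use that in auto)
    hence "Q a * exp (\<kappa> * (t - a)) \<le> Q t * exp (- \<kappa> * (t - a)) * exp (\<kappa> * (t - a))"
      by simp
    thus ?thesis by (simp add: mult.assoc flip: exp_add)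
  qed
  \<comment> \<open>Late enough that \<open>exp x \<ge> 1 + x\<close> already pushes the lower bound
    past \<bar>B\<bar>.\<close>
  define t where "t = a + (\<bar>B\<bar> / Q a + 1) / \<kappa>"
  have "t \<ge> a" using pos \<open>\<kappa> > 0\<close> by (simp add: t_def)
  have "\<kappa> * (t - a) = \<bar>B\<bar> / Q a + 1" using \<open>\<kappa> > 0\<close> by (simp add: t_def)
  hence "exp (\<kappa> * (t - a)) > \<bar>B\<bar> / Q a"
    using exp_ge_add_one_self[of "\<kappa> * (t - a)"] by linarith
  hence "Q a * exp (\<kappa> * (t - a)) > \<bar>B\<bar>" using pos by (simp add: field_simps)
  with mono[OF \<open>t \<ge> a\<close>] bnd[OF \<open>t \<ge> a\<close>] show False by linarith
qed

text \<open>The arithmetic of the cone. Here \<open>a\<close> is the size of the error part of a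
  difference, \<open>d\<close> that of its center part, \<open>X\<close> the derivative of the
  dissipated form, \<open>Y\<close> half the derivative of \<open>d\<^sup>2\<close>,
  \<open>Q\<close> the negated form, and \<open>m * (a + d)\<close> the nonlinear remainder. The
  center part has no decay of its own; the term \<open>- \<kappa> * \<epsilon> * d\<^sup>2\<close>
  on the left is what pays for every \<open>d\<^sup>2\<close> produced on the right.\<close>

lemma cone_constants:
  fixes k B K :: real
  assumes "k > 0" "B > 0" "K > 0"
  obtains \<epsilon> m \<kappa> where "\<epsilon> > 0" "m > 0" "\<kappa> > 0"
    "\<And>a d X Y Q. 0 \<le> a \<Longrightarrow> 0 \<le> d \<Longrightarrow> X \<le> - k * a\<^sup>2 + B * a * (m * (a + d)) \<Longrightarrow>
      Y \<le> d * (K * a + m * (a + d)) \<Longrightarrow> Q \<le> B * a\<^sup>2 \<Longrightarrow>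
      \<kappa> * (Q - \<epsilon> * d\<^sup>2) \<le> - X - 2 * \<epsilon> * Y"
proof -
  \<comment> \<open>\<kappa> makes \<open>\<kappa> * Q\<close> cost a quarter of
    \<open>k * a\<^sup>2\<close>. \<epsilon> makes Young's inequality on the coupling
    \<open>2 * \<epsilon> * K * a * d\<close> cost an eighth. Each of the four bounds on
    \<open>m\<close> absorbs one remainder term; in total at most 3/4 of
    \<open>k * a\<^sup>2\<close> and 3/4 of \<open>\<kappa> * \<epsilon> * d\<^sup>2\<close> are
    spent.\<close>
  define \<kappa> where "\<kappa> = k / (4 * B)"
  define \<epsilon> where "\<epsilon> = \<kappa> * k / (32 * K\<^sup>2)"
  define m where "m = Min {k / (8 * B), sqrt (\<kappa> * \<epsilon> * k / 8) / B, \<kappa> / 12, k / (8 * \<epsilon>)}"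
  have pos: "\<kappa> > 0" "\<epsilon> > 0" using assms by (auto simp: \<kappa>_def \<epsilon>_def)
  hence "m > 0" using assms by (auto simp: m_def)
  have "m \<le> k / (8 * B)" "m \<le> sqrt (\<kappa> * \<epsilon> * k / 8) / B" "m \<le> \<kappa> / 12" "m \<le> k / (8 * \<epsilon>)"
    unfolding m_def by (rule Min_le; simp)+
  hence m: "B * m \<le> k / 8" "B * m \<le> sqrt (\<kappa> * \<epsilon> * k / 8)" "m \<le> \<kappa> / 12" "\<epsilon> * m \<le> k / 8"
    using assms pos by (simp_all add: field_simps)
  have Bm: "(B * m)\<^sup>2 \<le> \<kappa> * \<epsilon> * k / 8"
    using power_mono[OF m(2), of 2] assms pos \<open>m > 0\<close> by simp
  have amgm: "x * y \<le> c / 4 * y\<^sup>2 + x\<^sup>2 / c" if "c > 0" for x y c :: real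
  proof -
    have "0 \<le> (c * y - 2 * x)\<^sup>2 / (4 * c)" using that by simp
    also have "\<dots> = c / 4 * y\<^sup>2 + x\<^sup>2 / c - x * y"
      using that by (simp add: power2_eq_square field_simps)
    finally show ?thesis by simp
  qed
  show ?thesis
  proof (rule that[OF pos(2) \<open>m > 0\<close> pos(1)])
    fix a d X Y Q :: real
    assume ad: "0 \<le> a" "0 \<le> d" and X: "X \<le> - k * a\<^sup>2 + B * a * (m * (a + d))"
      and Y: "Y \<le> d * (K * a + m * (a + d))" and Q: "Q \<le> B * a\<^sup>2"
    have sq: "0 \<le> a\<^sup>2" "0 \<le> d\<^sup>2" by simp_all
    have 1: "\<kappa> * Q \<le> k / 4 * a\<^sup>2"
      using mult_left_mono[OF Q, of \<kappa>] pos assms by (simp add: \<kappa>_def)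
    have 2: "2 * \<epsilon> * (K * a * d) \<le> \<kappa> * \<epsilon> / 4 * d\<^sup>2 + k / 8 * a\<^sup>2"
    proof -
      have "2 * \<epsilon> * (K * a) * d \<le> \<kappa> * \<epsilon> / 4 * d\<^sup>2 + (2 * \<epsilon> * (K * a))\<^sup>2 / (\<kappa> * \<epsilon>)"
        using pos by (intro amgm) simp
      also have "(2 * \<epsilon> * (K * a))\<^sup>2 / (\<kappa> * \<epsilon>) = 4 * K\<^sup>2 / \<kappa> * \<epsilon> * a\<^sup>2"
        using pos by (simp add: power2_eq_square field_simps)
      also have "\<dots> = k / 8 * a\<^sup>2"
        using pos assms by (simp add: \<epsilon>_def power2_eq_square field_simps)
      finally show ?thesis by (simp add: algebra_simps)
    qed
    have 3: "B * m * a * d \<le> \<kappa> * \<epsilon> / 4 * d\<^sup>2 + k / 8 * a\<^sup>2"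
    proof -
      have "B * m * a * d \<le> \<kappa> * \<epsilon> / 4 * d\<^sup>2 + (B * m * a)\<^sup>2 / (\<kappa> * \<epsilon>)"
        using pos by (intro amgm) simp
      also have "(B * m * a)\<^sup>2 / (\<kappa> * \<epsilon>) = (B * m)\<^sup>2 / (\<kappa> * \<epsilon>) * a\<^sup>2"
        by (simp add: power_mult_distrib)
      also have "\<dots> \<le> k / 8 * a\<^sup>2"
        using Bm pos by (intro mult_right_mono) (simp_all add: field_simps)
      finally show ?thesis by simp
    qed
    have 4: "B * m * a\<^sup>2 \<le> k / 8 * a\<^sup>2" by (rule mult_right_mono[OF m(1) sq(1)])
    have 5: "2 * (\<epsilon> * m) * (a * d) \<le> k / 8 * a\<^sup>2 + (\<epsilon> * m) * d\<^sup>2"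
    proof -
      have "2 * (a * d) \<le> a\<^sup>2 + d\<^sup>2" using sum_squares_bound[of a d] by simp
      hence "(\<epsilon> * m) * (2 * (a * d)) \<le> (\<epsilon> * m) * (a\<^sup>2 + d\<^sup>2)"
        using pos \<open>m > 0\<close> by (intro mult_left_mono) auto
      moreover have "(\<epsilon> * m) * a\<^sup>2 \<le> k / 8 * a\<^sup>2" by (rule mult_right_mono[OF m(4) sq(1)])
      ultimately show ?thesis by (simp add: algebra_simps)
    qed
    have 6: "3 * (\<epsilon> * m) * d\<^sup>2 \<le> \<kappa> * \<epsilon> / 4 * d\<^sup>2"
      using m(3) pos by (intro mult_right_mono sq) (simp add: field_simps)
    have 7: "2 * \<epsilon> * Y \<le> 2 * \<epsilon> * (d * (K * a + m * (a + d)))"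
      using Y pos by (intro mult_left_mono) auto
    have 8: "0 \<le> \<kappa> * \<epsilon> / 4 * d\<^sup>2" using pos by simp
    have e: "2 * \<epsilon> * (d * (K * a + m * (a + d)))
        = 2 * \<epsilon> * (K * a * d) + 2 * (\<epsilon> * m) * (a * d) + 2 * (\<epsilon> * m) * d\<^sup>2"
      "B * a * (m * (a + d)) = B * m * a\<^sup>2 + B * m * a * d"
      "\<kappa> * (Q - \<epsilon> * d\<^sup>2) = \<kappa> * Q - 4 * (\<kappa> * \<epsilon> / 4 * d\<^sup>2)"
      by (simp_all add: power2_eq_square algebra_simps)
    show "\<kappa> * (Q - \<epsilon> * d\<^sup>2) \<le> - X - 2 * \<epsilon> * Y"
      using 1 2 3 4 5 6 7 8 X sq mult_nonneg_nonneg[OF less_imp_le[OF \<open>k > 0\<close>] sq(1)] unfolding e by linarith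
  qed
qed

text \<open>A Barbalat argument: an excursion of \<open>z\<close> above level \<open>\<epsilon>\<close> costs \<open>V\<close> a fixed amount.\<close>

lemma barbalat_dissipation:
  fixes V V' :: "real \<Rightarrow> real" and z :: "real \<Rightarrow> 'a::real_normed_vector"
  assumes der: "\<And>t. t \<ge> 0 \<Longrightarrow> (V has_real_derivative V' t) (at t within {0..})"
    and diss: "\<And>t. t \<ge> 0 \<Longrightarrow> V' t \<le> - k * (norm (z t))\<^sup>2" and "k > 0"
    and bnd: "\<And>t. t \<ge> 0 \<Longrightarrow> 0 \<le> V t"
    and lip: "\<And>s t. 0 \<le> s \<Longrightarrow> s \<le> t \<Longrightarrow> norm (z t - z s) \<le> L * (t - s)" and "L > 0"
  shows "(z \<longlongrightarrow> 0) at_top" and "\<exists>l. (V \<longlongrightarrow> l) at_top \<and> (\<forall>t\<ge>0. l \<le> V t)"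
proof -
  have dec: "V t \<le> V s" if "0 \<le> s" "s \<le> t" for s t
  proof -
    have "- V s \<le> - V t"
    proof (rule nondecreasing_if_deriv_nonneg[where g = "\<lambda>r. - V r"])
      fix r assume r: "r \<in> {s..t}"
      show "((\<lambda>r. - V r) has_real_derivative - V' r) (at r within {0..})"
        using r that by (auto intro!: derivative_eq_intros der)
      have "k * (norm (z r))\<^sup>2 \<ge> 0" using \<open>k > 0\<close> by simp
      thus "0 \<le> - V' r" using diss[of r] r that by auto
    qed (use that in auto)
    thus ?thesis by simp
  qed
  define l where "l = Inf (V ` {0..})"
  have bdd: "bdd_below (V ` {0..})" using bnd by (auto intro!: bdd_belowI[of _ 0])
  have l_le: "l \<le> V t" if "t \<ge> 0" for t
    unfolding l_def using that bdd by (auto intro!: cInf_lower)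
  have lim: "(V \<longlongrightarrow> l) at_top"
  proof (rule tendstoI)
    fix e :: real assume "e > 0"
    have "\<exists>t\<ge>0. V t < l + e"
      using cInf_lessD[of "V ` {0..}" "l + e"] \<open>e > 0\<close> by (auto simp: l_def)
    then obtain T where T: "T \<ge> 0" "V T < l + e" by blast
    have "dist (V t) l < e" if "t \<ge> T" for t
      using dec[of T t] l_le[of t] T that by (auto simp: dist_real_def)
    thus "\<forall>\<^sub>F t in at_top. dist (V t) l < e"
      using eventually_at_top_linorder by blast
  qed
  thus "\<exists>l. (V \<longlongrightarrow> l) at_top \<and> (\<forall>t\<ge>0. l \<le> V t)" using l_le by blast
  show "(z \<longlongrightarrow> 0) at_top"
  proof (rule tendstoI)
    fix \<epsilon> :: real assume "\<epsilon> > 0"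
    \<comment> \<open>By the Lipschitz bound \<open>z\<close> needs at least time \<open>h\<close>
      to fall from \<epsilon> to \<open>\<epsilon> / 2\<close>; \<open>d\<close> is the loss of
      \<open>V\<close> enforced during that time.\<close>
    define h where "h = \<epsilon> / (2 * L)"
    define d where "d = k * (\<epsilon> / 2)\<^sup>2 * h"
    have "h > 0" "d > 0" using \<open>\<epsilon> > 0\<close> \<open>L > 0\<close> \<open>k > 0\<close> by (auto simp: h_def d_def)
    have drop: "V (t + h) \<le> V t - d" if t: "t \<ge> 0" "norm (z t) \<ge> \<epsilon>" for t
    proof -
      have "- V t - k * (\<epsilon> / 2)\<^sup>2 * (t - t) \<le> - V (t + h) - k * (\<epsilon> / 2)\<^sup>2 * (t + h - t)"
      proof (rule nondecreasing_if_deriv_nonneg[where g = "\<lambda>r. - V r - k * (\<epsilon> / 2)\<^sup>2 * (r - t)"])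
        fix r assume r: "r \<in> {t..t + h}"
        show "((\<lambda>r. - V r - k * (\<epsilon> / 2)\<^sup>2 * (r - t)) has_real_derivative
            - V' r - k * (\<epsilon> / 2)\<^sup>2) (at r within {0..})"
          using r that by (auto intro!: derivative_eq_intros der)
        have "norm (z r - z t) \<le> L * (r - t)" using lip[of t r] r t by auto
        also have "\<dots> \<le> L * h" using r \<open>L > 0\<close> by auto
        also have "\<dots> = \<epsilon> / 2" using \<open>L > 0\<close> by (simp add: h_def)
        finally have "norm (z r) \<ge> \<epsilon> / 2"
          using norm_triangle_ineq2[of "z t" "z r"] t by (simp add: norm_minus_commute)
        hence "(\<epsilon> / 2)\<^sup>2 \<le> (norm (z r))\<^sup>2" using \<open>\<epsilon> > 0\<close> by (intro power_mono) auto
        hence "k * (\<epsilon> / 2)\<^sup>2 \<le> k * (norm (z r))\<^sup>2" using \<open>k > 0\<close> by simp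
        thus "0 \<le> - V' r - k * (\<epsilon> / 2)\<^sup>2" using diss[of r] r t by auto
      qed (use \<open>h > 0\<close> t in auto)
      thus ?thesis by (simp add: d_def)
    qed
    have "\<forall>\<^sub>F t in at_top. V t < l + d"
      using order_tendstoD(2)[OF lim, of "l + d"] \<open>d > 0\<close> by simp
    moreover have "\<forall>\<^sub>F t in at_top. (t::real) \<ge> 0" by (rule eventually_ge_at_top)
    ultimately show "\<forall>\<^sub>F t in at_top. dist (z t) 0 < \<epsilon>"
    proof eventually_elim
      case (elim t)
      show ?case
      proof (rule ccontr)
        assume "\<not> dist (z t) 0 < \<epsilon>"
        hence "V (t + h) \<le> V t - d" using drop elim by simp
        moreover have "l \<le> V (t + h)" using l_le elim \<open>h > 0\<close> by simp
        ultimately show False using elim by linarith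
      qed
    qed
  qed
qed

section \<open>Lipschitz bounds from derivatives\<close>

lemma norm_fst_snd_le:
  fixes z :: "'a::real_normed_vector \<times> 'b::real_normed_vector \<times> 'c::real_normed_vector"
  shows "norm (fst (snd z)) \<le> norm z"
  using norm_fst_le[of "fst (snd z)" "snd (snd z)"] norm_snd_le[of "snd z" "fst z"] by simp

lemma bounded_vector_derivative_imp_lipschitz:
  fixes f :: "real \<Rightarrow> 'a::real_normed_vector"
  assumes "\<And>r. r \<in> {s..t} \<Longrightarrow> (f has_vector_derivative f' r) (at r within S)"
    and "\<And>r. r \<in> {s..t} \<Longrightarrow> norm (f' r) \<le> B" and "{s..t} \<subseteq> S" and "s \<le> t"
  shows "norm (f t - f s) \<le> B * (t - s)"
proof -
  have "norm (f t - f s) \<le> B * norm (t - s)"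
  proof (rule differentiable_bound[where f' = "\<lambda>r h. h *\<^sub>R f' r" and S = "{s..t}"])
    fix r assume r: "r \<in> {s..t}"
    show "(f has_derivative (\<lambda>h. h *\<^sub>R f' r)) (at r within {s..t})"
      using has_vector_derivative_within_subset[OF assms(1)[OF r] assms(3)]
      by (simp add: has_vector_derivative_def)
    show "onorm (\<lambda>h. h *\<^sub>R f' r) \<le> B"
      using assms(2)[OF r] by (intro onorm_le) (simp add: mult.commute[of B] mult_left_mono)
  qed (use \<open>s \<le> t\<close> in auto)
  thus ?thesis using \<open>s \<le> t\<close> by simp
qed

text \<open>The bound is centered at \<open>x\<close> only. This pointwise form is all that the
  theorem on Lipschitz images of null sets asks for.\<close>

lemma differentiable_imp_pointwise_lipschitz:
  fixes f :: "'a::real_normed_vector \<Rightarrow> 'b::real_normed_vector"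
  assumes "f differentiable (at x)"
  obtains d B where "d > 0" "B > 0" "\<And>y. norm (y - x) < d \<Longrightarrow> norm (f y - f x) \<le> B * norm (y - x)"
proof -
  obtain f' where f': "(f has_derivative f') (at x)" using assms by (auto simp: differentiable_def)
  obtain K where K: "K > 0" "\<And>h. norm (f' h) \<le> norm h * K"
    using bounded_linear.pos_bounded[OF has_derivative_bounded_linear[OF f']] by blast
  have "\<exists>d>0. \<forall>y. norm (y - x) < d \<longrightarrow> norm (f y - f x - f' (y - x)) \<le> 1 * norm (y - x)"
    using f' zero_less_one unfolding has_derivative_at_alt by blast
  then obtain d where d: "d > 0" "\<And>y. norm (y - x) < d \<Longrightarrow> norm (f y - f x - f' (y - x)) \<le> norm (y - x)"
    by auto
  show ?thesis
  proof (rule that[of d "1 + K"])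
    fix y assume "norm (y - x) < d"
    hence "norm (f y - f x - f' (y - x)) \<le> norm (y - x)" by (rule d)
    moreover have "norm (f y - f x) \<le> norm (f' (y - x)) + norm (f y - f x - f' (y - x))"
      by (rule norm_triangle_sub)
    ultimately show "norm (f y - f x) \<le> (1 + K) * norm (y - x)"
      using K(2)[of "y - x"] by (simp add: algebra_simps)
  qed (use d K in auto)
qed

subsection \<open>Global existence for ordinary differential equations\<close>

text \<open>The factor \<open>1 / \<mu>\<close> gained by integrating the weight is the source of
  the contraction: with Lipschitz constant \<open>L\<close> the Picard operator contracts by
  \<open>L / \<mu>\<close>.\<close>

lemma integral_exp_bound:
  fixes g :: "real \<Rightarrow> 'a::euclidean_space"
  assumes "continuous_on {0..t} g" "\<And>s. s \<in> {0..t} \<Longrightarrow> norm (g s) \<le> c * exp (\<mu> * s)"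
    and "\<mu> > 0" "t \<ge> 0" "c \<ge> 0"
  shows "norm (integral {0..t} g) \<le> c / \<mu> * exp (\<mu> * t)"
proof -
  have I: "((\<lambda>s. c * exp (\<mu> * s)) has_integral (c / \<mu> * exp (\<mu> * t) - c / \<mu> * exp (\<mu> * 0))) {0..t}"
    using \<open>\<mu> > 0\<close> \<open>t \<ge> 0\<close>
    by (intro fundamental_theorem_of_calculus)
      (auto intro!: derivative_eq_intros simp flip: has_real_derivative_iff_has_vector_derivative)
  have "norm (integral {0..t} g) \<le> integral {0..t} (\<lambda>s. c * exp (\<mu> * s))"
    using assms I by (intro integral_norm_bound_integral integrable_continuous_real)
      (auto intro!: continuous_intros)
  also have "\<dots> = c / \<mu> * exp (\<mu> * t) - c / \<mu>"
    using integral_unique[OF I] by (simp only: mult_zero_right exp_zero mult_1_right)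
  also have "\<dots> \<le> c / \<mu> * exp (\<mu> * t)" using assms by simp
  finally show ?thesis .
qed

text \<open>The Picard operator is a contraction for the weighted norm \<open>sup (exp (- 2 L t) * norm (y t))\<close>;
  the unknown \<open>u\<close> below is \<open>exp (- 2 L t) * y t\<close>, extended to \<open>t < 0\<close> as a constant.\<close>

lemma global_solution_lipschitz:
  fixes f :: "'a::euclidean_space \<Rightarrow> 'a"
  assumes lip: "\<And>x y. norm (f x - f y) \<le> L * norm (x - y)" and "L > 0"
  obtains y where "y 0 = y0"
    "\<And>t. t \<ge> 0 \<Longrightarrow> (y has_vector_derivative f (y t)) (at t within {0..})"
proof -
  define \<mu> where "\<mu> = 2 * L"
  have "\<mu> > 0" using \<open>L > 0\<close> by (simp add: \<mu>_def)
  have f_cont: "continuous_on UNIV f"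
  proof (rule continuous_onI)
    fix x :: 'a and e :: real assume "e > 0"
    thus "\<exists>d>0. \<forall>x'\<in>UNIV. dist x' x < d \<longrightarrow> dist (f x') (f x) \<le> e"
      using lip[of _ x] \<open>L > 0\<close>
      by (intro exI[of _ "e / L"])
        (auto simp: dist_norm field_simps intro: order_trans less_imp_le)
  qed
  define G :: "(real \<Rightarrow> 'a) \<Rightarrow> real \<Rightarrow> 'a" where "G u s = f (exp (\<mu> * s) *\<^sub>R u s)" for u s
  define P :: "(real \<Rightarrow> 'a) \<Rightarrow> real \<Rightarrow> 'a" where
    "P u t = exp (- \<mu> * max 0 t) *\<^sub>R (y0 + integral {0..max 0 t} (G u))" for u t
  have G_cont: "continuous_on S (G (apply_bcontfun u))" for u :: "real \<Rightarrow>\<^sub>C 'a" and S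
    unfolding G_def
    by (intro continuous_on_compose2[OF f_cont] continuous_intros) auto
  have int_cont: "continuous_on {0..} (\<lambda>t. integral {0..t} (G (apply_bcontfun u)))"
    for u :: "real \<Rightarrow>\<^sub>C 'a"
  proof -
    have "continuous_on {0..b} (\<lambda>t. integral {0..t} (G (apply_bcontfun u)))" for b
      by (intro indefinite_integral_continuous_1 integrable_continuous_real G_cont)
    hence "continuous (at t within {0..}) (\<lambda>t. integral {0..t} (G (apply_bcontfun u)))"
      if "t \<ge> 0" for t
      using that at_within_nhd[of t "{..<t+1}" "{0..}" "{0..t+1}"]
      by (force simp: continuous_on_eq_continuous_within)
    thus ?thesis by (simp add: continuous_on_eq_continuous_within)
  qed
  have P_cont: "continuous_on UNIV (P (apply_bcontfun u))" for u :: "real \<Rightarrow>\<^sub>C 'a"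
    unfolding P_def
    by (intro continuous_intros continuous_on_compose2[OF int_cont[of u], of UNIV "max 0"])
      (auto intro!: continuous_intros)
  have P_bnd: "norm (P (apply_bcontfun u) t) \<le> norm y0 + (norm (f 0) + L * norm u) / \<mu>"
    for u :: "real \<Rightarrow>\<^sub>C 'a" and t
  proof -
    define m where "m = max 0 t"
    have "m \<ge> 0" by (simp add: m_def)
    have "norm (integral {0..m} (G (apply_bcontfun u))) \<le> (norm (f 0) + L * norm u) / \<mu> * exp (\<mu> * m)"
    proof (rule integral_exp_bound[OF G_cont])
      fix s assume s: "s \<in> {0..m}"
      have "norm (G (apply_bcontfun u) s) \<le> norm (f 0) + L * norm (exp (\<mu> * s) *\<^sub>R u s)"
        unfolding G_def using lip[of "exp (\<mu> * s) *\<^sub>R u s" 0]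
          norm_triangle_ineq2[of "f (exp (\<mu> * s) *\<^sub>R u s)" "f 0"] by simp
      also have "\<dots> = norm (f 0) * 1 + L * norm (u s) * exp (\<mu> * s)" by simp
      also have "\<dots> \<le> norm (f 0) * exp (\<mu> * s) + L * norm u * exp (\<mu> * s)"
        using s \<open>\<mu> > 0\<close> \<open>L > 0\<close> norm_bounded[of u s]
        by (intro add_mono mult_mono) auto
      finally show "norm (G (apply_bcontfun u) s) \<le> (norm (f 0) + L * norm u) * exp (\<mu> * s)"
        by (simp add: algebra_simps)
    qed (use \<open>\<mu> > 0\<close> \<open>L > 0\<close> \<open>m \<ge> 0\<close> in auto)
    hence "exp (- \<mu> * m) * norm (integral {0..m} (G (apply_bcontfun u)))
        \<le> exp (- \<mu> * m) * ((norm (f 0) + L * norm u) / \<mu> * exp (\<mu> * m))"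
      by (rule mult_left_mono) simp
    also have "\<dots> = (norm (f 0) + L * norm u) / \<mu>"
    proof -
      have "exp (- \<mu> * m) * exp (\<mu> * m) = 1" by (simp flip: exp_add)
      thus ?thesis by (metis mult.left_commute mult.right_neutral)
    qed
    finally have 1: "exp (- \<mu> * m) * norm (integral {0..m} (G (apply_bcontfun u)))
        \<le> (norm (f 0) + L * norm u) / \<mu>" .
    have 2: "exp (- \<mu> * m) * norm y0 \<le> 1 * norm y0"
      using \<open>\<mu> > 0\<close> \<open>m \<ge> 0\<close> by (intro mult_right_mono) auto
    have "norm (P (apply_bcontfun u) t)
        \<le> exp (- \<mu> * m) * (norm y0 + norm (integral {0..m} (G (apply_bcontfun u))))"
      by (simp add: P_def m_def norm_triangle_ineq)
    thus ?thesis using 1 2 by (simp add: algebra_simps)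
  qed
  have P_mem: "P (apply_bcontfun u) \<in> bcontfun" for u :: "real \<Rightarrow>\<^sub>C 'a"
    by (rule bcontfun_normI[OF P_cont P_bnd])
  define T :: "(real \<Rightarrow>\<^sub>C 'a) \<Rightarrow> (real \<Rightarrow>\<^sub>C 'a)" where "T u = Bcontfun (P (apply_bcontfun u))" for u
  have T_apply: "apply_bcontfun (T u) = P (apply_bcontfun u)" for u
    unfolding T_def by (rule Bcontfun_inverse[OF P_mem])
  have contr: "dist (T u) (T v) \<le> 1/2 * dist u v" for u v
  proof (rule dist_bound)
    fix t :: real
    define m where "m = max 0 t"
    have "m \<ge> 0" by (simp add: m_def)
    have I: "integral {0..m} (G (apply_bcontfun u)) - integral {0..m} (G (apply_bcontfun v))
        = integral {0..m} (\<lambda>s. G (apply_bcontfun u) s - G (apply_bcontfun v) s)"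
      by (intro Henstock_Kurzweil_Integration.integral_diff[symmetric] integrable_continuous_real G_cont)
    have "norm (integral {0..m} (\<lambda>s. G (apply_bcontfun u) s - G (apply_bcontfun v) s))
        \<le> L * dist u v / \<mu> * exp (\<mu> * m)"
    proof (rule integral_exp_bound)
      show "continuous_on {0..m} (\<lambda>s. G (apply_bcontfun u) s - G (apply_bcontfun v) s)"
        by (intro continuous_intros G_cont)
      fix s assume s: "s \<in> {0..m}"
      have "norm (G (apply_bcontfun u) s - G (apply_bcontfun v) s)
          \<le> L * norm (exp (\<mu> * s) *\<^sub>R (u s - v s))"
        unfolding G_def using lip by (metis scaleR_diff_right)
      also have "\<dots> = L * dist (u s) (v s) * exp (\<mu> * s)" by (simp add: dist_norm)
      also have "\<dots> \<le> L * dist u v * exp (\<mu> * s)"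
        using \<open>L > 0\<close> dist_bounded[of u s v] by (intro mult_right_mono mult_left_mono) auto
      finally show "norm (G (apply_bcontfun u) s - G (apply_bcontfun v) s)
          \<le> L * dist u v * exp (\<mu> * s)" .
    qed (use \<open>\<mu> > 0\<close> \<open>L > 0\<close> \<open>m \<ge> 0\<close> in auto)
    hence "exp (- \<mu> * m) * norm (integral {0..m} (\<lambda>s. G (apply_bcontfun u) s - G (apply_bcontfun v) s))
        \<le> exp (- \<mu> * m) * (L * dist u v / \<mu> * exp (\<mu> * m))"
      by (rule mult_left_mono) simp
    also have "\<dots> = 1/2 * dist u v"
      using \<open>L > 0\<close> by (simp add: exp_minus field_simps \<mu>_def)
    finally have le: "exp (- \<mu> * m) * norm (integral {0..m} (\<lambda>s. G (apply_bcontfun u) s - G (apply_bcontfun v) s))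
        \<le> 1/2 * dist u v" .
    have "dist (P (apply_bcontfun u) t) (P (apply_bcontfun v) t) = norm (exp (- \<mu> * m) *\<^sub>R
        (integral {0..m} (G (apply_bcontfun u)) - integral {0..m} (G (apply_bcontfun v))))"
      by (simp add: P_def m_def dist_norm algebra_simps)
    also have "\<dots> \<le> 1/2 * dist u v" using le I by simp
    finally show "dist (apply_bcontfun (T u) t) (apply_bcontfun (T v) t) \<le> 1/2 * dist u v"
      by (simp add: T_apply)
  qed
  obtain u where u: "T u = u"
    using banach_fix_type[of "1/2" T] contr by auto
  define y where "y t = y0 + integral {0..t} (G (apply_bcontfun u))" for t
  have yu: "exp (\<mu> * t) *\<^sub>R u t = y t" if "t \<ge> 0" for t
  proof -
    have "u t = P (apply_bcontfun u) t" using T_apply[of u] u by simp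
    thus ?thesis using that by (simp add: P_def y_def exp_minus)
  qed
  show ?thesis
  proof (rule that[of y])
    show "y 0 = y0" by (simp add: y_def)
    fix t :: real assume "t \<ge> 0"
    have "((\<lambda>t. integral {0..t} (G (apply_bcontfun u))) has_vector_derivative
        G (apply_bcontfun u) t) (at t within {0..t+1})"
      using \<open>t \<ge> 0\<close> by (intro integral_has_vector_derivative G_cont) auto
    hence "((\<lambda>t. integral {0..t} (G (apply_bcontfun u))) has_vector_derivative
        G (apply_bcontfun u) t) (at t within {0..})"
      using at_within_nhd[of t "{..<t+1}" "{0..}" "{0..t+1}"] \<open>t \<ge> 0\<close> by force
    hence "(y has_vector_derivative G (apply_bcontfun u) t) (at t within {0..})"
      unfolding y_def by (auto intro!: derivative_eq_intros)
    thus "(y has_vector_derivative f (y t)) (at t within {0..})"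
      using yu[OF \<open>t \<ge> 0\<close>] by (simp add: G_def)
  qed
qed

text \<open>Composing \<open>f\<close> with the metric projection onto the ball, which is
  1-Lipschitz, gives a globally Lipschitz field. Its solution solves the original equation until it
  first reaches norm \<open>K\<close>, which the a priori bound forbids.\<close>

lemma global_solution_a_priori:
  fixes f :: "'a::euclidean_space \<Rightarrow> 'a"
  assumes lip: "\<And>x y. norm x \<le> K \<Longrightarrow> norm y \<le> K \<Longrightarrow> norm (f x - f y) \<le> L * norm (x - y)"
    and "L > 0" and "norm y0 < K"
    and apriori: "\<And>T y. T \<ge> 0 \<Longrightarrow> y 0 = y0 \<Longrightarrow>
      (\<And>t. t \<in> {0..T} \<Longrightarrow> (y has_vector_derivative f (y t)) (at t within {0..T})) \<Longrightarrow> norm (y T) < K"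
  obtains y where "y 0 = y0"
    "\<And>t. t \<ge> 0 \<Longrightarrow> (y has_vector_derivative f (y t)) (at t within {0..})"
proof -
  have "K > 0" using \<open>norm y0 < K\<close> norm_ge_zero[of y0] by linarith
  define \<pi> where "\<pi> = closest_point (cball (0::'a) K)"
  have ne: "convex (cball (0::'a) K)" "closed (cball (0::'a) K)" "cball (0::'a) K \<noteq> {}"
    using \<open>K > 0\<close> by auto
  have \<pi>_in: "norm (\<pi> x) \<le> K" for x
    using closest_point_in_set[OF ne(2,3), of x] by (simp add: \<pi>_def)
  have \<pi>_id: "\<pi> x = x" if "norm x \<le> K" for x
    using that by (simp add: \<pi>_def closest_point_self)
  have "norm (f (\<pi> x) - f (\<pi> y)) \<le> L * norm (x - y)" for x y
  proof -
    have "norm (f (\<pi> x) - f (\<pi> y)) \<le> L * norm (\<pi> x - \<pi> y)" by (rule lip[OF \<pi>_in \<pi>_in])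
    also have "\<dots> \<le> L * norm (x - y)"
      using closest_point_lipschitz[OF ne, of x y] \<open>L > 0\<close> by (simp add: \<pi>_def dist_norm)
    finally show ?thesis .
  qed
  then obtain y where y0: "y 0 = y0"
    and y: "\<And>t. t \<ge> 0 \<Longrightarrow> (y has_vector_derivative f (\<pi> (y t))) (at t within {0..})"
    using global_solution_lipschitz[of "f \<circ> \<pi>" L y0] \<open>L > 0\<close> by auto
  have cont: "continuous_on {0..t} (\<lambda>s. norm (y s))" for t
  proof -
    have "continuous_on {0..} y"
      using y has_vector_derivative_continuous
      by (fastforce simp: continuous_on_eq_continuous_within)
    thus ?thesis by (intro continuous_on_norm) (auto intro: continuous_on_subset)
  qed
  have "norm (y t) < K" if "t \<ge> 0" for t
  proof (rule ccontr)
    assume "\<not> norm (y t) < K"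
    have hit: "\<exists>s\<in>{0..r}. norm (y s) = K" if "r \<ge> 0" "norm (y r) \<ge> K" for r
      using IVT'[of "\<lambda>s. norm (y s)" 0 K r] cont[of r] that \<open>norm y0 < K\<close> y0 by auto
    define S where "S = {s\<in>{0..t}. norm (y s) = K}"
    have "compact S"
    proof -
      have "closed S" unfolding S_def
        using cont by (intro continuous_closed_preimage_constant) auto
      moreover have "bounded S" by (rule bounded_subset[of "{0..t}"]) (auto simp: S_def)
      ultimately show ?thesis by (simp add: compact_eq_bounded_closed)
    qed
    moreover have "S \<noteq> {}" using hit[OF \<open>t \<ge> 0\<close>] \<open>\<not> norm (y t) < K\<close> by (auto simp: S_def)
    ultimately obtain T where T: "T \<in> S" "\<And>s. s \<in> S \<Longrightarrow> T \<le> s"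
      using compact_attains_inf by metis
    \<comment> \<open>\<open>T\<close> is the first hitting time of the sphere, so the projection
      acts as the identity up to and including \<open>T\<close>, and the a priori bound applies
      there.\<close>
    have small: "norm (y s) \<le> K" if s: "s \<in> {0..T}" for s
    proof (rule ccontr)
      assume "\<not> norm (y s) \<le> K"
      then obtain r where "r \<in> {0..s}" "norm (y r) = K" using hit[of s] s by force
      moreover from this have "r \<in> S" using that T(1) by (auto simp: S_def)
      ultimately have "r = T" "r = s" using T(2) that by force+
      thus False using \<open>\<not> norm (y s) \<le> K\<close> \<open>norm (y r) = K\<close> by simp
    qed
    have "norm (y T) < K"
    proof (rule apriori)
      show "0 \<le> T" "y 0 = y0" using T(1) y0 by (auto simp: S_def)
      fix s assume s: "s \<in> {0..T}"
      show "(y has_vector_derivative f (y s)) (at s within {0..T})"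
        using has_vector_derivative_within_subset[OF y, of s "{0..T}"] \<pi>_id[OF small[OF s]] s by auto
    qed
    thus False using T(1) by (simp add: S_def)
  qed
  hence "\<pi> (y t) = y t" if "t \<ge> 0" for t using \<pi>_id that by (simp add: less_imp_le)
  thus ?thesis using that y0 y by simp
qed

text \<open>Gronwall read backwards: \<open>D' \<ge> - 2 * L * D\<close> for the squared distance,
  so \<open>D t * exp (2 * L * t)\<close> is nondecreasing. Initial data are thus controlled by
  later states without solving the equation backwards, which is the direction needed to pull null
  sets back to time 0.\<close>

lemma backward_lipschitz:
  fixes f :: "'a::euclidean_space \<Rightarrow> 'a"
  assumes lip: "\<And>x y. norm x \<le> K \<Longrightarrow> norm y \<le> K \<Longrightarrow> norm (f x - f y) \<le> L * norm (x - y)"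
    and p: "\<And>t. t \<ge> 0 \<Longrightarrow> (p has_vector_derivative f (p t)) (at t within {0..})"
      "\<And>t. t \<ge> 0 \<Longrightarrow> norm (p t) \<le> K"
    and q: "\<And>t. t \<ge> 0 \<Longrightarrow> (q has_vector_derivative f (q t)) (at t within {0..})"
      "\<And>t. t \<ge> 0 \<Longrightarrow> norm (q t) \<le> K"
    and "T \<ge> 0"
  shows "norm (p 0 - q 0) \<le> exp (L * T) * norm (p T - q T)"
proof -
  define D where "D t = (p t - q t) \<bullet> (p t - q t)" for t
  have "D 0 * exp (2 * L * 0) \<le> D T * exp (2 * L * T)"
  proof (rule nondecreasing_if_deriv_nonneg[where g = "\<lambda>t. D t * exp (2 * L * t)"])
    fix t assume t: "t \<in> {0..T}"
    have d: "((\<lambda>t. p t - q t) has_vector_derivative (f (p t) - f (q t))) (at t within {0..})"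
      using p(1) q(1) t by (intro has_vector_derivative_diff) auto
    have "(D has_real_derivative 2 * ((p t - q t) \<bullet> (f (p t) - f (q t)))) (at t within {0..})"
      unfolding D_def has_real_derivative_iff_has_vector_derivative
      using bounded_bilinear.has_vector_derivative[OF bounded_bilinear_inner d d]
      by (simp add: inner_commute)
    thus "((\<lambda>t. D t * exp (2 * L * t)) has_real_derivative
        (2 * ((p t - q t) \<bullet> (f (p t) - f (q t))) + 2 * L * D t) * exp (2 * L * t)) (at t within {0..})"
      by (auto intro!: derivative_eq_intros simp: algebra_simps)
    have "\<bar>(p t - q t) \<bullet> (f (p t) - f (q t))\<bar> \<le> norm (p t - q t) * (L * norm (p t - q t))"
      using p(2) q(2) t
      by (intro order_trans[OF Cauchy_Schwarz_ineq2] mult_left_mono lip) auto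
    hence "0 \<le> 2 * ((p t - q t) \<bullet> (f (p t) - f (q t))) + 2 * L * D t"
      by (simp add: D_def dot_square_norm power2_eq_square algebra_simps abs_le_iff)
    thus "0 \<le> (2 * ((p t - q t) \<bullet> (f (p t) - f (q t))) + 2 * L * D t) * exp (2 * L * t)" by simp
  qed (use \<open>T \<ge> 0\<close> in auto)
  also have "exp (2 * L * T) = (exp (L * T))\<^sup>2" by (simp add: exp_double[symmetric] mult.assoc)
  finally have "(norm (p 0 - q 0))\<^sup>2 \<le> (exp (L * T) * norm (p T - q T))\<^sup>2"
    by (simp add: D_def dot_square_norm power_mult_distrib algebra_simps)
  thus ?thesis by (rule power2_le_imp_le) simp
qed

text \<open>The estimate with \<open>g y = g x\<close> makes \<open>g\<close> injective, and in
  general it makes the inverse pointwise Lipschitz. So \<open>S\<close> is a locally Lipschitz image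
  of a null set, in a space of the same dimension.\<close>

lemma negligible_if_locally_bilipschitz_into_negligible:
  fixes g :: "'a::euclidean_space \<Rightarrow> 'a"
  assumes "g ` S \<subseteq> N" "negligible N"
    and inv: "\<And>x. x \<in> S \<Longrightarrow> \<exists>d B. d > 0 \<and>
      (\<forall>y\<in>S. norm (g y - g x) < d \<longrightarrow> norm (y - x) \<le> B * norm (g y - g x))"
  shows "negligible S"
proof -
  have inj: "inj_on g S"
  proof (rule inj_onI)
    fix x y assume "x \<in> S" "y \<in> S" "g x = g y"
    thus "x = y" using inv[of x] by force
  qed
  define h where "h = the_inv_into S g"
  have h: "h (g x) = x" if "x \<in> S" for x
    using the_inv_into_f_f[OF inj that] by (simp add: h_def)
  have "negligible (h ` (g ` S))"
  proof (rule negligible_locally_Lipschitz_image)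
    show "negligible (g ` S)" using assms negligible_subset by blast
    fix z assume "z \<in> g ` S"
    then obtain x where x: "x \<in> S" "z = g x" by blast
    then obtain d B where "d > 0"
      and B: "\<And>y. y \<in> S \<Longrightarrow> norm (g y - g x) < d \<Longrightarrow> norm (y - x) \<le> B * norm (g y - g x)"
      using inv by metis
    have "\<forall>y\<in>g ` S \<inter> ball z d. norm (h y - h z) \<le> B * norm (y - z)"
      using B x h by (auto simp: dist_norm norm_minus_commute)
    thus "\<exists>T B. open T \<and> z \<in> T \<and> (\<forall>y\<in>g ` S \<inter> T. norm (h y - h z) \<le> B * norm (y - z))"
      using \<open>d > 0\<close> by (intro exI[of _ "ball z d"] exI[of _ B]) auto
  qed simp
  moreover have "h ` (g ` S) = S" using h by force
  ultimately show ?thesis by simp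
qed

subsection \<open>Rotation matrices\<close>

lemma inner_mat3: "(A::real^3^3) \<bullet> B = A$1$1 * B$1$1 + A$1$2 * B$1$2 + A$1$3 * B$1$3
   + A$2$1 * B$2$1 + A$2$2 * B$2$2 + A$2$3 * B$2$3 + A$3$1 * B$3$1 + A$3$2 * B$3$2 + A$3$3 * B$3$3"
  by (simp add: inner_vec_def sum_3)

lemma inner_vec3: "(x::real^3) \<bullet> y = x$1 * y$1 + x$2 * y$2 + x$3 * y$3"
  by (simp add: inner_vec_def sum_3)

lemma mat_eq_3: "(A::real^3^3) = B \<longleftrightarrow> A$1$1 = B$1$1 \<and> A$1$2 = B$1$2 \<and> A$1$3 = B$1$3
   \<and> A$2$1 = B$2$1 \<and> A$2$2 = B$2$2 \<and> A$2$3 = B$2$3 \<and> A$3$1 = B$3$1 \<and> A$3$2 = B$3$2 \<and> A$3$3 = B$3$3"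
  by (auto simp: vec_eq_iff forall_3)

lemma vec_eq_3: "(x::real^3) = y \<longleftrightarrow> x$1 = y$1 \<and> x$2 = y$2 \<and> x$3 = y$3"
  by (auto simp: vec_eq_iff forall_3)

lemma skew_nth [simp]:
  "skew v $ 1 $ 1 = 0" "skew v $ 1 $ 2 = - v$3" "skew v $ 1 $ 3 = v$2"
  "skew v $ 2 $ 1 = v$3" "skew v $ 2 $ 2 = 0" "skew v $ 2 $ 3 = - v$1"
  "skew v $ 3 $ 1 = - v$2" "skew v $ 3 $ 2 = v$1" "skew v $ 3 $ 3 = 0"
  by (simp_all add: skew_def vector_3)

lemma eR_nth [simp]:
  "eR M $ 1 = (M$3$2 - M$2$3) / 2" "eR M $ 2 = (M$1$3 - M$3$1) / 2" "eR M $ 3 = (M$2$1 - M$1$2) / 2"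
  by (simp_all add: eR_def vee_def vector_3 transpose_def)

lemma mult_nth_3: "((A::real^3^3) ** B) $ i $ j = A$i$1 * B$1$j + A$i$2 * B$2$j + A$i$3 * B$3$j"
  by (simp add: matrix_matrix_mult_def sum_3)

lemma transpose_nth: "transpose A $ i $ j = A $ j $ i"
  by (simp add: transpose_def)

lemma mat_nth: "mat c $ i $ j = (if i = j then c else 0)"
  by (simp add: mat_def)

lemma Psi_eq: "Psi M = (3 - M$1$1 - M$2$2 - M$3$3) / 2"
  by (simp add: Psi_def trace_def sum_3 mat_nth field_simps)

lemma linear_eR: "linear eR"
  by (rule linearI) (simp_all add: vec_eq_3 field_simps)

lemma linear_skew: "linear skew"
  by (rule linearI) (simp_all add: mat_eq_3)

lemma bounded_linear_eR: "bounded_linear eR"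
  using linear_eR by (simp add: linear_conv_bounded_linear)

lemma transpose_skew: "transpose (skew w) = - skew w"
  by (simp add: mat_eq_3 transpose_nth)

lemma eR_skew [simp]: "eR (skew w) = w"
  by (simp add: vec_eq_3)

lemma skew_eR: "skew (eR M) = (1/2) *\<^sub>R (M - transpose M)"
  by (simp add: mat_eq_3 transpose_nth field_simps)

lemma norm_skew: "(norm (skew w))\<^sup>2 = 2 * (norm w)\<^sup>2"
  by (simp add: power2_norm_eq_inner inner_mat3 inner_vec3)

lemma eR_mat_1 [simp]: "eR (mat 1) = 0"
  by (simp add: vec_eq_3 mat_nth)

lemma norm_skew_le: "norm (skew v) \<le> 2 * norm v"
  by (rule power2_le_imp_le) (auto simp: power_mult_distrib norm_skew)

lemma norm_eR: "2 * (norm (eR M))\<^sup>2 \<le> (norm M)\<^sup>2"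
proof -
  have *: "2 * ((a - b) / 2 * ((a - b) / 2)) \<le> a * a + b * b" for a b :: real
    using zero_le_square[of "a + b"] zero_le_square[of a] zero_le_square[of b]
    by (simp add: field_simps)
  have "0 \<le> M$1$1 * M$1$1 + M$2$2 * M$2$2 + M$3$3 * M$3$3" by simp
  with *[of "M$3$2" "M$2$3"] *[of "M$1$3" "M$3$1"] *[of "M$2$1" "M$1$2"] show ?thesis
    unfolding power2_norm_eq_inner inner_mat3 inner_vec3 eR_nth distrib_left by linarith
qed

lemma norm_eR_le: "norm (eR M) \<le> norm M"
proof (rule power2_le_imp_le)
  show "(norm (eR M))\<^sup>2 \<le> (norm M)\<^sup>2"
    using norm_eR[of M] zero_le_power2[of "norm (eR M)"] by linarith
qed simp

section \<open>Norms and products of matrices\<close>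

lemma inner_matrix_trace: "A \<bullet> B = trace (transpose A ** (B::real^'m^'n))"
  by (simp add: inner_vec_def trace_def matrix_matrix_mult_def transpose_def) (rule sum.swap)

lemma norm_orthogonal_mult:
  fixes R :: "real^'n^'n" and M :: "real^'m^'n"
  assumes "transpose R ** R = mat 1"
  shows "norm (R ** M) = norm M"
proof -
  have "transpose (R ** M) ** (R ** M) = transpose M ** ((transpose R ** R) ** M)"
    by (simp only: matrix_transpose_mul matrix_mul_assoc)
  thus ?thesis by (simp add: norm_eq_sqrt_inner inner_matrix_trace assms)
qed

text \<open>The factors 2 in \<open>norm_eR\<close> and \<open>norm_skew\<close> cancel. Along R' =
  R w^x the left side is the speed of e_R, so this supplies the admissible \<open>u\<close> of the
  dissipation inequality.\<close>

lemma norm_eR_skew_mult_le: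
  assumes "transpose R ** R = mat 1"
  shows "norm (eR (R ** skew w)) \<le> norm w"
proof (rule power2_le_imp_le)
  show "(norm (eR (R ** skew w)))\<^sup>2 \<le> (norm w)\<^sup>2"
    using norm_eR[of "R ** skew w"] norm_skew[of w] by (simp add: norm_orthogonal_mult[OF assms])
qed simp

lemma norm_transpose: "norm (transpose (A::real^'m^'n)) = norm A"
  by (simp add: norm_eq_sqrt_inner inner_vec_def transpose_def) (rule sum.swap)

lemma norm_matrix_mult_le: "norm ((A::real^'m^'n) ** (B::real^'k^'m)) \<le> norm A * norm B"
proof (rule power2_le_imp_le)
  have "(norm (A ** B))\<^sup>2 = (\<Sum>i\<in>UNIV. \<Sum>j\<in>UNIV. (row i A \<bullet> column j B)\<^sup>2)"
    unfolding power2_norm_eq_inner inner_vec_def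
    by (simp add: matrix_matrix_mult_def row_def column_def power2_eq_square)
  also have "\<dots> \<le> (\<Sum>i\<in>UNIV. \<Sum>j\<in>UNIV. (row i A \<bullet> row i A) * (column j B \<bullet> column j B))"
    by (intro sum_mono Cauchy_Schwarz_ineq)
  also have "\<dots> = (norm A)\<^sup>2 * (\<Sum>j\<in>UNIV. column j B \<bullet> column j B)"
    unfolding power2_norm_eq_inner inner_vec_def[of A A] by (simp add: inner_vec_def row_def sum_product)
  also have "(\<Sum>j\<in>UNIV. column j B \<bullet> column j B) = (norm B)\<^sup>2"
    unfolding power2_norm_eq_inner by (simp add: inner_vec_def column_def) (rule sum.swap)
  finally show "(norm (A ** B))\<^sup>2 \<le> (norm A * norm B)\<^sup>2" by (simp add: power_mult_distrib)
qed simp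

lemma matrix_add_rdistrib: "((A::real^'m^'n) + B) ** (C::real^'k^'m) = A ** C + B ** C"
  by (simp add: matrix_matrix_mult_def vec_eq_iff algebra_simps sum.distrib)

lemma bounded_bilinear_matrix_mult: "bounded_bilinear (\<lambda>(A::real^'m^'n) (B::real^'k^'m). A ** B)"
proof (rule bounded_bilinear.intro)
  show "\<exists>K. \<forall>(a::real^'m^'n) (b::real^'k^'m). norm (a ** b) \<le> norm a * norm b * K"
    by (intro exI[of _ 1]) (simp add: norm_matrix_mult_le)
  show "(a + a') ** b = a ** b + a' ** b" for a a' :: "real^'m^'n" and b :: "real^'k^'m"
    by (rule matrix_add_rdistrib)
  show "a ** (b + b') = a ** b + a ** b'" for a :: "real^'m^'n" and b b' :: "real^'k^'m"
    by (rule matrix_add_ldistrib)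
qed (auto simp: matrix_matrix_mult_def vec_eq_iff sum_distrib_left ac_simps)

lemmas matrix_mult_scaleR_left = bounded_bilinear.scaleR_left[OF bounded_bilinear_matrix_mult]
  and matrix_mult_scaleR_right = bounded_bilinear.scaleR_right[OF bounded_bilinear_matrix_mult]

section \<open>Polynomial identities for rotations\<close>

lemma SO3_D:
  assumes "R \<in> SO3"
  shows "transpose R ** R = mat 1" "det R = 1" "R ** transpose R = mat 1"
  using assms by (auto simp: SO3_def matrix_left_right_inverse)

lemma SO3_transpose_mult:
  assumes "A \<in> SO3" "B \<in> SO3" shows "transpose A ** B \<in> SO3"
proof -
  have "transpose (transpose A ** B) ** (transpose A ** B) = transpose B ** ((A ** transpose A) ** B)"
    by (simp only: matrix_transpose_mul transpose_transpose matrix_mul_assoc)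
  also have "\<dots> = mat 1" using SO3_D[OF assms(1)] SO3_D[OF assms(2)] by simp
  finally show ?thesis using SO3_D[OF assms(1)] SO3_D[OF assms(2)] by (simp add: SO3_def det_mul)
qed

lemma SO3_norm_sq: assumes "R \<in> SO3" shows "R \<bullet> R = 3"
  using SO3_D(1)[OF assms] by (simp add: inner_matrix_trace trace_def sum_3 mat_nth)

text \<open>A rotation is its own cofactor matrix, because it commutes with the cross product: the
  cross product of two columns is the third. Minors thereby become entries, so later identities are
  linear.\<close>

lemma SO3_cofactor:
  assumes "R \<in> SO3"
  shows "R$1$1 = R$2$2 * R$3$3 - R$2$3 * R$3$2" "R$2$2 = R$1$1 * R$3$3 - R$1$3 * R$3$1"
    "R$3$3 = R$1$1 * R$2$2 - R$1$2 * R$2$1"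
    "R$1$2 = R$2$3 * R$3$1 - R$2$1 * R$3$3" "R$1$3 = R$2$1 * R$3$2 - R$2$2 * R$3$1"
    "R$2$3 = R$1$2 * R$3$1 - R$1$1 * R$3$2"
proof -
  have orth: "orthogonal_matrix R" using SO3_D(1)[OF assms] by (simp add: orthogonal_matrix)
  have c: "cross3 (column i R) (column j R) = R *v cross3 (axis i 1) (axis j 1)" for i j
    using cross_orthogonal_matrix[OF orth, of "axis i 1" "axis j 1"] SO3_D(2)[OF assms]
    by (simp add: matrix_vector_mul_component matrix_vector_mult_basis)
  have ax: "cross3 (axis 1 1) (axis 2 1) = axis 3 1" "cross3 (axis 2 1) (axis 3 1) = axis 1 1"
    "cross3 (axis 3 1) (axis 1 1) = axis (2::3) 1"
    by (simp_all add: cross3_def vec_eq_3 axis_def)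
  have "cross3 (column 1 R) (column 2 R) = column 3 R" "cross3 (column 2 R) (column 3 R) = column 1 R"
    "cross3 (column 3 R) (column 1 R) = column 2 R"
    using c[of 1 2] c[of 2 3] c[of 3 1] unfolding ax by (simp_all only: matrix_vector_mult_basis)
  hence "R$2$1 * R$3$2 - R$3$1 * R$2$2 = R$1$3 \<and> R$1$1 * R$2$2 - R$2$1 * R$1$2 = R$3$3 \<and>
      R$2$2 * R$3$3 - R$3$2 * R$2$3 = R$1$1 \<and> R$3$3 * R$1$1 - R$1$3 * R$3$1 = R$2$2 \<and>
      R$2$3 * R$3$1 - R$3$3 * R$2$1 = R$1$2 \<and> R$3$1 * R$1$2 - R$1$1 * R$3$2 = R$2$3"
    by (simp add: cross3_def vec_eq_3 column_def)
  thus "R$1$1 = R$2$2 * R$3$3 - R$2$3 * R$3$2" "R$2$2 = R$1$1 * R$3$3 - R$1$3 * R$3$1"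
    "R$3$3 = R$1$1 * R$2$2 - R$1$2 * R$2$1"
    "R$1$2 = R$2$3 * R$3$1 - R$2$1 * R$3$3" "R$1$3 = R$2$1 * R$3$2 - R$2$2 * R$3$1"
    "R$2$3 = R$1$2 * R$3$1 - R$1$1 * R$3$2"
    by (simp_all only: mult.commute)
qed

lemma SO3_norm_diff:
  assumes "R \<in> SO3" shows "(norm (R - mat 1))\<^sup>2 = 4 * Psi R"
  using SO3_norm_sq[OF assms]
  by (simp add: power2_norm_eq_inner inner_diff_left inner_diff_right Psi_eq inner_mat3[of _ "mat 1"]
      inner_mat3[of "mat 1"] mat_nth)

text \<open>In terms of the rotation angle both sides are the square of its sine. The angle is
  avoided: after expansion the principal minors are diagonal entries by \<open>SO3_cofactor\<close>,
  and \<open>R \<bullet> R = 3\<close> removes the rest.\<close>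

lemma SO3_norm_eR:
  assumes "R \<in> SO3" shows "(norm (eR R))\<^sup>2 = Psi R * (2 - Psi R)"
proof -
  define t where "t = R$1$1 + R$2$2 + R$3$3"
  have "4 * (norm (eR R))\<^sup>2 - 4 * (Psi R * (2 - Psi R))
      = R \<bullet> R - 3 - 2 * t + 2 * (R$1$1 * R$2$2 - R$1$2 * R$2$1)
        + 2 * (R$1$1 * R$3$3 - R$1$3 * R$3$1) + 2 * (R$2$2 * R$3$3 - R$2$3 * R$3$2)"
    unfolding power2_norm_eq_inner inner_vec3 inner_mat3 Psi_eq eR_nth t_def
    by (simp add: field_simps)
  also have "\<dots> = 0"
    unfolding SO3_cofactor(1,2,3)[OF assms, symmetric] SO3_norm_sq[OF assms] t_def by simp
  finally show ?thesis by simp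
qed

lemma SO3_Psi_bounds:
  assumes "R \<in> SO3" shows "0 \<le> Psi R" "Psi R \<le> 2"
proof -
  show "0 \<le> Psi R" using SO3_norm_diff[OF assms] zero_le_power2[of "norm (R - mat 1)"] by linarith
  have "0 \<le> Psi R * (2 - Psi R)" using SO3_norm_eR[OF assms] by (metis zero_le_power2)
  thus "Psi R \<le> 2" using \<open>0 \<le> Psi R\<close> by (auto simp: zero_le_mult_iff)
qed

section \<open>Rodrigues rotations and the zeros of \<open>eR\<close>\<close>

lemma rodrigues_nth:
  "rodrigues \<alpha> \<theta> $ i $ j = mat 1 $ i $ j + sin \<theta> * skew \<alpha> $ i $ j + (1 - cos \<theta>) * (skew \<alpha> ** skew \<alpha>) $ i $ j"
  by (simp add: rodrigues_def)

lemma eR_rodrigues: "eR (rodrigues \<alpha> \<theta>) = sin \<theta> *\<^sub>R \<alpha>"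
  by (simp add: vec_eq_3 rodrigues_nth mat_nth mult_nth_3)

lemma Psi_rodrigues:
  assumes "norm \<alpha> = 1" shows "Psi (rodrigues \<alpha> \<theta>) = 1 - cos \<theta>"
proof -
  have "Psi (rodrigues \<alpha> \<theta>) = (1 - cos \<theta>) * (\<alpha> \<bullet> \<alpha>)"
    by (simp add: Psi_eq rodrigues_nth mat_nth mult_nth_3 inner_vec3 field_simps)
  thus ?thesis using assms by (simp add: norm_eq_1)
qed

text \<open>First variation of e_R at a half-turn. Variations \<zeta> orthogonal to \<alpha> only
  tilt the axis, hence stay among the half-turns to first order and are invisible.\<close>

lemma eR_rodrigues_pi_skew:
  assumes "norm \<alpha> = 1" shows "eR (rodrigues \<alpha> pi ** skew \<zeta>) = - (\<alpha> \<bullet> \<zeta>) *\<^sub>R \<alpha>"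
proof -
  have "eR (rodrigues \<alpha> pi ** skew \<zeta>) = (1 - \<alpha> \<bullet> \<alpha>) *\<^sub>R \<zeta> - (\<alpha> \<bullet> \<zeta>) *\<^sub>R \<alpha>"
    by (simp add: vec_eq_3 rodrigues_nth mat_nth mult_nth_3 inner_vec3 field_simps)
  thus ?thesis using assms by (simp add: norm_eq_1)
qed

lemma rodrigues_SO3:
  assumes "norm \<alpha> = 1" shows "rodrigues \<alpha> \<theta> \<in> SO3"
proof -
  define s c where "s = sin \<theta>" and "c = 1 - cos \<theta>"
  define S where "S = skew \<alpha>"
  have sc: "s * s = c + c - c * c"
    using sin_cos_squared_add[of \<theta>] by (simp add: s_def c_def power2_eq_square algebra_simps)
  \<comment> \<open>The Cayley-Hamilton identity of a skew matrix; it reduces the product below to a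
    combination of 1, \<open>S\<close> and \<open>S ** S\<close>.\<close>
  have "S ** (S ** S) = - (\<alpha> \<bullet> \<alpha>) *\<^sub>R S"
    by (simp add: S_def mat_eq_3 mult_nth_3 inner_vec3 algebra_simps)
  hence S3: "S ** (S ** S) = (-1) *\<^sub>R S" using assms by (simp add: norm_eq_1)
  have S4: "S ** (S ** (S ** S)) = - (S ** S)"
    unfolding S3 matrix_mult_scaleR_right by simp
  have expand: "(mat 1 + t *\<^sub>R S + c *\<^sub>R (S ** S)) ** (mat 1 + s *\<^sub>R S + c *\<^sub>R (S ** S))
      = mat 1 + (t + s) *\<^sub>R S + (c + c + t * s) *\<^sub>R (S ** S)
        + (c * (t + s)) *\<^sub>R (S ** (S ** S)) + (c * c) *\<^sub>R (S ** (S ** (S ** S)))" for t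
    by (simp only: matrix_add_ldistrib matrix_add_rdistrib matrix_mult_scaleR_left
        matrix_mult_scaleR_right matrix_mul_assoc[symmetric] scaleR_add_left scaleR_add_right
        scaleR_scaleR matrix_mul_lid matrix_mul_rid distrib_left ac_simps)
  have "(mat 1 + (- s) *\<^sub>R S + c *\<^sub>R (S ** S)) ** (mat 1 + s *\<^sub>R S + c *\<^sub>R (S ** S)) = mat 1"
    unfolding expand S4 using sc by (simp flip: scaleR_add_left)
  also have "mat 1 + (- s) *\<^sub>R S + c *\<^sub>R (S ** S) = transpose (rodrigues \<alpha> \<theta>)"
    by (simp add: rodrigues_def S_def s_def c_def mat_eq_3 transpose_nth mult_nth_3 mat_nth)
  finally have "transpose (rodrigues \<alpha> \<theta>) ** rodrigues \<alpha> \<theta> = mat 1"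
    by (simp add: rodrigues_def S_def s_def c_def)
  moreover have "det (rodrigues \<alpha> \<theta>) = 1"
  proof -
    have "det (rodrigues \<alpha> \<theta>) = (1 - c * (\<alpha> \<bullet> \<alpha>))\<^sup>2 + s * s * (\<alpha> \<bullet> \<alpha>)"
      by (simp add: det_3 rodrigues_nth mult_nth_3 mat_nth s_def[symmetric] c_def[symmetric] inner_vec3
          power2_eq_square algebra_simps)
    thus ?thesis using assms sc by (simp add: norm_eq_1 power2_eq_square algebra_simps)
  qed
  ultimately show ?thesis by (simp add: SO3_def)
qed

text \<open>The symmetric matrix with diagonal \<open>p, q, r\<close> and off-diagonal
  \<open>u, v, s\<close> has rank one; dividing its first row by \<open>sqrt p\<close> gives its
  factor.\<close>

lemma rank_one_psd_3:
  fixes p q r u v s :: real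
  assumes "p > 0" "p * q = u * u" "p * r = v * v" "p * s = u * v"
  shows "\<exists>a b c. a * a = p \<and> b * b = q \<and> c * c = r \<and> a * b = u \<and> a * c = v \<and> b * c = s"
  using assms
  by (intro exI[of _ "sqrt p"] exI[of _ "u / sqrt p"] exI[of _ "v / sqrt p"])
    (simp add: field_simps)

lemma SO3_eR_eq_0:
  assumes R: "R \<in> SO3" and "eR R = 0"
  shows "Psi R = 0 \<and> R = mat 1 \<or> Psi R = 2 \<and> (\<exists>\<alpha>. norm \<alpha> = 1 \<and> R = rodrigues \<alpha> pi)"
proof -
  have sym: "R$3$2 = R$2$3" "R$3$1 = R$1$3" "R$2$1 = R$1$2"
    using \<open>eR R = 0\<close> by (simp_all add: vec_eq_3)
  have "Psi R * (2 - Psi R) = 0" using SO3_norm_eR[OF R] \<open>eR R = 0\<close> by simp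
  then consider "Psi R = 0" | "Psi R = 2" by force
  thus ?thesis
  proof cases
    case 1
    thus ?thesis using SO3_norm_diff[OF R] by simp
  next
    case 2
    \<comment> \<open>These are the entries of (R + I) / 2, which for a half-turn about \<alpha> is
      the projection onto its axis. The axis is recovered as the rank-one factor.\<close>
    define p q r u v s where "p = (R$1$1 + 1) / 2" and "q = (R$2$2 + 1) / 2" and "r = (R$3$3 + 1) / 2"
      and "u = R$1$2 / 2" and "v = R$1$3 / 2" and "s = R$2$3 / 2"
    note defs = p_def q_def r_def u_def v_def s_def
    have tr: "R$1$1 + R$2$2 + R$3$3 = -1" using 2 by (simp add: Psi_eq)
    have "4 * (p * q) - 4 * (u * u) = R$1$1 * R$2$2 - R$1$2 * R$1$2 + R$1$1 + R$2$2 + 1"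
      "4 * (p * r) - 4 * (v * v) = R$1$1 * R$3$3 - R$1$3 * R$1$3 + R$1$1 + R$3$3 + 1"
      "4 * (q * r) - 4 * (s * s) = R$2$2 * R$3$3 - R$2$3 * R$2$3 + R$2$2 + R$3$3 + 1"
      "4 * (p * s) - 4 * (u * v) = R$2$3 - (R$1$2 * R$1$3 - R$1$1 * R$2$3)"
      "4 * (q * v) - 4 * (u * s) = R$1$3 - (R$1$2 * R$2$3 - R$2$2 * R$1$3)"
      "4 * (r * u) - 4 * (v * s) = R$1$2 - (R$2$3 * R$1$3 - R$1$2 * R$3$3)"
      by (simp_all add: defs field_simps)
    moreover note SO3_cofactor[OF R, unfolded sym] tr
    ultimately have minors: "p * q = u * u" "p * r = v * v" "q * r = s * s" "p * s = u * v"
      "q * v = u * s" "r * u = v * s"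
      by - linarith+
    have "p + q + r = 1" using tr by (simp add: defs field_simps)
    \<comment> \<open>The trace is 1, so some diagonal entry can serve as the pivot of
      \<open>rank_one_psd_3\<close>; the other two cases only permute coordinates.\<close>
    then consider "p > 0" | "q > 0" | "r > 0" by linarith
    hence "\<exists>a b c. a * a = p \<and> b * b = q \<and> c * c = r \<and> a * b = u \<and> a * c = v \<and> b * c = s"
    proof cases
      case 1
      thus ?thesis using rank_one_psd_3[of p q u r v s] minors by simp
    next
      case 2
      then obtain b a c where "b * b = q" "a * a = p" "c * c = r" "b * a = u" "b * c = s" "a * c = v"
        using rank_one_psd_3[of q p u r s v] minors by (auto simp: mult.commute)
      thus ?thesis by (intro exI[of _ a] exI[of _ b] exI[of _ c]) (simp add: mult.commute)
    next
      case 3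
      then obtain c a b where "c * c = r" "a * a = p" "b * b = q" "c * a = v" "c * b = s" "a * b = u"
        using rank_one_psd_3[of r p v q s u] minors by (auto simp: mult.commute)
      thus ?thesis by (intro exI[of _ a] exI[of _ b] exI[of _ c]) (simp add: mult.commute)
    qed
    then obtain a b c where abc: "a * a = p" "b * b = q" "c * c = r" "a * b = u" "a * c = v" "b * c = s"
      by blast
    define \<alpha> :: "real^3" where "\<alpha> = vector [a, b, c]"
    have "\<alpha> \<bullet> \<alpha> = 1" using abc \<open>p + q + r = 1\<close> by (simp add: \<alpha>_def inner_vec3)
    moreover have "R = rodrigues \<alpha> pi"
      using abc tr sym
      by (simp add: mat_eq_3 rodrigues_nth mult_nth_3 mat_nth \<alpha>_def mult.commute[of b a]
          mult.commute[of c a] mult.commute[of c b]) (simp add: defs field_simps)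
    ultimately show ?thesis using 2 by (auto simp: norm_eq_1)
  qed
qed

text \<open>On a small ball around the identity, differences of rotations are almost skew:
  \<open>X + X\<^sup>T = - X\<^sup>T X\<close> for \<open>X = A - I\<close>.\<close>

lemma SO3_diff_almost_skew:
  assumes "A \<in> SO3" "B \<in> SO3" "norm (A - mat 1) \<le> r" "norm (B - mat 1) \<le> r"
  shows "norm (A - B - skew (eR (A - B))) \<le> r * norm (A - B)"
proof -
  define X Y where "X = A - mat 1" and "Y = B - mat 1"
  have sym: "M + transpose M = - (transpose M ** M)" if "C \<in> SO3" "M = C - mat 1" for C M :: "real^3^3"
  proof -
    have "transpose (M + mat 1) ** (M + mat 1) = mat 1" using SO3_D(1)[OF that(1)] that(2) by simp
    moreover have "transpose (M + mat 1) = transpose M + mat 1"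
      by (auto simp: vec_eq_iff transpose_nth mat_nth)
    ultimately have "transpose M ** M + (M + transpose M) = 0"
      by (simp add: matrix_add_ldistrib matrix_add_rdistrib algebra_simps)
    thus ?thesis by (simp add: eq_neg_iff_add_eq_0 add.commute)
  qed
  have "A - B = X - Y" by (simp add: X_def Y_def)
  have "2 *\<^sub>R (X - Y - skew (eR (X - Y))) = (X + transpose X) - (Y + transpose Y)"
    by (simp add: skew_eR mat_eq_3 transpose_nth field_simps)
  \<comment> \<open>Polarization: the difference of the two quadratic terms is written with a factor
    \<open>X - Y\<close> in each summand, the remaining factor being at most
    \<open>r\<close>.\<close>
  also have "\<dots> = - (transpose X ** (X - Y)) - transpose (X - Y) ** Y"
    unfolding sym[OF assms(1) X_def] sym[OF assms(2) Y_def]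
    by (simp add: mat_eq_3 mult_nth_3 transpose_nth algebra_simps)
  finally have "2 * norm (X - Y - skew (eR (X - Y)))
      = norm (- (transpose X ** (X - Y)) - transpose (X - Y) ** Y)"
    by (metis norm_scaleR abs_numeral)
  also have "\<dots> \<le> norm (transpose X ** (X - Y)) + norm (transpose (X - Y) ** Y)"
    by (rule norm_triangle_le_diff) simp
  also have "\<dots> \<le> norm X * norm (X - Y) + norm (X - Y) * norm Y"
    by (intro add_mono order_trans[OF norm_matrix_mult_le]) (simp_all add: norm_transpose)
  also have "\<dots> \<le> r * norm (X - Y) + norm (X - Y) * r"
    using assms by (intro add_mono mult_right_mono mult_left_mono) (auto simp: X_def Y_def)
  finally show ?thesis by (simp add: \<open>A - B = X - Y\<close>)
qed

subsection \<open>Quadratic forms of block matrices\<close>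

declare transpose_matrix_vector [simp del]

lemma inner_transpose_right: "y \<bullet> (transpose A *v z) = (A *v y) \<bullet> (z::real^'n)"
  by (metis inner_commute dot_lmul_matrix transpose_matrix_vector)

lemma inner_transpose_left: "(transpose A *v z) \<bullet> y = z \<bullet> (A *v (y::real^'n))"
  using inner_transpose_right[of y A z] by (simp add: inner_commute)

lemma inner_sym_mat: "sym_mat A \<Longrightarrow> y \<bullet> (A *v z) = (A *v y) \<bullet> z"
  using inner_transpose_right[of y A z] by (simp add: sym_mat_def)

lemma pos_def_coercive:
  fixes A :: "real^'n^'n"
  assumes "pos_def A"
  obtains k where "k > 0" "\<And>x. k * (norm x)\<^sup>2 \<le> x \<bullet> (A *v x)"
proof -
  have "continuous_on (sphere 0 1) (\<lambda>x. x \<bullet> (A *v x))"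
    by (intro continuous_intros)
  moreover have "axis undefined 1 \<in> sphere (0::real^'n) 1" by simp
  ultimately obtain y where y: "y \<in> sphere 0 1" "\<And>x. x \<in> sphere 0 1 \<Longrightarrow> y \<bullet> (A *v y) \<le> x \<bullet> (A *v x)"
    using continuous_attains_inf[of "sphere (0::real^'n) 1" "\<lambda>x. x \<bullet> (A *v x)"] by auto
  show ?thesis
  proof
    have "y \<noteq> 0" using y(1) by auto
    thus "y \<bullet> (A *v y) > 0" using assms by (simp add: pos_def_def)
    fix x :: "real^'n"
    show "y \<bullet> (A *v y) * (norm x)\<^sup>2 \<le> x \<bullet> (A *v x)"
    proof (cases "x = 0")
      case False
      have "(r *\<^sub>R s) \<bullet> (A *v (r *\<^sub>R s)) = r\<^sup>2 * (s \<bullet> (A *v s))" for r s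
        by (simp add: matrix_vector_mult_scaleR power2_eq_square)
      from this[of "norm x" "sgn x"] have "x \<bullet> (A *v x) = (norm x)\<^sup>2 * (sgn x \<bullet> (A *v sgn x))"
        using False by (simp add: sgn_div_norm)
      moreover have "y \<bullet> (A *v y) \<le> sgn x \<bullet> (A *v sgn x)" using False by (intro y(2)) (simp add: norm_sgn)
      ultimately show ?thesis by (metis mult.commute mult_left_mono zero_le_power2)
    qed simp
  qed
qed

definition join3 :: "real^'a \<Rightarrow> real^'b \<Rightarrow> real^'c \<Rightarrow> real^('a + 'b + 'c)" where
  "join3 e w x = (\<chi> i. case i of Inl a \<Rightarrow> e $ a | Inr (Inl b) \<Rightarrow> w $ b | Inr (Inr c) \<Rightarrow> x $ c)"

lemma sum_UNIV_Plus: "(\<Sum>i\<in>(UNIV::('a::finite + 'b::finite) set). f i) = (\<Sum>a\<in>UNIV. f (Inl a)) + (\<Sum>b\<in>UNIV. f (Inr b))"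
  unfolding UNIV_Plus_UNIV[symmetric] by (subst sum.Plus) (auto simp: o_def)

lemma inner_join3: "join3 e w x \<bullet> join3 e' w' x' = e \<bullet> e' + w \<bullet> w' + x \<bullet> x'"
  by (simp add: inner_vec_def sum_UNIV_Plus join3_def)

lemma norm_join3: "(norm (join3 e w x))\<^sup>2 = (norm e)\<^sup>2 + (norm w)\<^sup>2 + (norm x)\<^sup>2"
  by (simp only: power2_norm_eq_inner inner_join3)

lemma block3_mult_join3:
  "block3 A11 A12 A13 A21 A22 A23 A31 A32 A33 *v join3 e w x =
    join3 (A11 *v e + A12 *v w + A13 *v x) (A21 *v e + A22 *v w + A23 *v x) (A31 *v e + A32 *v w + A33 *v x)"
  by (simp add: vec_eq_iff block3_def join3_def matrix_vector_mult_def sum_UNIV_Plus split: sum.split)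

lemma two_inner_le_weighted:
  fixes u a :: "'a::real_inner"
  assumes "\<tau> > 0"
  shows "2 * (u \<bullet> a) \<le> \<tau> * (u \<bullet> u) + (1 / \<tau>) * (a \<bullet> a)"
proof -
  have "0 \<le> (\<tau> *\<^sub>R u - a) \<bullet> (\<tau> *\<^sub>R u - a)" by simp
  also have "\<dots> = \<tau> * (\<tau> * (u \<bullet> u) - 2 * (u \<bullet> a) + (1 / \<tau>) * (a \<bullet> a))"
    using assms by (simp add: inner_diff_left inner_diff_right inner_commute algebra_simps)
  finally show ?thesis using assms by (simp add: zero_le_mult_iff)
qed

subsection \<open>Dissipation\<close>

locale tracking =
  fixes J :: "real^3^3"
    and AK :: "real^'n^'n" and B\<theta> B\<omega> :: "real^3^'n" and CK :: "real^'n^3"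
    and D\<theta> D\<omega> :: "real^3^3"
    and p11 :: real and P21 P22 :: "real^3^3" and P31 P32 :: "real^3^'n"
    and P33 :: "real^'n^'n"
  assumes J_pd: "pos_def J"
    and P22_sym: "sym_mat P22" and P33_sym: "sym_mat P33"
    and P22_J: "P22 ** J = J ** P22"
    and P_pd: "pos_def (Pmat J p11 P21 P22 P31 P32 P33)"
    and M1_nd: "\<exists>\<tau>1 \<tau>2. \<tau>1 > 0 \<and> \<tau>2 > 0
                 \<and> neg_def (M1mat J AK B\<theta> B\<omega> CK D\<theta> D\<omega> p11 P21 P22 P31 P32 P33 \<tau>1 \<tau>2)"
begin

text \<open>\<open>\<beta>\<close> is the polar form of the part of \<open>V\<close> that is quadratic in \<open>(e\<^sub>R, \<omega>\<^sub>e, x\<^sub>K)\<close>.\<close>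

definition \<beta> :: "(real^3) \<times> (real^3) \<times> (real^'n) \<Rightarrow> (real^3) \<times> (real^3) \<times> (real^'n) \<Rightarrow> real" where
  "\<beta> z z' = (case z of (e, w, x) \<Rightarrow> case z' of (e', w', x') \<Rightarrow>
     w \<bullet> (P22 *v (J *v w')) + e \<bullet> (transpose P21 *v (J *v w')) + e' \<bullet> (transpose P21 *v (J *v w))
     + x \<bullet> (P33 *v x') + x \<bullet> (P31 *v e') + x' \<bullet> (P31 *v e)
     + x \<bullet> (P32 *v (J *v w')) + x' \<bullet> (P32 *v (J *v w)))"

definition Jinv :: "real^3^3" where "Jinv = (SOME B. J ** B = mat 1 \<and> B ** J = mat 1)"

definition Fw :: "real^3 \<Rightarrow> real^3 \<Rightarrow> real^'n \<Rightarrow> real^3" where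
  "Fw e w x = CK *v x + D\<theta> *v e + D\<omega> *v w"

definition Fx :: "real^3 \<Rightarrow> real^3 \<Rightarrow> real^'n \<Rightarrow> real^'n" where
  "Fx e w x = AK *v x + B\<theta> *v e + B\<omega> *v w"

lemma J_sym: "sym_mat J"
  using J_pd by (simp add: pos_def_def)

lemma J_Jinv: "J ** Jinv = mat 1" "Jinv ** J = mat 1"
proof -
  have "J *v y = 0 \<Longrightarrow> y = 0" for y
    using J_pd unfolding pos_def_def by (metis inner_zero_right less_irrefl)
  hence "\<exists>B. J ** B = mat 1 \<and> B ** J = mat 1"
    using matrix_left_invertible_ker[of J] matrix_left_right_inverse by blast
  from someI_ex[OF this] show "J ** Jinv = mat 1" "Jinv ** J = mat 1"
    unfolding Jinv_def by simp_all
qed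

lemma J_Jinv_vec [simp]: "J *v (Jinv *v y) = y" "Jinv *v (J *v y) = y"
  by (simp_all add: matrix_vector_mul_assoc J_Jinv)

text \<open>The only block whose symmetry is not immediate is \<open>P22 ** J\<close>: it is
  symmetric as a product of commuting symmetric matrices.\<close>

lemma \<beta>_commute: "\<beta> z z' = \<beta> z' z"
proof -
  have "w \<bullet> (P22 *v (J *v w')) = w' \<bullet> (P22 *v (J *v w))" for w w'
  proof -
    have "w \<bullet> (P22 *v (J *v w')) = w \<bullet> (J *v (P22 *v w'))"
      by (simp add: matrix_vector_mul_assoc P22_J)
    also have "\<dots> = (P22 *v (J *v w)) \<bullet> w'"
      using inner_sym_mat[OF J_sym, of w "P22 *v w'"] inner_sym_mat[OF P22_sym, of "J *v w" w'] by simp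
    finally show ?thesis by (simp add: inner_commute)
  qed
  moreover have "x \<bullet> (P33 *v x') = x' \<bullet> (P33 *v x)" for x x'
    using inner_sym_mat[OF P33_sym, of x x'] by (simp add: inner_commute)
  ultimately show ?thesis by (cases z; cases z') (simp add: \<beta>_def)
qed

lemma bounded_bilinear_\<beta>: "bounded_bilinear \<beta>"
  unfolding bilinear_conv_bounded_bilinear[symmetric] bilinear_def
  by (intro conjI allI linearI)
    (auto simp: \<beta>_def inner_add_left inner_add_right matrix_vector_right_distrib
      matrix_vector_mult_scaleR algebra_simps split: prod.split)

text \<open>The velocity of e_R is left as an arbitrary \<open>u\<close> with
  \<open>norm u \<le> norm w\<close>, the only kinematic fact that enters. The inequality therefore
  applies to the closed loop and again to its linearization at a half-turn.\<close>

lemma dissipation: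
  obtains k where "k > 0"
    "\<And>e w x u. norm u \<le> norm w \<Longrightarrow>
      2 * p11 * (e \<bullet> w) + 2 * \<beta> (e, w, x) (u, Jinv *v Fw e w x, Fx e w x) \<le> - k * (norm (e, w, x))\<^sup>2"
proof -
  obtain \<tau>1 \<tau>2 where \<tau>: "\<tau>1 > 0" "\<tau>2 > 0"
    "neg_def (M1mat J AK B\<theta> B\<omega> CK D\<theta> D\<omega> p11 P21 P22 P31 P32 P33 \<tau>1 \<tau>2)"
    using M1_nd by blast
  define M where "M = M1mat J AK B\<theta> B\<omega> CK D\<theta> D\<omega> p11 P21 P22 P31 P32 P33 \<tau>1 \<tau>2"
  obtain k where k: "k > 0" "\<And>m. k * (norm m)\<^sup>2 \<le> m \<bullet> (- M *v m)"
    using pos_def_coercive \<tau>(3) unfolding neg_def_def M_def by metis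
  show ?thesis
  proof
    show "k > 0" by fact
    fix e w u :: "real^3" and x :: "real^'n"
    assume u: "norm u \<le> norm w"
    define m where "m = join3 e w x"
    \<comment> \<open>\<open>a\<close> and \<open>b\<close> are the coefficients of \<open>u\<close>
      in the derivative of \<open>V\<close>. Their squared norms are exactly the extra terms of M1
      with weights \<open>1 / \<tau>2\<close> and \<open>1 / \<tau>1\<close>.\<close>
    define a where "a = transpose P21 *v (J *v w)"
    define b where "b = transpose P31 *v x"
    have aa: "w \<bullet> (J *v (P21 *v (transpose P21 *v (J *v w)))) = a \<bullet> a"
      by (simp add: inner_sym_mat[OF J_sym] a_def inner_transpose_left)
    have bb: "x \<bullet> (P31 *v (transpose P31 *v x)) = b \<bullet> b"
      by (simp add: b_def inner_transpose_left)
    have ua: "u \<bullet> (transpose P21 *v (J *v w)) = u \<bullet> a" by (simp add: a_def)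
    have ub: "x \<bullet> (P31 *v u) = u \<bullet> b" by (simp add: b_def inner_transpose_right inner_commute)
    have Jw: "w \<bullet> (J *v y) = (J *v w) \<bullet> y" for y by (rule inner_sym_mat[OF J_sym])
    have P22w: "w \<bullet> (P22 *v y) = (P22 *v w) \<bullet> y" for y by (rule inner_sym_mat[OF P22_sym])
    have P33x: "x \<bullet> (P33 *v y) = (P33 *v x) \<bullet> y" for y by (rule inner_sym_mat[OF P33_sym])
    note mv = matrix_vector_mult_add_rdistrib matrix_vector_mul_assoc[symmetric]
      scaleR_matrix_vector_assoc[symmetric] matrix_vector_right_distrib matrix_vector_mul_lid
    have te: "e \<bullet> (transpose A *v y) = y \<bullet> (A *v e)" for A :: "real^3^'b" and y
      by (simp add: inner_transpose_right inner_commute)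
    have twx: "w \<bullet> (transpose A *v x) = x \<bullet> (A *v w)" for A
      by (simp add: inner_transpose_right inner_commute)
    have minus: "- M *v m = - (M *v m)" for m
      by (simp add: matrix_vector_mult_def vec_eq_iff sum_negf)
    \<comment> \<open>With the slack terms of M1 removed and the true \<open>u\<close>-terms
      restored, the quadratic form is the exact derivative. Young's inequality and \<bar>u\<bar>
      \<le> \<bar>w\<bar> then show that the slack dominates.\<close>
    have Mm: "m \<bullet> (M *v m) - (\<tau>1 + \<tau>2) * (w \<bullet> w) - (1 / \<tau>2) * (a \<bullet> a) - (1 / \<tau>1) * (b \<bullet> b)
        + 2 * (u \<bullet> a) + 2 * (u \<bullet> b)
      = 2 * p11 * (e \<bullet> w) + 2 * \<beta> (e, w, x) (u, Jinv *v Fw e w x, Fx e w x)"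
      unfolding M_def M1mat_def Let_def m_def block3_mult_join3 inner_join3 \<beta>_def prod.case te twx
        J_Jinv_vec mv inner_add_right inner_add_left inner_scaleR_right Fw_def Fx_def
      unfolding aa bb ua ub
      unfolding inner_transpose_right inner_transpose_left Jw P22w P33x
      by (simp add: inner_commute algebra_simps)
    have uu: "u \<bullet> u \<le> w \<bullet> w" using u by (simp add: norm_le)
    have "2 * (u \<bullet> a) \<le> \<tau>2 * (u \<bullet> u) + (1 / \<tau>2) * (a \<bullet> a)"
      by (rule two_inner_le_weighted) fact
    moreover have "2 * (u \<bullet> b) \<le> \<tau>1 * (u \<bullet> u) + (1 / \<tau>1) * (b \<bullet> b)"
      by (rule two_inner_le_weighted) fact
    moreover have "(\<tau>1 + \<tau>2) * (u \<bullet> u) \<le> (\<tau>1 + \<tau>2) * (w \<bullet> w)"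
      using uu \<tau> by (intro mult_left_mono) auto
    ultimately have "2 * p11 * (e \<bullet> w) + 2 * \<beta> (e, w, x) (u, Jinv *v Fw e w x, Fx e w x) \<le> m \<bullet> (M *v m)"
      unfolding Mm[symmetric] by (simp add: algebra_simps)
    also have "\<dots> \<le> - k * (norm m)\<^sup>2"
      using k(2)[of m] minus[of m] by simp
    also have "(norm m)\<^sup>2 = (norm (e, w, x))\<^sup>2"
      by (simp add: m_def norm_join3 norm_Pair add.assoc)
    finally show "2 * p11 * (e \<bullet> w) + 2 * \<beta> (e, w, x) (u, Jinv *v Fw e w x, Fx e w x)
        \<le> - k * (norm (e, w, x))\<^sup>2" .
  qed
qed

lemma P_coercive:
  obtains k where "k > 0" "\<And>z. k * (norm z)\<^sup>2 \<le> p11 * (norm (fst z))\<^sup>2 + \<beta> z z"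
proof -
  define P where "P = Pmat J p11 P21 P22 P31 P32 P33"
  obtain k where k: "k > 0" "\<And>m. k * (norm m)\<^sup>2 \<le> m \<bullet> (P *v m)"
    using pos_def_coercive P_pd unfolding P_def by metis
  show ?thesis
  proof
    show "k > 0" by fact
    fix z :: "(real^3) \<times> (real^3) \<times> (real^'n)"
    obtain e w x where z: "z = (e, w, x)" by (cases z) auto
    have "join3 e w x \<bullet> (P *v join3 e w x) = p11 * (norm (fst z))\<^sup>2 + \<beta> z z"
      unfolding P_def Pmat_def block3_mult_join3 inner_join3 \<beta>_def z prod.case power2_norm_eq_inner fst_conv
        matrix_vector_mul_assoc[symmetric] scaleR_matrix_vector_assoc[symmetric] matrix_vector_mul_lid
        inner_add_right inner_scaleR_right inner_transpose_right
        inner_sym_mat[OF J_sym, of w]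
      by (simp add: inner_commute algebra_simps)
    thus "k * (norm z)\<^sup>2 \<le> p11 * (norm (fst z))\<^sup>2 + \<beta> z z"
      using k(2)[of "join3 e w x"] by (simp add: norm_join3 z norm_Pair add.assoc)
  qed
qed

lemma p11_pos: "p11 > 0"
proof -
  obtain k where k: "k > 0" "\<And>z. k * (norm z)\<^sup>2 \<le> p11 * (norm (fst z))\<^sup>2 + \<beta> z z"
    using P_coercive by blast
  have "\<beta> (axis 1 1, 0, 0) (axis 1 1, 0, 0) = 0" by (simp add: \<beta>_def)
  with k(1) k(2)[of "(axis 1 1, 0, 0)"] show ?thesis by (simp add: norm_Pair)
qed

end

subsection \<open>Compactness of the rotation group\<close>

lemma continuous_on_det_3: "continuous_on S (\<lambda>R::real^3^3. det R)"
  unfolding det_3 by (intro continuous_intros)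

lemma compact_SO3: "compact SO3"
proof -
  have "continuous_on UNIV (\<lambda>R::real^3^3. transpose R ** R)"
    unfolding transpose_def matrix_matrix_mult_def by (intro continuous_intros)
  hence "closed {R::real^3^3. transpose R ** R = mat 1}"
    by (rule closed_Collect_eq) (rule continuous_on_const)
  moreover have "closed {R::real^3^3. det R = 1}"
    by (rule closed_Collect_eq[OF continuous_on_det_3 continuous_on_const])
  ultimately have "closed ({R::real^3^3. transpose R ** R = mat 1} \<inter> {R. det R = 1})"
    by (rule closed_Int)
  hence "closed SO3" by (simp add: SO3_def Collect_conj_eq)
  moreover have "bounded SO3"
    unfolding bounded_iff by (intro exI[of _ "sqrt 3"]) (simp add: norm_eq_sqrt_inner SO3_norm_sq)
  ultimately show ?thesis by (simp add: compact_eq_bounded_closed)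
qed

text \<open>Compactness: on the rotations at distance at least \<epsilon> from the critical set,
  \<bar>e_R\<bar> attains a minimum, which is positive because by \<open>SO3_eR_eq_0\<close> all
  zeros are critical.\<close>

lemma SO3_near_critical:
  assumes "\<epsilon> > 0"
  obtains \<delta> where "\<delta> > 0"
    "\<And>R. R \<in> SO3 \<Longrightarrow> norm (eR R) < \<delta> \<Longrightarrow>
      infdist R ({mat 1} \<union> {rodrigues \<alpha> pi | \<alpha>. norm \<alpha> = 1}) < \<epsilon>"
proof -
  define S where "S = {mat 1} \<union> {rodrigues \<alpha> pi | \<alpha>. norm \<alpha> = 1}"
  define K where "K = SO3 \<inter> {R. \<epsilon> \<le> infdist R S}"
  have "closed {R. \<epsilon> \<le> infdist R S}"
    by (intro closed_Collect_le continuous_intros)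
  hence K: "compact K" unfolding K_def by (rule compact_Int_closed[OF compact_SO3])
  have "continuous_on K (\<lambda>R. norm (eR R))"
    by (intro continuous_intros linear_continuous_on bounded_linear_eR)
  show ?thesis
  proof (cases "K = {}")
    case True
    thus ?thesis using that[of 1] by (fastforce simp: K_def S_def)
  next
    case False
    then obtain R0 where R0: "R0 \<in> K" "\<And>R. R \<in> K \<Longrightarrow> norm (eR R0) \<le> norm (eR R)"
      using continuous_attains_inf[OF K False \<open>continuous_on K (\<lambda>R. norm (eR R))\<close>] by blast
    have "eR R0 \<noteq> 0"
    proof
      assume "eR R0 = 0"
      hence "R0 \<in> S" using SO3_eR_eq_0[of R0] R0(1) by (auto simp: S_def K_def)
      hence "infdist R0 S = 0" by simp
      thus False using R0(1) \<open>\<epsilon> > 0\<close> by (simp add: K_def)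
    qed
    thus ?thesis using that[of "norm (eR R0)"] R0(2) by (force simp: K_def S_def)
  qed
qed

context tracking
begin

subsection \<open>The closed loop as an autonomous system\<close>

text \<open>The field is defined on all 3x3 matrices, so that existence theory in a vector space
  applies; the rotation group is afterwards shown to be invariant.\<close>

definition F :: "(real^3^3) \<times> (real^3) \<times> (real^'n) \<Rightarrow> (real^3^3) \<times> (real^3) \<times> (real^'n)" where
  "F p = (fst p ** skew (fst (snd p)), Jinv *v Fw (eR (fst p)) (fst (snd p)) (snd (snd p)),
     Fx (eR (fst p)) (fst (snd p)) (snd (snd p)))"

definition Z :: "(real^3^3) \<times> (real^3) \<times> (real^'n) \<Rightarrow> (real^3) \<times> (real^3) \<times> (real^'n)" where
  "Z p = (eR (fst p), snd p)"

definition V :: "(real^3^3) \<times> (real^3) \<times> (real^'n) \<Rightarrow> real" where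
  "V p = 2 * p11 * Psi (fst p) + \<beta> (Z p) (Z p)"

definition dV :: "(real^3^3) \<times> (real^3) \<times> (real^'n) \<Rightarrow> real" where
  "dV p = 2 * p11 * (eR (fst p) \<bullet> fst (snd p)) + 2 * \<beta> (Z p) (Z (F p))"

definition sol :: "(real \<Rightarrow> (real^3^3) \<times> (real^3) \<times> (real^'n)) \<Rightarrow> bool" where
  "sol p \<longleftrightarrow> (\<forall>t\<ge>0. fst (p t) \<in> SO3 \<and> (p has_vector_derivative F (p t)) (at t within {0..}))"

lemma sol_D:
  assumes "sol p" "t \<ge> 0"
  shows "fst (p t) \<in> SO3" "(p has_vector_derivative F (p t)) (at t within {0..})"
  using assms by (auto simp: sol_def)

lemma is_sol_iff:
  "is_sol J AK B\<theta> B\<omega> CK D\<theta> D\<omega> Rm w x \<longleftrightarrow> sol (\<lambda>t. (Rm t, w t, x t))"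
proof -
  have "((\<lambda>s. J *v w s) has_vector_derivative Fw (eR (Rm t)) (w t) (x t)) (at t within {0..})
    \<longleftrightarrow> (w has_vector_derivative Jinv *v Fw (eR (Rm t)) (w t) (x t)) (at t within {0..})" for t
  proof
    assume "((\<lambda>s. J *v w s) has_vector_derivative Fw (eR (Rm t)) (w t) (x t)) (at t within {0..})"
    from bounded_linear.has_vector_derivative[OF matrix_vector_mul_bounded_linear this, of Jinv]
    show "(w has_vector_derivative Jinv *v Fw (eR (Rm t)) (w t) (x t)) (at t within {0..})" by simp
  next
    assume "(w has_vector_derivative Jinv *v Fw (eR (Rm t)) (w t) (x t)) (at t within {0..})"
    from bounded_linear.has_vector_derivative[OF matrix_vector_mul_bounded_linear this, of J]
    show "((\<lambda>s. J *v w s) has_vector_derivative Fw (eR (Rm t)) (w t) (x t)) (at t within {0..})" by simp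
  qed
  moreover have "((\<lambda>t. (Rm t, w t, x t)) has_vector_derivative (a, b, c)) (at t within S)
    \<longleftrightarrow> (Rm has_vector_derivative a) (at t within S) \<and> (w has_vector_derivative b) (at t within S)
      \<and> (x has_vector_derivative c) (at t within S)" (is "?l \<longleftrightarrow> ?r") for a b c t S
  proof
    assume ?r thus ?l by (intro has_vector_derivative_Pair) auto
  next
    assume l: ?l
    note s = bounded_linear.has_vector_derivative[OF bounded_linear_snd l]
    from bounded_linear.has_vector_derivative[OF bounded_linear_fst l]
      bounded_linear.has_vector_derivative[OF bounded_linear_fst s]
      bounded_linear.has_vector_derivative[OF bounded_linear_snd s]
    show ?r by simp
  qed
  ultimately show ?thesis
    unfolding is_sol_def sol_def F_def fst_conv snd_conv Fw_def Fx_def by (simp add: add.assoc)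
qed

lemma bounded_linear_Z: "bounded_linear Z"
  unfolding Z_def
  by (intro bounded_linear_Pair bounded_linear_compose[OF bounded_linear_eR] bounded_linear_fst bounded_linear_snd)

lemma norm_Z_le: "norm (Z p) \<le> norm p"
proof -
  have "(norm (eR (fst p)))\<^sup>2 \<le> (norm (fst p))\<^sup>2"
    by (intro power_mono norm_eR_le) simp
  thus ?thesis unfolding Z_def norm_Pair by (cases p) (simp add: norm_Pair)
qed

text \<open>The product of attitude and angular velocity is the only nonlinear component; the others
  form the linear map \<open>G\<close>.\<close>

lemma F_lipschitz_on_balls:
  obtains L where "L > 0"
    "\<And>p q. norm p \<le> K \<Longrightarrow> norm q \<le> K \<Longrightarrow> norm (F p - F q) \<le> L * norm (p - q)"
proof -
  define G where "G p = (Jinv *v Fw (eR (fst p)) (fst (snd p)) (snd (snd p)),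
     Fx (eR (fst p)) (fst (snd p)) (snd (snd p)))" for p :: "(real^3^3) \<times> (real^3) \<times> (real^'n)"
  have "linear G"
    by (rule linearI)
      (simp_all add: G_def Fw_def Fx_def linear_add[OF linear_eR] linear_scale[OF linear_eR]
        matrix_vector_right_distrib matrix_vector_mult_scaleR scaleR_right_distrib ac_simps)
  hence "bounded_linear G" by (simp add: linear_conv_bounded_linear)
  obtain B where B: "B > 0" "\<And>p. norm (G p) \<le> norm p * B"
    using bounded_linear.pos_bounded[OF \<open>bounded_linear G\<close>] by blast
  have G_diff: "G p - G q = G (p - q)" for p q
    using linear_diff[OF bounded_linear.linear[OF \<open>bounded_linear G\<close>]] by simp
  have F_eq: "F p = (fst p ** skew (fst (snd p)), G p)" for p by (simp add: F_def G_def)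
  show ?thesis
  proof (rule that[of "4 * \<bar>K\<bar> + B"])
    show "4 * \<bar>K\<bar> + B > 0" using B by simp
    fix p q :: "(real^3^3) \<times> (real^3) \<times> (real^'n)"
    assume pq: "norm p \<le> K" "norm q \<le> K"
    define R w R' w' where "R = fst p" and "w = fst (snd p)" and "R' = fst q" and "w' = fst (snd q)"
    have fst_le: "norm (fst u) \<le> norm u" for u :: "'x::real_normed_vector \<times> 'y::real_normed_vector"
      by (cases u) (simp add: norm_fst_le)
    have n1: "norm R \<le> norm p" "norm w' \<le> norm q" "norm (R - R') \<le> norm (p - q)" "norm (w - w') \<le> norm (p - q)"
      unfolding R_def w_def R'_def w'_def fst_diff[symmetric] snd_diff[symmetric]
      by (rule fst_le norm_fst_snd_le)+
    have "R ** skew w - R' ** skew w' = R ** skew (w - w') + (R - R') ** skew w'"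
      by (simp add: linear_diff[OF linear_skew] bounded_bilinear.diff_left[OF bounded_bilinear_matrix_mult]
          bounded_bilinear.diff_right[OF bounded_bilinear_matrix_mult])
    also have "norm \<dots> \<le> norm R * norm (skew (w - w')) + norm (R - R') * norm (skew w')"
      by (intro norm_triangle_le add_mono norm_matrix_mult_le)
    also have "\<dots> \<le> \<bar>K\<bar> * (2 * norm (p - q)) + norm (p - q) * (2 * \<bar>K\<bar>)"
    proof (intro add_mono mult_mono)
      show "norm R \<le> \<bar>K\<bar>" "norm (R - R') \<le> norm (p - q)" using n1 pq by linarith+
      show "norm (skew (w - w')) \<le> 2 * norm (p - q)" using n1 norm_skew_le[of "w - w'"] by linarith
      show "norm (skew w') \<le> 2 * \<bar>K\<bar>" using n1 pq norm_skew_le[of w'] by linarith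
    qed auto
    finally have 1: "norm (R ** skew w - R' ** skew w') \<le> 4 * \<bar>K\<bar> * norm (p - q)" by simp
    have "norm (F p - F q) \<le> norm (R ** skew w - R' ** skew w') + norm (G p - G q)"
      unfolding F_eq R_def w_def R'_def w'_def diff_Pair by (rule norm_Pair_le)
    also have "\<dots> \<le> 4 * \<bar>K\<bar> * norm (p - q) + norm (p - q) * B"
      unfolding G_diff by (intro add_mono 1 B)
    finally show "norm (F p - F q) \<le> (4 * \<bar>K\<bar> + B) * norm (p - q)" by (simp add: algebra_simps)
  qed
qed

subsection \<open>The Lyapunov function\<close>

lemma Psi_has_derivative:
  assumes "(R has_vector_derivative R t ** skew w) (at t within S)"
  shows "((\<lambda>t. Psi (R t)) has_real_derivative eR (R t) \<bullet> w) (at t within S)"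
proof -
  define l :: "real^3^3 \<Rightarrow> real" where "l M = - (M$1$1 + M$2$2 + M$3$3) / 2" for M
  have "linear l" by (rule linearI) (simp_all add: l_def field_simps)
  hence "bounded_linear l" by (simp add: linear_conv_bounded_linear)
  from bounded_linear.has_vector_derivative[OF this assms]
  have "((\<lambda>t. l (R t) + 3 / 2) has_vector_derivative l (R t ** skew w)) (at t within S)"
    by (auto intro!: derivative_eq_intros)
  moreover have "(\<lambda>t. l (R t) + 3 / 2) = (\<lambda>t. Psi (R t))"
    by (simp add: l_def Psi_eq field_simps)
  moreover have "l (R t ** skew w) = eR (R t) \<bullet> w"
    by (simp add: l_def inner_vec3 mult_nth_3 field_simps)
  ultimately show ?thesis by (simp add: has_real_derivative_iff_has_vector_derivative)
qed

lemma V_has_derivative: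
  assumes "(p has_vector_derivative F (p t)) (at t within S)"
  shows "((\<lambda>t. V (p t)) has_real_derivative dV (p t)) (at t within S)"
proof -
  have "((\<lambda>t. fst (p t)) has_vector_derivative fst (p t) ** skew (fst (snd (p t)))) (at t within S)"
    using bounded_linear.has_vector_derivative[OF bounded_linear_fst assms] by (simp add: F_def)
  note 1 = Psi_has_derivative[OF this]
  note z = bounded_linear.has_vector_derivative[OF bounded_linear_Z assms]
  have 2: "((\<lambda>t. \<beta> (Z (p t)) (Z (p t))) has_real_derivative 2 * \<beta> (Z (p t)) (Z (F (p t)))) (at t within S)"
    using bounded_bilinear.has_vector_derivative[OF bounded_bilinear_\<beta> z z]
    by (simp add: has_real_derivative_iff_has_vector_derivative \<beta>_commute[of "Z (F (p t))"])
  show ?thesis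
    unfolding V_def dV_def using 1 2 by (auto intro!: derivative_eq_intros)
qed

lemma dV_le:
  obtains k where "k > 0" "\<And>p. fst p \<in> SO3 \<Longrightarrow> dV p \<le> - k * (norm (Z p))\<^sup>2"
proof -
  obtain k where k: "k > 0" "\<And>e w x u. norm u \<le> norm w \<Longrightarrow>
      2 * p11 * (e \<bullet> w) + 2 * \<beta> (e, w, x) (u, Jinv *v Fw e w x, Fx e w x) \<le> - k * (norm (e, w, x))\<^sup>2"
    using dissipation by blast
  show ?thesis
  proof (rule that[OF k(1)])
    fix p :: "(real^3^3) \<times> (real^3) \<times> (real^'n)" assume "fst p \<in> SO3"
    hence "norm (eR (fst p ** skew (fst (snd p)))) \<le> norm (fst (snd p))"
      by (intro norm_eR_skew_mult_le SO3_D)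
    from k(2)[OF this, of "eR (fst p)" "snd (snd p)"]
    show "dV p \<le> - k * (norm (Z p))\<^sup>2" by (simp add: dV_def Z_def F_def)
  qed
qed

definition peq :: "(real^3^3) \<times> (real^3) \<times> (real^'n)" where
  "peq = (mat 1, 0, 0)"

lemma norm_diff_peq:
  assumes "fst p \<in> SO3"
  shows "(norm (p - peq))\<^sup>2 = 4 * Psi (fst p) + (norm (snd p))\<^sup>2"
proof -
  have "p - peq = (fst p - mat 1, snd p)" by (simp add: peq_def prod_eq_iff)
  thus ?thesis using SO3_norm_diff[OF assms] SO3_Psi_bounds[OF assms] by (simp add: norm_Pair)
qed

lemma norm_Z_sq: "(norm (Z p))\<^sup>2 = (norm (eR (fst p)))\<^sup>2 + (norm (snd p))\<^sup>2"
  by (simp add: Z_def norm_Pair)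

text \<open>Distances to the identity are needed here, and \<bar>e_R\<bar> cannot measure them since
  it also vanishes at half-turns. The identity 2 Psi = \<bar>e_R\<bar>^2 + Psi^2 splits
  \<open>V\<close> into the form of \<open>P_coercive\<close> and the remainder
  \<open>p11 * Psi^2\<close>, which recovers what e_R misses.\<close>

lemma V_bounds:
  obtains c C where "c > 0" "C > 0"
    "\<And>p. fst p \<in> SO3 \<Longrightarrow> c * (norm (p - peq))\<^sup>2 \<le> V p"
    "\<And>p. fst p \<in> SO3 \<Longrightarrow> V p \<le> C * (norm (p - peq))\<^sup>2"
proof -
  obtain k where k: "k > 0" "\<And>z. k * (norm z)\<^sup>2 \<le> p11 * (norm (fst z))\<^sup>2 + \<beta> z z"
    using P_coercive by blast
  obtain B where B: "B > 0" "\<And>z z'. norm (\<beta> z z') \<le> norm z * norm z' * B"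
    using bounded_bilinear.pos_bounded[OF bounded_bilinear_\<beta>] by blast
  define c where "c = min k p11 / 2"
  have c: "0 < c" "2 * c \<le> k" "2 * c \<le> p11" using k(1) p11_pos by (auto simp: c_def)
  show ?thesis
  proof (rule that[of c "p11 + B"])
    show "c > 0" "p11 + B > 0" using c B p11_pos by auto
    fix p :: "(real^3^3) \<times> (real^3) \<times> (real^'n)" assume p: "fst p \<in> SO3"
    define \<psi> where "\<psi> = Psi (fst p)"
    define n where "n = (norm (snd p))\<^sup>2"
    have e: "(norm (eR (fst p)))\<^sup>2 = \<psi> * (2 - \<psi>)" and "\<psi> \<ge> 0"
      using SO3_norm_eR[OF p] SO3_Psi_bounds[OF p] by (simp_all add: \<psi>_def)
    have n: "n \<ge> 0" by (simp add: n_def)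
    have fst_Z: "fst (Z p) = eR (fst p)" by (simp add: Z_def)
    have Zsq: "(norm (Z p))\<^sup>2 = \<psi> * (2 - \<psi>) + n" by (simp add: norm_Z_sq e n_def)
    have sq: "(norm (p - peq))\<^sup>2 = 4 * \<psi> + n" using norm_diff_peq[OF p] by (simp add: \<psi>_def n_def)
    have "c * (4 * \<psi> + n) \<le> 2 * c * (\<psi> * (2 - \<psi>) + n) + 2 * c * (\<psi> * \<psi>)"
      using c n \<open>\<psi> \<ge> 0\<close> by (simp add: algebra_simps)
    also have "\<dots> \<le> k * (\<psi> * (2 - \<psi>) + n) + p11 * (\<psi> * \<psi>)"
      using c n SO3_Psi_bounds[OF p] by (intro add_mono mult_right_mono) (auto simp: \<psi>_def)
    also have "\<dots> \<le> V p"
      using k(2)[of "Z p"] by (simp add: Zsq V_def fst_Z e \<psi>_def[symmetric] algebra_simps)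
    finally show "c * (norm (p - peq))\<^sup>2 \<le> V p" by (simp add: sq)
    have "\<beta> (Z p) (Z p) \<le> B * (norm (Z p))\<^sup>2"
      using B(2)[of "Z p" "Z p"] by (simp add: power2_eq_square algebra_simps)
    also have "\<dots> \<le> B * (4 * \<psi> + n)"
      using B(1) \<open>\<psi> \<ge> 0\<close> by (intro mult_left_mono) (auto simp: Zsq algebra_simps intro: order_trans[of _ 0])
    finally have "\<beta> (Z p) (Z p) \<le> B * (4 * \<psi> + n)" .
    moreover have "2 * p11 * \<psi> \<le> p11 * (4 * \<psi> + n)"
      using p11_pos n \<open>\<psi> \<ge> 0\<close> by (simp add: algebra_simps)
    ultimately show "V p \<le> (p11 + B) * (norm (p - peq))\<^sup>2"
      by (simp add: sq V_def \<psi>_def[symmetric] algebra_simps)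
  qed
qed

lemma V_nonincreasing:
  assumes "\<And>t. t \<in> {a..b} \<Longrightarrow> fst (p t) \<in> SO3"
    "\<And>t. t \<in> {a..b} \<Longrightarrow> (p has_vector_derivative F (p t)) (at t within S)"
    "{a..b} \<subseteq> S" "a \<le> b"
  shows "V (p b) \<le> V (p a)"
proof -
  obtain k where k: "k > 0" "\<And>p. fst p \<in> SO3 \<Longrightarrow> dV p \<le> - k * (norm (Z p))\<^sup>2"
    using dV_le by blast
  have "- V (p a) \<le> - V (p b)"
  proof (rule nondecreasing_if_deriv_nonneg[where g = "\<lambda>t. - V (p t)" and g' = "\<lambda>t. - dV (p t)" and S = S])
    fix t assume t: "t \<in> {a..b}"
    show "((\<lambda>t. - V (p t)) has_real_derivative - dV (p t)) (at t within S)"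
      by (intro DERIV_minus V_has_derivative assms t)
    have "k * (norm (Z (p t)))\<^sup>2 \<ge> 0" using k(1) by simp
    thus "0 \<le> - dV (p t)" using k(2)[OF assms(1)[OF t]] by simp
  qed (use assms in auto)
  thus ?thesis by simp
qed

text \<open>Arbitrary \<open>S\<close> and a single end time \<open>T\<close> let the same bound
  serve the local pieces in the existence proof and the solutions on the half-line.\<close>

lemma norm_diff_peq_bound:
  obtains M where "M > 0"
    "\<And>p S T. T \<ge> 0 \<Longrightarrow> {0..T} \<subseteq> S \<Longrightarrow> (\<And>t. t \<in> {0..T} \<Longrightarrow> fst (p t) \<in> SO3) \<Longrightarrow>
      (\<And>t. t \<in> {0..T} \<Longrightarrow> (p has_vector_derivative F (p t)) (at t within S)) \<Longrightarrow>
      norm (p T - peq) \<le> M * norm (p 0 - peq)"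
proof -
  obtain c C where c: "c > 0" "C > 0"
    "\<And>p. fst p \<in> SO3 \<Longrightarrow> c * (norm (p - peq))\<^sup>2 \<le> V p"
    "\<And>p. fst p \<in> SO3 \<Longrightarrow> V p \<le> C * (norm (p - peq))\<^sup>2"
    using V_bounds by blast
  show ?thesis
  proof (rule that[of "sqrt (C / c)"])
    show "sqrt (C / c) > 0" using c by simp
    fix p S T assume *: "T \<ge> (0::real)" "{0..T} \<subseteq> S" "\<And>t. t \<in> {0..T} \<Longrightarrow> fst (p t) \<in> SO3"
      "\<And>t. t \<in> {0..T} \<Longrightarrow> (p has_vector_derivative F (p t)) (at t within S)"
    have "c * (norm (p T - peq))\<^sup>2 \<le> V (p T)" using * by (intro c) auto
    also have "\<dots> \<le> V (p 0)" using * by (intro V_nonincreasing) auto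
    also have "\<dots> \<le> C * (norm (p 0 - peq))\<^sup>2" using * by (intro c) auto
    finally have "(norm (p T - peq))\<^sup>2 \<le> (sqrt (C / c) * norm (p 0 - peq))\<^sup>2"
      using c by (simp add: power_mult_distrib field_simps)
    thus "norm (p T - peq) \<le> sqrt (C / c) * norm (p 0 - peq)"
      by (rule power2_le_imp_le) (use c in auto)
  qed
qed

subsection \<open>Existence of solutions\<close>

text \<open>The product taken is R R^T and not R^T R: its derivative cancels for every matrix R
  because w^x is skew, whereas that of R^T R is a commutator which vanishes only once orthogonality
  is known. The determinant is then 1 or -1 and cannot jump.\<close>

lemma SO3_invariant:
  assumes der: "\<And>t. t \<in> {0..T} \<Longrightarrow> (R has_vector_derivative R t ** skew (w t)) (at t within {0..T})"
    and "R 0 \<in> SO3" and t: "t \<in> {0..T}"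
  shows "R t \<in> SO3"
proof -
  have tr: "bounded_linear (transpose :: real^3^3 \<Rightarrow> real^3^3)"
    using linearI[of "transpose :: real^3^3 \<Rightarrow> real^3^3"]
    by (auto simp: linear_conv_bounded_linear[symmetric] transpose_def vec_eq_iff)
  have "((\<lambda>t. R t ** transpose (R t)) has_vector_derivative 0) (at s within {0..T})" if s: "s \<in> {0..T}" for s
  proof -
    note d = der[OF s]
    note d' = bounded_linear.has_vector_derivative[OF tr d]
    have "R s ** transpose (R s ** skew (w s)) + R s ** skew (w s) ** transpose (R s) = 0"
      by (simp add: matrix_transpose_mul transpose_skew matrix_mul_assoc)
        (simp add: mat_eq_3 mult_nth_3 transpose_nth algebra_simps)
    with bounded_bilinear.has_vector_derivative[OF bounded_bilinear_matrix_mult d d']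
    show ?thesis by simp
  qed
  then obtain N where N: "\<And>s. s \<in> {0..T} \<Longrightarrow> R s ** transpose (R s) = N"
    using has_vector_derivative_zero_constant[of "{0..T}" "\<lambda>t. R t ** transpose (R t)"] by auto
  have "N = mat 1" using N[of 0] SO3_D[OF \<open>R 0 \<in> SO3\<close>] t by simp
  hence orth: "transpose (R s) ** R s = mat 1" if "s \<in> {0..T}" for s
    using N[OF that] matrix_left_right_inverse by blast
  have det: "det (R s) = 1 \<or> det (R s) = -1" if "s \<in> {0..T}" for s
    using det_orthogonal_matrix[of "R s"] orth[OF that] by (simp add: orthogonal_matrix)
  have "continuous_on {0..T} R"
    using der has_vector_derivative_continuous by (fastforce simp: continuous_on_eq_continuous_within)
  hence cont: "continuous_on {0..t} (\<lambda>s. det (R s))"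
    using t by (intro continuous_on_compose2[OF continuous_on_det_3[of UNIV]]) (auto intro: continuous_on_subset)
  have "det (R t) = 1"
  proof (rule ccontr)
    assume "det (R t) \<noteq> 1"
    hence "det (R t) = -1" using det t by blast
    then obtain s where "0 \<le> s" "s \<le> t" "det (R s) = 0"
      using IVT2'[of "\<lambda>s. det (R s)" t 0 0] cont t SO3_D[OF \<open>R 0 \<in> SO3\<close>] by auto
    thus False using det[of s] t by auto
  qed
  thus ?thesis using orth[OF t] by (simp add: SO3_def)
qed

lemma solution_exists:
  assumes "fst p0 \<in> SO3"
  obtains p where "sol p" "p 0 = p0"
proof -
  obtain M where M: "M > 0"
    "\<And>p S T. T \<ge> 0 \<Longrightarrow> {0..T} \<subseteq> S \<Longrightarrow> (\<And>t. t \<in> {0..T} \<Longrightarrow> fst (p t) \<in> SO3) \<Longrightarrow>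
      (\<And>t. t \<in> {0..T} \<Longrightarrow> (p has_vector_derivative F (p t)) (at t within S)) \<Longrightarrow>
      norm (p T - peq) \<le> M * norm (p 0 - peq)"
    using norm_diff_peq_bound by blast
  \<comment> \<open>\<open>K\<close> lies above both the a priori bound
    \<open>norm peq + M * norm (p0 - peq)\<close> and \<open>norm p0\<close>; the additional 1 makes
    the inequalities strict.\<close>
  define K where "K = norm peq + (M + 1) * norm (p0 - peq) + 1"
  obtain L where L: "L > 0"
    "\<And>p q. norm p \<le> K \<Longrightarrow> norm q \<le> K \<Longrightarrow> norm (F p - F q) \<le> L * norm (p - q)"
    using F_lipschitz_on_balls[of K] by metis
  have SO3: "fst (p t) \<in> SO3"
    if "p 0 = p0" "t \<in> {0..T}"
      "\<And>t. t \<in> {0..T} \<Longrightarrow> (p has_vector_derivative F (p t)) (at t within {0..T})" for p t T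
  proof (rule SO3_invariant[where R = "\<lambda>t. fst (p t)" and w = "\<lambda>t. fst (snd (p t))", OF _ _ that(2)])
    fix s assume "s \<in> {0..T}"
    from bounded_linear.has_vector_derivative[OF bounded_linear_fst that(3)[OF this]]
    show "((\<lambda>t. fst (p t)) has_vector_derivative fst (p s) ** skew (fst (snd (p s)))) (at s within {0..T})"
      by (simp add: F_def)
  qed (use that assms in auto)
  have K0: "norm p0 < K"
  proof -
    have "norm p0 \<le> norm peq + norm (p0 - peq)" by (metis norm_triangle_sub)
    moreover have "0 \<le> M * norm (p0 - peq)" using M(1) by simp
    ultimately show ?thesis by (simp add: K_def algebra_simps)
  qed
  have apriori: "norm (p T) < K" if *: "T \<ge> (0::real)" "p 0 = p0"
      "\<And>t. t \<in> {0..T} \<Longrightarrow> (p has_vector_derivative F (p t)) (at t within {0..T})" for T p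
  proof -
    have "norm (p T - peq) \<le> M * norm (p0 - peq)"
      unfolding *(2)[symmetric] using * SO3[OF *(2) _ *(3)] by (intro M(2)[of T "{0..T}"]) auto
    moreover have "norm (p T) \<le> norm peq + norm (p T - peq)" by (metis norm_triangle_sub)
    moreover have "K = norm peq + M * norm (p0 - peq) + norm (p0 - peq) + 1"
      by (simp add: K_def algebra_simps)
    ultimately show "norm (p T) < K" using norm_ge_zero[of "p0 - peq"] by linarith
  qed
  have "\<exists>p. p 0 = p0 \<and> (\<forall>t\<ge>0. (p has_vector_derivative F (p t)) (at t within {0..}))"
  proof (rule global_solution_a_priori[where f = F and K = K and L = L and ?y0.0 = p0])
    show "norm (p T) < K" if "T \<ge> 0" "p 0 = p0"
      "\<And>t. t \<in> {0..T} \<Longrightarrow> (p has_vector_derivative F (p t)) (at t within {0..T})" for T p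
      by (rule apriori[OF that])
  next
    fix p assume "p 0 = p0" "\<And>t. t \<ge> 0 \<Longrightarrow> (p has_vector_derivative F (p t)) (at t within {0..})"
    thus ?thesis by blast
  qed (use L K0 in auto)
  then obtain p where p: "p 0 = p0"
    "\<And>t. t \<ge> 0 \<Longrightarrow> (p has_vector_derivative F (p t)) (at t within {0..})"
    by blast
  have "fst (p t) \<in> SO3" if "t \<ge> 0" for t
    using that p by (intro SO3[of p t t]) (auto intro!: has_vector_derivative_within_subset[OF p(2)])
  thus ?thesis using that[of p] p by (simp add: sol_def)
qed

subsection \<open>Stability, convergence, instability\<close>

lemma sol_stable:
  assumes "\<epsilon> > 0"
  obtains \<delta> where "\<delta> > 0"
    "\<And>p t. sol p \<Longrightarrow> dist (p 0) peq < \<delta> \<Longrightarrow> t \<ge> 0 \<Longrightarrow> dist (p t) peq < \<epsilon>"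
proof -
  obtain M where M: "M > 0"
    "\<And>p S T. T \<ge> 0 \<Longrightarrow> {0..T} \<subseteq> S \<Longrightarrow> (\<And>t. t \<in> {0..T} \<Longrightarrow> fst (p t) \<in> SO3) \<Longrightarrow>
      (\<And>t. t \<in> {0..T} \<Longrightarrow> (p has_vector_derivative F (p t)) (at t within S)) \<Longrightarrow>
      norm (p T - peq) \<le> M * norm (p 0 - peq)"
    using norm_diff_peq_bound by blast
  show ?thesis
  proof (rule that[of "\<epsilon> / M"])
    show "\<epsilon> / M > 0" using assms M(1) by simp
    fix p t assume p: "sol p" "dist (p 0) peq < \<epsilon> / M" "t \<ge> (0::real)"
    have "norm (p t - peq) \<le> M * norm (p 0 - peq)"
      using sol_D[OF p(1)] p(3) by (intro M(2)[of t "{0..}"]) auto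
    also have "\<dots> < \<epsilon>" using p(2) M(1) by (simp add: dist_norm field_simps)
    finally show "dist (p t) peq < \<epsilon>" by (simp add: dist_norm)
  qed
qed

lemma sol_bounded:
  assumes "sol p"
  obtains K where "\<And>t. t \<ge> 0 \<Longrightarrow> norm (p t) \<le> K"
proof -
  obtain M where M: "M > 0"
    "\<And>p S T. T \<ge> 0 \<Longrightarrow> {0..T} \<subseteq> S \<Longrightarrow> (\<And>t. t \<in> {0..T} \<Longrightarrow> fst (p t) \<in> SO3) \<Longrightarrow>
      (\<And>t. t \<in> {0..T} \<Longrightarrow> (p has_vector_derivative F (p t)) (at t within S)) \<Longrightarrow>
      norm (p T - peq) \<le> M * norm (p 0 - peq)"
    using norm_diff_peq_bound by blast
  have "norm (p t) \<le> norm peq + M * norm (p 0 - peq)" if "t \<ge> 0" for t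
  proof -
    have "norm (p t - peq) \<le> M * norm (p 0 - peq)"
      using sol_D[OF assms] that by (intro M(2)[of t "{0..}"]) auto
    moreover have "norm (p t) \<le> norm peq + norm (p t - peq)" by (rule norm_triangle_sub)
    ultimately show ?thesis by linarith
  qed
  thus ?thesis using that by blast
qed

lemma sol_Z_tendsto:
  assumes "sol p"
  shows "((\<lambda>t. Z (p t)) \<longlongrightarrow> 0) at_top" and "\<exists>l. ((\<lambda>t. V (p t)) \<longlongrightarrow> l) at_top \<and> (\<forall>t\<ge>0. l \<le> V (p t))"
proof -
  obtain K where K: "\<And>t. t \<ge> 0 \<Longrightarrow> norm (p t) \<le> K" using sol_bounded[OF assms] by blast
  obtain L where L: "L > 0" "\<And>p q. norm p \<le> \<bar>K\<bar> \<Longrightarrow> norm q \<le> \<bar>K\<bar> \<Longrightarrow> norm (F p - F q) \<le> L * norm (p - q)"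
    using F_lipschitz_on_balls[of "\<bar>K\<bar>"] by metis
  define B where "B = L * \<bar>K\<bar> + norm (F 0) + 1"
  have "B > 0" using L(1) by (simp add: B_def add_nonneg_pos)
  have F_le: "norm (F (p t)) \<le> B" if "t \<ge> 0" for t
  proof -
    have "norm (F (p t) - F 0) \<le> L * norm (p t - 0)" using K[OF that] by (intro L) auto
    also have "\<dots> \<le> L * \<bar>K\<bar>" using K[OF that] L(1) by (intro mult_left_mono) auto
    finally show ?thesis using norm_triangle_ineq2[of "F (p t)" "F 0"] by (simp add: B_def)
  qed
  have lip: "norm (Z (p t) - Z (p s)) \<le> B * (t - s)" if "0 \<le> s" "s \<le> t" for s t
  proof -
    have "norm (Z (p t) - Z (p s)) = norm (Z (p t - p s))"
      using linear_diff[OF bounded_linear.linear[OF bounded_linear_Z]] by simp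
    also have "\<dots> \<le> norm (p t - p s)" by (rule norm_Z_le)
    also have "\<dots> \<le> B * (t - s)"
      using that F_le sol_D[OF assms]
      by (intro bounded_vector_derivative_imp_lipschitz[where f' = "\<lambda>t. F (p t)" and S = "{0..}"]) auto
    finally show ?thesis .
  qed
  obtain k where k: "k > 0" "\<And>p. fst p \<in> SO3 \<Longrightarrow> dV p \<le> - k * (norm (Z p))\<^sup>2"
    using dV_le by blast
  have Vpos: "0 \<le> V (p t)" if "t \<ge> 0" for t
  proof -
    obtain c C where c: "c > 0" "C > 0" "\<And>p. fst p \<in> SO3 \<Longrightarrow> c * (norm (p - peq))\<^sup>2 \<le> V p"
      "\<And>p. fst p \<in> SO3 \<Longrightarrow> V p \<le> C * (norm (p - peq))\<^sup>2"
      using V_bounds by blast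
    have "0 \<le> c * (norm (p t - peq))\<^sup>2" using c(1) by simp
    also have "\<dots> \<le> V (p t)" by (rule c(3)[OF sol_D(1)[OF assms that]])
    finally show ?thesis .
  qed
  note b = barbalat_dissipation[of "\<lambda>t. V (p t)" "\<lambda>t. dV (p t)" k "\<lambda>t. Z (p t)" B,
      OF V_has_derivative[OF sol_D(2)[OF assms]] k(2)[OF sol_D(1)[OF assms]] k(1) Vpos lip \<open>B > 0\<close>]
  show "((\<lambda>t. Z (p t)) \<longlongrightarrow> 0) at_top" by (rule b(1))
  show "\<exists>l. ((\<lambda>t. V (p t)) \<longlongrightarrow> l) at_top \<and> (\<forall>t\<ge>0. l \<le> V (p t))" by (rule b(2))
qed

text \<open>Since \<open>\<bar>e\<^sub>R\<bar>\<^sup>2 = \<Psi> (2 - \<Psi>)\<close> on the rotation group, the limit of \<open>\<Psi>\<close> is 0 or 2.\<close>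

lemma sol_dichotomy:
  assumes "sol p"
  shows "(p \<longlongrightarrow> peq) at_top \<or>
    ((\<lambda>t. Psi (fst (p t))) \<longlongrightarrow> 2) at_top \<and> (\<forall>t\<ge>0. 4 * p11 \<le> V (p t))"
proof -
  obtain l where l: "((\<lambda>t. V (p t)) \<longlongrightarrow> l) at_top" "\<And>t. t \<ge> 0 \<Longrightarrow> l \<le> V (p t)"
    using sol_Z_tendsto(2)[OF assms] by blast
  note z = sol_Z_tendsto(1)[OF assms]
  define \<psi> where "\<psi> t = Psi (fst (p t))" for t
  \<comment> \<open>\<open>V - \<beta>\<close> is \<open>2 * p11 * Psi\<close>. Since
    \<open>V\<close> converges and the quadratic part tends to 0, \<open>Psi\<close> itself
    converges.\<close>
  have "((\<lambda>t. \<beta> (Z (p t)) (Z (p t))) \<longlongrightarrow> \<beta> 0 0) at_top"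
    by (rule bounded_bilinear.tendsto[OF bounded_bilinear_\<beta> z z])
  hence "((\<lambda>t. (V (p t) - \<beta> (Z (p t)) (Z (p t))) / (2 * p11)) \<longlongrightarrow> (l - 0) / (2 * p11)) at_top"
    using bounded_bilinear.zero_left[OF bounded_bilinear_\<beta>, of 0] p11_pos by (intro tendsto_intros l) auto
  hence \<psi>_lim: "(\<psi> \<longlongrightarrow> l / (2 * p11)) at_top"
    using p11_pos by (simp add: V_def \<psi>_def[abs_def])
  have "((\<lambda>t. (norm (fst (Z (p t))))\<^sup>2) \<longlongrightarrow> (norm (fst (0 :: (real^3) \<times> (real^3) \<times> (real^'n))))\<^sup>2) at_top"
    by (intro tendsto_intros z)
  hence "((\<lambda>t. (norm (eR (fst (p t))))\<^sup>2) \<longlongrightarrow> 0) at_top" by (simp add: Z_def)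
  moreover have "\<forall>\<^sub>F t in at_top. (norm (eR (fst (p t))))\<^sup>2 = \<psi> t * (2 - \<psi> t)"
    using eventually_ge_at_top[of 0]
    by eventually_elim (simp add: SO3_norm_eR[OF sol_D(1)[OF assms]] \<psi>_def)
  ultimately have "((\<lambda>t. \<psi> t * (2 - \<psi> t)) \<longlongrightarrow> 0) at_top" by (simp cong: tendsto_cong)
  moreover have "((\<lambda>t. \<psi> t * (2 - \<psi> t)) \<longlongrightarrow> l / (2 * p11) * (2 - l / (2 * p11))) at_top"
    by (intro tendsto_intros \<psi>_lim)
  ultimately have "l / (2 * p11) * (2 - l / (2 * p11)) = 0"
    using tendsto_unique trivial_limit_at_top_linorder by blast
  then consider "l / (2 * p11) = 0" | "l / (2 * p11) = 2" by force
  thus ?thesis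
  proof cases
    case 1
    have "((\<lambda>t. 4 * \<psi> t + (norm (snd (Z (p t))))\<^sup>2) \<longlongrightarrow>
        4 * 0 + (norm (snd (0 :: (real^3) \<times> (real^3) \<times> (real^'n))))\<^sup>2) at_top"
      using \<psi>_lim unfolding 1 by (intro tendsto_intros z)
    hence "((\<lambda>t. 4 * \<psi> t + (norm (snd (p t)))\<^sup>2) \<longlongrightarrow> 0) at_top" by (simp add: Z_def)
    moreover have "\<forall>\<^sub>F t in at_top. 4 * \<psi> t + (norm (snd (p t)))\<^sup>2 = (norm (p t - peq))\<^sup>2"
      using eventually_ge_at_top[of 0]
      by eventually_elim (simp add: norm_diff_peq[OF sol_D(1)[OF assms]] \<psi>_def)
    ultimately have "((\<lambda>t. (norm (p t - peq))\<^sup>2) \<longlongrightarrow> 0) at_top" by (simp cong: tendsto_cong)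
    hence "((\<lambda>t. sqrt ((norm (p t - peq))\<^sup>2)) \<longlongrightarrow> sqrt 0) at_top" by (intro tendsto_real_sqrt)
    hence "((\<lambda>t. norm (p t - peq)) \<longlongrightarrow> 0) at_top" by simp
    hence "((\<lambda>t. p t - peq) \<longlongrightarrow> 0) at_top" by (rule tendsto_norm_zero_cancel)
    thus ?thesis by (simp add: LIM_zero_iff)
  next
    case 2
    hence "l = 4 * p11" using p11_pos by (simp add: field_simps)
    thus ?thesis using \<psi>_lim l(2) 2 by (simp add: \<psi>_def[abs_def])
  qed
qed

lemma peq_attracts_sublevel:
  assumes "sol p" "V (p 0) < 4 * p11"
  shows "(p \<longlongrightarrow> peq) at_top"
  using sol_dichotomy[OF assms(1)] assms(2) by fastforce

text \<open>The perturbation shortens the angle to \<open>pi - h\<close> and leaves the system at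
  rest. Every term of \<open>\<beta>\<close> contains w or x, so it vanishes, and \<open>V\<close>
  equals \<open>2 * p11 * (1 + cos h) < 4 * p11\<close>.\<close>

lemma critical_point_unstable:
  assumes \<alpha>: "norm \<alpha> = 1"
  shows "\<exists>\<epsilon>>0. \<forall>\<delta>>0. \<exists>p. sol p \<and> dist (p 0) (rodrigues \<alpha> pi, 0, 0) < \<delta>
    \<and> \<not> (\<forall>t\<ge>0. dist (p t) (rodrigues \<alpha> pi, 0, 0) < \<epsilon>)"
proof (intro exI[of _ 1] conjI allI impI)
  fix \<delta> :: real assume "\<delta> > 0"
  define q where "q = (rodrigues \<alpha> pi, 0 :: real^3, 0 :: real^'n)"
  have "isCont (\<lambda>h. rodrigues \<alpha> (pi - h)) 0"
    unfolding rodrigues_def by (intro continuous_intros)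
  hence "\<exists>d>0. \<forall>h. dist h 0 < d \<longrightarrow> dist (rodrigues \<alpha> (pi - h)) (rodrigues \<alpha> (pi - 0)) < \<delta>"
    using \<open>\<delta> > 0\<close> unfolding continuous_at_eps_delta by blast
  then obtain d where d: "d > 0"
    "\<And>h. dist h 0 < d \<Longrightarrow> dist (rodrigues \<alpha> (pi - h)) (rodrigues \<alpha> pi) < \<delta>"
    by auto
  define h where "h = min (d / 2) 1"
  have h: "h > 0" "dist h 0 < d" "h \<le> 1" using d(1) by (auto simp: h_def)
  obtain p where p: "sol p" "p 0 = (rodrigues \<alpha> (pi - h), 0, 0)"
    using solution_exists[of "(rodrigues \<alpha> (pi - h), 0, 0)"] rodrigues_SO3[OF \<alpha>] by auto
  have near: "dist (p 0) q < \<delta>"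
    using d(2)[OF h(2)] by (simp add: p(2) q_def dist_Pair_Pair)
  have "V (p 0) = 2 * p11 * (1 + cos h)"
  proof -
    have "\<beta> (Z (p 0)) (Z (p 0)) = 0" by (simp add: \<beta>_def Z_def p(2))
    thus ?thesis by (simp add: V_def p(2) Psi_rodrigues[OF \<alpha>])
  qed
  moreover have "cos h < 1" using h pi_gt3 cos_monotone_0_pi[of 0 h] by simp
  ultimately have "V (p 0) < 4 * p11" using p11_pos by (simp add: algebra_simps)
  hence "(p \<longlongrightarrow> peq) at_top" by (rule peq_attracts_sublevel[OF p(1)])
  hence "\<forall>\<^sub>F t in at_top. dist (p t) peq < 1" by (rule tendstoD) simp
  moreover have "\<forall>\<^sub>F t in at_top. (t::real) \<ge> 0" by (rule eventually_ge_at_top)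
  ultimately have "\<forall>\<^sub>F t in at_top. dist (p t) peq < 1 \<and> t \<ge> 0" by eventually_elim simp
  then obtain t where t: "dist (p t) peq < 1" "t \<ge> 0"
    using eventually_happens' trivial_limit_at_top_linorder by blast
  have "fst q \<in> SO3" using rodrigues_SO3[OF \<alpha>] by (simp add: q_def)
  \<comment> \<open>The half-turn is at distance sqrt 8 from the identity, so entering the unit ball
    around the latter means leaving the unit ball around the former.\<close>
  from norm_diff_peq[OF this] have "(dist q peq)\<^sup>2 = 8"
    by (simp add: dist_norm q_def Psi_rodrigues[OF \<alpha>] norm_Pair)
  hence "dist q peq \<ge> 2" by (intro power2_le_imp_le[of 2 "dist q peq"]) auto
  hence "\<not> dist (p t) q < 1" using t(1) dist_triangle[of q peq "p t"] by (simp add: dist_commute)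
  thus "\<exists>p. sol p \<and> dist (p 0) (rodrigues \<alpha> pi, 0, 0) < \<delta>
    \<and> \<not> (\<forall>t\<ge>0. dist (p t) (rodrigues \<alpha> pi, 0, 0) < 1)"
    using p(1) near t(2) unfolding q_def by blast
qed simp

lemma sol_infdist_tendsto:
  assumes "sol p"
  shows "((\<lambda>t. infdist (fst (p t)) ({mat 1} \<union> {rodrigues \<alpha> pi | \<alpha>. norm \<alpha> = 1})) \<longlongrightarrow> 0) at_top"
proof (rule tendstoI)
  fix \<epsilon> :: real assume "\<epsilon> > 0"
  obtain \<delta> where \<delta>: "\<delta> > 0" "\<And>R. R \<in> SO3 \<Longrightarrow> norm (eR R) < \<delta> \<Longrightarrow>
      infdist R ({mat 1} \<union> {rodrigues \<alpha> pi | \<alpha>. norm \<alpha> = 1}) < \<epsilon>"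
    using SO3_near_critical[OF \<open>\<epsilon> > 0\<close>] by blast
  have "((\<lambda>t. fst (Z (p t))) \<longlongrightarrow> fst (0 :: (real^3) \<times> (real^3) \<times> (real^'n))) at_top"
    by (intro tendsto_fst sol_Z_tendsto assms)
  hence "\<forall>\<^sub>F t in at_top. dist (fst (Z (p t))) 0 < \<delta>" using \<delta>(1) tendstoD by fastforce
  moreover have "\<forall>\<^sub>F t in at_top. (t::real) \<ge> 0" by (rule eventually_ge_at_top)
  ultimately show "\<forall>\<^sub>F t in at_top. dist (infdist (fst (p t)) ({mat 1} \<union> {rodrigues \<alpha> pi | \<alpha>. norm \<alpha> = 1})) 0 < \<epsilon>"
  proof eventually_elim
    case (elim t)
    show ?case using \<delta>(2)[OF sol_D(1)[OF assms elim(2)]] elim(1)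
      by (simp add: Z_def dist_real_def infdist_nonneg)
  qed
qed


subsection \<open>A cone condition at the undesired equilibria\<close>

text \<open>For a difference \<open>\<delta>\<close> of two states near \<open>(R\<^sub>0, 0, 0)\<close>, \<open>R\<^sub>0 = exp (\<pi> \<alpha>)\<close>, the linear map \<open>loc \<alpha>\<close>
  reads off a local rotation vector \<open>\<zeta>\<close> of its rotation part. Its component along \<open>\<alpha>\<close> is the only
  one seen by \<open>e\<^sub>R\<close> to first order; the two others are tangent to the set of undesired equilibria.\<close>

definition loc :: "real^3 \<Rightarrow> real^3^3 \<Rightarrow> real^3" where
  "loc \<alpha> M = eR (transpose (rodrigues \<alpha> pi) ** M)"

definition Zloc :: "real^3 \<Rightarrow> (real^3^3) \<times> (real^3) \<times> (real^'n) \<Rightarrow> (real^3) \<times> (real^3) \<times> (real^'n)" where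
  "Zloc \<alpha> p = (- (\<alpha> \<bullet> loc \<alpha> (fst p)) *\<^sub>R \<alpha>, snd p)"

definition Cloc :: "real^3 \<Rightarrow> (real^3^3) \<times> (real^3) \<times> (real^'n) \<Rightarrow> real^3" where
  "Cloc \<alpha> p = loc \<alpha> (fst p) - (\<alpha> \<bullet> loc \<alpha> (fst p)) *\<^sub>R \<alpha>"

lemma linear_loc: "linear (loc \<alpha>)"
  unfolding loc_def
  by (rule linearI) (simp_all add: linear_add[OF linear_eR] linear_scale[OF linear_eR]
      matrix_add_ldistrib matrix_mult_scaleR_right)

lemma linear_Zloc: "linear (Zloc \<alpha>)"
  unfolding Zloc_def
  by (rule linearI) (simp_all add: linear_add[OF linear_loc] linear_scale[OF linear_loc] inner_add_right
      scaleR_add_left scaleR_diff_left)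

lemma linear_Cloc: "linear (Cloc \<alpha>)"
  unfolding Cloc_def
  by (rule linearI) (simp_all add: linear_add[OF linear_loc] linear_scale[OF linear_loc] inner_add_right
      scaleR_add_left scaleR_diff_right)

lemma bounded_linear_Zloc: "bounded_linear (Zloc \<alpha>)"
  using linear_Zloc by (simp add: linear_conv_bounded_linear)

lemma bounded_linear_Cloc: "bounded_linear (Cloc \<alpha>)"
  using linear_Cloc by (simp add: linear_conv_bounded_linear)

text \<open>The controller state is left unrestricted: it enters \<open>F\<close> linearly and
  contributes nothing to the remainder.\<close>

definition near :: "real \<Rightarrow> real^3 \<Rightarrow> (real^3^3) \<times> (real^3) \<times> (real^'n) \<Rightarrow> bool" where
  "near r \<alpha> p \<longleftrightarrow> fst p \<in> SO3 \<and> norm (fst p - rodrigues \<alpha> pi) \<le> r \<and> norm (fst (snd p)) \<le> r"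

section \<open>Differences of states near a half-turn\<close>

context
  fixes \<alpha> :: "real^3" and r :: real and p q :: "(real^3^3) \<times> (real^3) \<times> (real^'n)"
  assumes \<alpha>: "norm \<alpha> = 1" and r: "0 \<le> r" "r \<le> 1/2" and near: "near r \<alpha> p" "near r \<alpha> q"
begin

lemma R0: "rodrigues \<alpha> pi \<in> SO3" "transpose (rodrigues \<alpha> pi) ** rodrigues \<alpha> pi = mat 1"
    "rodrigues \<alpha> pi ** transpose (rodrigues \<alpha> pi) = mat 1"
    "transpose (transpose (rodrigues \<alpha> pi)) ** transpose (rodrigues \<alpha> pi) = mat 1"
  using rodrigues_SO3[OF \<alpha>] SO3_D[OF rodrigues_SO3[OF \<alpha>]] by auto

lemma norm_R0_mult: "norm (transpose (rodrigues \<alpha> pi) ** M) = norm M"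
  by (rule norm_orthogonal_mult[OF R0(4)])

lemma near_rotation:
  assumes "near r \<alpha> u"
  shows "norm (transpose (rodrigues \<alpha> pi) ** fst u - mat 1) \<le> r"
proof -
  have "transpose (rodrigues \<alpha> pi) ** fst u - mat 1 = transpose (rodrigues \<alpha> pi) ** (fst u - rodrigues \<alpha> pi)"
    by (simp add: bounded_bilinear.diff_right[OF bounded_bilinear_matrix_mult] R0)
  thus ?thesis using assms by (simp add: norm_R0_mult near_def)
qed

lemma loc_almost_skew:
  "norm (transpose (rodrigues \<alpha> pi) ** (fst p - fst q) - skew (loc \<alpha> (fst p - fst q))) \<le> r * norm (fst p - fst q)"
proof -
  have "transpose (rodrigues \<alpha> pi) ** fst p \<in> SO3" "transpose (rodrigues \<alpha> pi) ** fst q \<in> SO3"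
    using near by (auto simp: near_def intro: SO3_transpose_mult[OF R0(1)])
  from SO3_diff_almost_skew[OF this near_rotation[OF near(1)] near_rotation[OF near(2)]]
  show ?thesis
    by (simp add: loc_def norm_R0_mult flip: bounded_bilinear.diff_right[OF bounded_bilinear_matrix_mult])
qed

text \<open>The non-skew part is at most half of the difference because \<open>r \<le> 1/2\<close>,
  so it can be absorbed; \<open>loc\<close> then loses no information.\<close>

lemma norm_diff_le_loc: "norm (fst p - fst q) \<le> 4 * norm (loc \<alpha> (fst p - fst q))"
proof -
  define A where "A = transpose (rodrigues \<alpha> pi) ** (fst p - fst q)"
  have A: "norm A = norm (fst p - fst q)" by (simp add: A_def norm_R0_mult)
  have "norm A \<le> norm (skew (loc \<alpha> (fst p - fst q))) + r * norm A"
    using norm_triangle_sub[of A "skew (loc \<alpha> (fst p - fst q))"] loc_almost_skew by (simp add: A A_def[symmetric])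
  moreover have "r * norm A \<le> 1/2 * norm A" using r by (intro mult_right_mono) auto
  ultimately show ?thesis using norm_skew_le[of "loc \<alpha> (fst p - fst q)"] A by linarith
qed

lemma eR_diff_approx:
  "norm (eR (fst p - fst q) + (\<alpha> \<bullet> loc \<alpha> (fst p - fst q)) *\<^sub>R \<alpha>) \<le> r * norm (fst p - fst q)"
proof -
  define \<zeta> where "\<zeta> = loc \<alpha> (fst p - fst q)"
  define E where "E = transpose (rodrigues \<alpha> pi) ** (fst p - fst q) - skew \<zeta>"
  have "fst p - fst q = rodrigues \<alpha> pi ** (skew \<zeta> + E)"
    by (simp add: E_def matrix_mul_assoc R0)
  hence "eR (fst p - fst q) = eR (rodrigues \<alpha> pi ** skew \<zeta>) + eR (rodrigues \<alpha> pi ** E)"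
    by (simp add: matrix_add_ldistrib linear_add[OF linear_eR])
  hence "eR (fst p - fst q) + (\<alpha> \<bullet> \<zeta>) *\<^sub>R \<alpha> = eR (rodrigues \<alpha> pi ** E)"
    by (simp add: eR_rodrigues_pi_skew[OF \<alpha>])
  also have "norm \<dots> \<le> norm (rodrigues \<alpha> pi ** E)" by (rule norm_eR_le)
  also have "\<dots> = norm E" by (rule norm_orthogonal_mult[OF R0(2)])
  finally show ?thesis using loc_almost_skew by (simp add: E_def \<zeta>_def)
qed

text \<open>To first order the local rotation vector moves with velocity w. Both error terms carry a
  factor \<open>r\<close>, one from the attitude and one from the angular velocity.\<close>

lemma loc_F_approx:
  "norm (loc \<alpha> (fst (F p - F q)) - fst (snd (p - q))) \<le> 2 * r * (norm (fst (snd (p - q))) + norm (fst p - fst q))"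
proof -
  define w where "w = fst (snd (p - q))"
  define A where "A = transpose (rodrigues \<alpha> pi)"
  have "fst (F p - F q) = fst p ** skew w + (fst p - fst q) ** skew (fst (snd q))"
    by (simp add: F_def w_def linear_diff[OF linear_skew]
        bounded_bilinear.diff_left[OF bounded_bilinear_matrix_mult]
        bounded_bilinear.diff_right[OF bounded_bilinear_matrix_mult])
  hence "A ** fst (F p - F q) = skew w + ((A ** fst p - mat 1) ** skew w + A ** ((fst p - fst q) ** skew (fst (snd q))))"
    by (simp add: matrix_add_ldistrib matrix_mul_assoc
        bounded_bilinear.diff_left[OF bounded_bilinear_matrix_mult])
  hence "loc \<alpha> (fst (F p - F q)) - w = eR ((A ** fst p - mat 1) ** skew w + A ** ((fst p - fst q) ** skew (fst (snd q))))"
    by (simp add: loc_def A_def linear_add[OF linear_eR])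
  also have "norm \<dots> \<le> norm ((A ** fst p - mat 1) ** skew w) + norm (A ** ((fst p - fst q) ** skew (fst (snd q))))"
    by (intro order_trans[OF norm_eR_le] norm_triangle_ineq)
  also have "\<dots> \<le> norm (A ** fst p - mat 1) * norm (skew w) + norm (fst p - fst q) * norm (skew (fst (snd q)))"
    unfolding A_def norm_R0_mult by (intro add_mono norm_matrix_mult_le)
  also have "\<dots> \<le> r * (2 * norm w) + norm (fst p - fst q) * (2 * r)"
  proof (intro add_mono mult_mono)
    show "norm (A ** fst p - mat 1) \<le> r" unfolding A_def by (rule near_rotation[OF near(1)])
    show "norm (skew (fst (snd q))) \<le> 2 * r"
      using norm_skew_le[of "fst (snd q)"] near(2) by (simp add: near_def)
  qed (use r norm_skew_le in auto)
  finally show ?thesis by (simp add: w_def algebra_simps)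
qed

lemma norm_loc_le: "norm (loc \<alpha> (fst p - fst q)) \<le> norm (Zloc \<alpha> (p - q)) + norm (Cloc \<alpha> (p - q))"
proof -
  define \<zeta> where "\<zeta> = loc \<alpha> (fst p - fst q)"
  have "norm ((\<alpha> \<bullet> \<zeta>) *\<^sub>R \<alpha>) \<le> norm (Zloc \<alpha> (p - q))"
  proof -
    have "norm (fst z) \<le> norm z" for z :: "(real^3) \<times> (real^3) \<times> (real^'n)"
      by (cases z) (simp add: norm_fst_le)
    from this[of "Zloc \<alpha> (p - q)"] show ?thesis by (simp add: Zloc_def \<zeta>_def)
  qed
  moreover have "\<zeta> = (\<alpha> \<bullet> \<zeta>) *\<^sub>R \<alpha> + Cloc \<alpha> (p - q)" by (simp add: Cloc_def \<zeta>_def)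
  hence "norm \<zeta> \<le> norm ((\<alpha> \<bullet> \<zeta>) *\<^sub>R \<alpha>) + norm (Cloc \<alpha> (p - q))" by (metis norm_triangle_ineq)
  ultimately show ?thesis by (simp add: \<zeta>_def)
qed

end

text \<open>The second variation of \<open>V\<close> at a half-turn: from \<bar>e_R\<bar>^2 = Psi (2
  - Psi), Psi is 2 - \<bar>e_R\<bar>^2 / 2 to second order, so \<open>2 * p11 * Psi\<close>
  contributes \<open>- p11 * |e|^2\<close>.\<close>

definition \<gamma> :: "(real^3) \<times> (real^3) \<times> (real^'n) \<Rightarrow> (real^3) \<times> (real^3) \<times> (real^'n) \<Rightarrow> real" where
  "\<gamma> z z' = \<beta> z z' - p11 * (fst z \<bullet> fst z')"

lemma bounded_bilinear_\<gamma>: "bounded_bilinear \<gamma>"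
proof -
  have "bilinear \<gamma>"
    using bounded_bilinear_\<beta> unfolding bilinear_conv_bounded_bilinear[symmetric] bilinear_def
    by (auto simp: \<gamma>_def linear_iff inner_add_left inner_add_right algebra_simps)
  thus ?thesis by (simp add: bilinear_conv_bounded_bilinear)
qed

lemma \<gamma>_commute: "\<gamma> z z' = \<gamma> z' z"
  by (simp add: \<gamma>_def \<beta>_commute[of z] inner_commute)

text \<open>The linearized closed loop in the coordinates \<open>Zloc\<close>; its first component
  is the derivative of - (\<alpha> . \<zeta>) \<alpha> when \<zeta>' = w.\<close>

definition Lz :: "real^3 \<Rightarrow> (real^3) \<times> (real^3) \<times> (real^'n) \<Rightarrow> (real^3) \<times> (real^3) \<times> (real^'n)" where
  "Lz \<alpha> z = (- (\<alpha> \<bullet> fst (snd z)) *\<^sub>R \<alpha>, Jinv *v Fw (fst z) (fst (snd z)) (snd (snd z)),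
     Fx (fst z) (fst (snd z)) (snd (snd z)))"

text \<open>For e = - s \<alpha> and e' = - (\<alpha> . w) \<alpha> one has e . e' = - e . w, which
  undoes the sign of \<open>p11\<close> in \<open>\<gamma>\<close>. The expression is literally that
  of \<open>dissipation\<close> with \<open>u = e'\<close>, and \<bar>e'\<bar> \<le>
  \<bar>w\<bar>.\<close>

lemma \<gamma>_linearized_dissipation:
  obtains k where "k > 0"
    "\<And>\<alpha> p. norm \<alpha> = 1 \<Longrightarrow> 2 * \<gamma> (Zloc \<alpha> p) (Lz \<alpha> (Zloc \<alpha> p)) \<le> - k * (norm (Zloc \<alpha> p))\<^sup>2"
proof -
  obtain k where k: "k > 0" "\<And>e w x u. norm u \<le> norm w \<Longrightarrow>
      2 * p11 * (e \<bullet> w) + 2 * \<beta> (e, w, x) (u, Jinv *v Fw e w x, Fx e w x) \<le> - k * (norm (e, w, x))\<^sup>2"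
    using dissipation by blast
  show ?thesis
  proof (rule that[OF k(1)])
    fix \<alpha> p assume \<alpha>: "norm (\<alpha>::real^3) = 1"
    obtain e w x where z: "Zloc \<alpha> p = (e, w, x)" by (cases "Zloc \<alpha> p") auto
    define s where "s = \<alpha> \<bullet> loc \<alpha> (fst p)"
    have e: "e = - s *\<^sub>R \<alpha>" using z by (simp add: Zloc_def s_def)
    have "norm (- (\<alpha> \<bullet> w) *\<^sub>R \<alpha>) \<le> norm w"
      using Cauchy_Schwarz_ineq2[of \<alpha> w] \<alpha> by simp
    from k(2)[OF this, of e x]
    show "2 * \<gamma> (Zloc \<alpha> p) (Lz \<alpha> (Zloc \<alpha> p)) \<le> - k * (norm (Zloc \<alpha> p))\<^sup>2"
      using \<alpha> by (simp add: z Lz_def \<gamma>_def e norm_eq_1 algebra_simps)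
  qed
qed

text \<open>The constant is chosen before \<alpha>, so one radius later works for all half-turns. In
  the second bound the center part appears only with a factor \<open>r\<close>: to first order it is
  driven by w alone.\<close>

lemma Zloc_F_approx:
  obtains C where "C > 0"
    "\<And>\<alpha> r p q. norm \<alpha> = 1 \<Longrightarrow> 0 \<le> r \<Longrightarrow> r \<le> 1/2 \<Longrightarrow> near r \<alpha> p \<Longrightarrow> near r \<alpha> q \<Longrightarrow>
      norm (Zloc \<alpha> (F p - F q) - Lz \<alpha> (Zloc \<alpha> (p - q)))
        \<le> C * r * (norm (Zloc \<alpha> (p - q)) + norm (Cloc \<alpha> (p - q)))"
    "\<And>\<alpha> r p q. norm \<alpha> = 1 \<Longrightarrow> 0 \<le> r \<Longrightarrow> r \<le> 1/2 \<Longrightarrow> near r \<alpha> p \<Longrightarrow> near r \<alpha> q \<Longrightarrow>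
      norm (Cloc \<alpha> (F p - F q)) \<le> 2 * norm (Zloc \<alpha> (p - q))
        + C * r * (norm (Zloc \<alpha> (p - q)) + norm (Cloc \<alpha> (p - q)))"
proof -
  have "bounded_linear (\<lambda>e. (Jinv *v (D\<theta> *v e), B\<theta> *v e))"
    by (intro bounded_linear_Pair bounded_linear_compose[OF matrix_vector_mul_bounded_linear]
        matrix_vector_mul_bounded_linear)
  from bounded_linear.pos_bounded[OF this]
  obtain G where G: "G > 0" "\<And>e. norm (Jinv *v (D\<theta> *v e), B\<theta> *v e) \<le> norm e * G"
    by blast
  show ?thesis
  \<comment> \<open>From \<bar>w\<bar> \<le> a and \<bar>D\<bar> \<le> 4 (a + d) the error of \<eta>
    is \<open>10 * r * (a + d)\<close>, counted twice in the center part. The error of e_R is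
    \<open>4 * r * (a + d)\<close> and enters the dynamics with gain \<open>G\<close>.\<close>
  proof (rule that[of "4 * G + 20"])
    show "4 * G + 20 > 0" using G by simp
    fix \<alpha> :: "real^3" and r :: real and p q
    assume *: "norm \<alpha> = 1" "0 \<le> r" "r \<le> 1/2" "near r \<alpha> p" "near r \<alpha> q"
    define \<zeta> where "\<zeta> = loc \<alpha> (fst p - fst q)"
    define w where "w = fst (snd (p - q))"
    define D where "D = fst p - fst q"
    define a d where "a = norm (Zloc \<alpha> (p - q))" and "d = norm (Cloc \<alpha> (p - q))"
    have ad: "a \<ge> 0" "d \<ge> 0" by (simp_all add: a_def d_def)
    have w_le: "norm w \<le> a"
    proof -
      show ?thesis using norm_fst_snd_le[of "Zloc \<alpha> (p - q)"] by (simp add: a_def w_def Zloc_def)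
    qed
    have D_le: "norm D \<le> 4 * (a + d)"
      using norm_diff_le_loc[OF *] norm_loc_le[OF *] by (simp add: D_def a_def d_def)
    define \<eta> where "\<eta> = loc \<alpha> (fst (F p - F q))"
    have \<eta>: "norm (\<eta> - w) \<le> r * (10 * (a + d))"
    proof -
      have "norm (\<eta> - w) \<le> 2 * r * (norm w + norm D)"
        using loc_F_approx[OF *] by (simp add: \<eta>_def w_def D_def)
      also have "\<dots> \<le> 2 * r * (5 * (a + d))"
        using *(2) w_le D_le ad by (intro mult_left_mono) auto
      finally show ?thesis by (simp add: algebra_simps)
    qed
    have err: "norm (eR D + (\<alpha> \<bullet> \<zeta>) *\<^sub>R \<alpha>) \<le> r * (4 * (a + d))"
      using eR_diff_approx[OF *] mult_left_mono[OF D_le *(2)] by (simp add: D_def \<zeta>_def)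
    \<comment> \<open>\<open>h\<close> is the only error in the velocities of w and x, all other
      terms there being linear in the difference.\<close>
    define h where "h = eR D + (\<alpha> \<bullet> \<zeta>) *\<^sub>R \<alpha>"
    have eRD: "eR (fst p) - eR (fst q) = eR D" by (simp add: D_def linear_diff[OF linear_eR])
    have "Zloc \<alpha> (F p - F q) - Lz \<alpha> (Zloc \<alpha> (p - q)) =
        (- (\<alpha> \<bullet> (\<eta> - w)) *\<^sub>R \<alpha>, Jinv *v (D\<theta> *v h), B\<theta> *v h)"
    proof -
      have "snd (F p - F q) = (Jinv *v Fw (eR D) w (snd (snd (p - q))), Fx (eR D) w (snd (snd (p - q))))"
        by (simp add: F_def Fw_def Fx_def eRD[symmetric] w_def matrix_vector_mult_diff_distrib
            matrix_vector_right_distrib algebra_simps)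
      moreover have "snd (Lz \<alpha> (Zloc \<alpha> (p - q)))
          = (Jinv *v Fw (- (\<alpha> \<bullet> \<zeta>) *\<^sub>R \<alpha>) w (snd (snd (p - q))), Fx (- (\<alpha> \<bullet> \<zeta>) *\<^sub>R \<alpha>) w (snd (snd (p - q))))"
        by (simp add: Lz_def Zloc_def \<zeta>_def w_def)
      ultimately have "snd (F p - F q) - snd (Lz \<alpha> (Zloc \<alpha> (p - q))) = (Jinv *v (D\<theta> *v h), B\<theta> *v h)"
        by (simp add: Fw_def Fx_def h_def matrix_vector_mult_diff_distrib[symmetric])
      thus ?thesis
        by (simp add: prod_eq_iff Zloc_def[of \<alpha> "F p - F q"])
          (simp add: Lz_def Zloc_def \<eta>_def w_def inner_diff_right scaleR_diff_left)
    qed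
    hence "norm (Zloc \<alpha> (F p - F q) - Lz \<alpha> (Zloc \<alpha> (p - q)))
        \<le> norm (- (\<alpha> \<bullet> (\<eta> - w)) *\<^sub>R \<alpha>) + norm (Jinv *v (D\<theta> *v h), B\<theta> *v h)"
      by (simp only: norm_Pair_le)
    also have "\<dots> \<le> norm (\<eta> - w) + norm h * G"
    proof (intro add_mono G)
      show "norm (- (\<alpha> \<bullet> (\<eta> - w)) *\<^sub>R \<alpha>) \<le> norm (\<eta> - w)"
        using Cauchy_Schwarz_ineq2[of \<alpha> "\<eta> - w"] *(1) by simp
    qed
    also have "\<dots> \<le> r * (10 * (a + d)) + r * (4 * (a + d)) * G"
      using \<eta> err G(1) by (intro add_mono mult_right_mono) (auto simp: h_def)
    also have "\<dots> \<le> (4 * G + 20) * r * (a + d)"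
      using *(2) ad by (simp add: algebra_simps)
    finally show "norm (Zloc \<alpha> (F p - F q) - Lz \<alpha> (Zloc \<alpha> (p - q)))
        \<le> (4 * G + 20) * r * (norm (Zloc \<alpha> (p - q)) + norm (Cloc \<alpha> (p - q)))"
      by (simp add: a_def d_def)
    have "norm (Cloc \<alpha> (F p - F q)) \<le> norm \<eta> + norm ((\<alpha> \<bullet> \<eta>) *\<^sub>R \<alpha>)"
      unfolding Cloc_def \<eta>_def by (rule norm_triangle_ineq4)
    also have "\<dots> \<le> 2 * norm \<eta>"
      using Cauchy_Schwarz_ineq2[of \<alpha> \<eta>] *(1) by simp
    also have "\<dots> \<le> 2 * (a + r * (10 * (a + d)))"
      using norm_triangle_sub[of \<eta> w] \<eta> w_le by (simp add: algebra_simps)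
    also have "\<dots> \<le> 2 * a + (4 * G + 20) * r * (a + d)"
      using *(2) ad G(1) by (simp add: algebra_simps)
    finally show "norm (Cloc \<alpha> (F p - F q)) \<le> 2 * norm (Zloc \<alpha> (p - q))
        + (4 * G + 20) * r * (norm (Zloc \<alpha> (p - q)) + norm (Cloc \<alpha> (p - q)))"
      by (simp add: a_def d_def)
  qed
qed

text \<open>Two solutions that stay near the same undesired equilibrium cannot differ along the cone
  \<open>- \<gamma> > \<epsilon> \<bar>c\<bar>\<^sup>2\<close>, as their difference would grow exponentially there.\<close>

lemma trapped_outside_cone:
  obtains r \<epsilon> where "r > 0" "r \<le> 1/2" "\<epsilon> > 0"
    "\<And>\<alpha> p q n. norm \<alpha> = 1 \<Longrightarrow> sol p \<Longrightarrow> sol q \<Longrightarrow> n \<ge> 0 \<Longrightarrow>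
      (\<And>t. t \<ge> n \<Longrightarrow> near r \<alpha> (p t)) \<Longrightarrow> (\<And>t. t \<ge> n \<Longrightarrow> near r \<alpha> (q t)) \<Longrightarrow>
      - \<gamma> (Zloc \<alpha> (p n - q n)) (Zloc \<alpha> (p n - q n)) \<le> \<epsilon> * (norm (Cloc \<alpha> (p n - q n)))\<^sup>2"
proof -
  obtain k where k: "k > 0"
    "\<And>\<alpha> p. norm \<alpha> = 1 \<Longrightarrow> 2 * \<gamma> (Zloc \<alpha> p) (Lz \<alpha> (Zloc \<alpha> p)) \<le> - k * (norm (Zloc \<alpha> p))\<^sup>2"
    using \<gamma>_linearized_dissipation by blast
  obtain C where C: "C > 0"
    "\<And>\<alpha> r p q. norm \<alpha> = 1 \<Longrightarrow> 0 \<le> r \<Longrightarrow> r \<le> 1/2 \<Longrightarrow> near r \<alpha> p \<Longrightarrow> near r \<alpha> q \<Longrightarrow>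
      norm (Zloc \<alpha> (F p - F q) - Lz \<alpha> (Zloc \<alpha> (p - q)))
        \<le> C * r * (norm (Zloc \<alpha> (p - q)) + norm (Cloc \<alpha> (p - q)))"
    "\<And>\<alpha> r p q. norm \<alpha> = 1 \<Longrightarrow> 0 \<le> r \<Longrightarrow> r \<le> 1/2 \<Longrightarrow> near r \<alpha> p \<Longrightarrow> near r \<alpha> q \<Longrightarrow>
      norm (Cloc \<alpha> (F p - F q)) \<le> 2 * norm (Zloc \<alpha> (p - q))
        + C * r * (norm (Zloc \<alpha> (p - q)) + norm (Cloc \<alpha> (p - q)))"
    using Zloc_F_approx by blast
  obtain B where B: "B > 0" "\<And>z z'. norm (\<gamma> z z') \<le> norm z * norm z' * B"
    using bounded_bilinear.pos_bounded[OF bounded_bilinear_\<gamma>] by blast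
  \<comment> \<open>\<open>2 * B\<close> accounts for the factor 2 in the derivative of
    \<open>\<gamma> z z\<close>; the coupling constant 2 is that of the center bound in
    \<open>Zloc_F_approx\<close>. Shrinking \<open>r\<close> afterwards brings the remainder
    \<open>C * r\<close> below \<open>m\<close>.\<close>
  obtain \<epsilon> m \<kappa> where c: "\<epsilon> > 0" "m > 0" "\<kappa> > 0"
    "\<And>a d X Y Q. 0 \<le> a \<Longrightarrow> 0 \<le> d \<Longrightarrow> X \<le> - k * a\<^sup>2 + (2 * B) * a * (m * (a + d)) \<Longrightarrow>
      Y \<le> d * (2 * a + m * (a + d)) \<Longrightarrow> Q \<le> (2 * B) * a\<^sup>2 \<Longrightarrow>
      \<kappa> * (Q - \<epsilon> * d\<^sup>2) \<le> - X - 2 * \<epsilon> * Y"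
    using cone_constants[of k "2 * B" 2] k(1) B(1) by auto
  define r where "r = min (1/2) (m / C)"
  have r: "r > 0" "r \<le> 1/2" "C * r \<le> m" using c C(1) by (auto simp: r_def min_def field_simps)
  show ?thesis
  proof (rule that[OF r(1,2) c(1)])
    fix \<alpha> :: "real^3" and p q and n :: real
    assume \<alpha>: "norm \<alpha> = 1" and sols: "sol p" "sol q" and n: "n \<ge> 0"
      and nearp: "\<And>t. t \<ge> n \<Longrightarrow> near r \<alpha> (p t)" and nearq: "\<And>t. t \<ge> n \<Longrightarrow> near r \<alpha> (q t)"
    define z where "z t = Zloc \<alpha> (p t - q t)" for t
    define y where "y t = Cloc \<alpha> (p t - q t)" for t
    define z' where "z' t = Zloc \<alpha> (F (p t) - F (q t))" for t
    define y' where "y' t = Cloc \<alpha> (F (p t) - F (q t))" for t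
    \<comment> \<open>\<open>Q\<close> is positive exactly inside the cone. There it would grow at
      rate \<kappa>, yet it is bounded because both orbits are.\<close>
    define Q where "Q t = - \<gamma> (z t) (z t) - \<epsilon> * (y t \<bullet> y t)" for t
    have "Q n \<le> 0"
    proof -
      obtain Kp where Kp: "\<And>t. t \<ge> 0 \<Longrightarrow> norm (p t) \<le> Kp" using sol_bounded[OF sols(1)] by blast
      obtain Kq where Kq: "\<And>t. t \<ge> 0 \<Longrightarrow> norm (q t) \<le> Kq" using sol_bounded[OF sols(2)] by blast
      obtain Bz where Bz: "Bz > 0" "\<And>u. norm (Zloc \<alpha> u) \<le> norm u * Bz"
        using bounded_linear.pos_bounded[OF bounded_linear_Zloc] by blast
      show ?thesis
      proof (rule bounded_exponential_growth_nonpos[where Q = Q and \<kappa> = \<kappa> and a = n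
            and Q' = "\<lambda>t. - 2 * \<gamma> (z t) (z' t) - 2 * \<epsilon> * (y t \<bullet> y' t)"
            and B = "((Kp + Kq) * Bz) * ((Kp + Kq) * Bz) * B"])
        show "\<kappa> > 0" by fact
        fix t assume t: "t \<ge> n"
        have t0: "t \<ge> 0" using t n by simp
        have D: "((\<lambda>t. p t - q t) has_vector_derivative F (p t) - F (q t)) (at t within {n..})"
          using n by (intro has_vector_derivative_within_subset[OF
                has_vector_derivative_diff[OF sol_D(2)[OF sols(1) t0] sol_D(2)[OF sols(2) t0]]]) auto
        note dz = bounded_linear.has_vector_derivative[OF bounded_linear_Zloc[of \<alpha>] D, folded z_def z'_def]
        note dy = bounded_linear.has_vector_derivative[OF bounded_linear_Cloc[of \<alpha>] D, folded y_def y'_def]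
        have 1: "((\<lambda>t. \<gamma> (z t) (z t)) has_real_derivative 2 * \<gamma> (z t) (z' t)) (at t within {n..})"
          using bounded_bilinear.has_vector_derivative[OF bounded_bilinear_\<gamma> dz dz]
          by (simp add: has_real_derivative_iff_has_vector_derivative \<gamma>_commute[of "z' t"])
        have 2: "((\<lambda>t. y t \<bullet> y t) has_real_derivative 2 * (y t \<bullet> y' t)) (at t within {n..})"
          using bounded_bilinear.has_vector_derivative[OF bounded_bilinear_inner dy dy]
          by (simp add: has_real_derivative_iff_has_vector_derivative inner_commute)
        show "(Q has_real_derivative - 2 * \<gamma> (z t) (z' t) - 2 * \<epsilon> * (y t \<bullet> y' t)) (at t within {n..})"
          unfolding Q_def[abs_def] using 1 2 by (auto intro!: derivative_eq_intros)
        define a d where "a = norm (z t)" and "d = norm (y t)"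
        have ad: "0 \<le> a" "0 \<le> d" by (simp_all add: a_def d_def)
        note ass = \<alpha> less_imp_le[OF r(1)] r(2) nearp[OF t] nearq[OF t]
        have Cr: "C * r * (a + d) \<le> m * (a + d)" using r(3) ad by (intro mult_right_mono) auto
        have "\<kappa> * (- \<gamma> (z t) (z t) - \<epsilon> * d\<^sup>2) \<le> - (2 * \<gamma> (z t) (z' t)) - 2 * \<epsilon> * (y t \<bullet> y' t)"
        proof (rule c(4)[OF ad])
          have "2 * \<gamma> (z t) (z' t) = 2 * \<gamma> (z t) (Lz \<alpha> (z t)) + 2 * \<gamma> (z t) (z' t - Lz \<alpha> (z t))"
            by (simp add: bounded_bilinear.diff_right[OF bounded_bilinear_\<gamma>])
          also have "\<gamma> (z t) (z' t - Lz \<alpha> (z t)) \<le> a * norm (z' t - Lz \<alpha> (z t)) * B"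
            using B(2)[of "z t" "z' t - Lz \<alpha> (z t)"] by (simp add: a_def)
          also have "\<dots> \<le> a * (m * (a + d)) * B"
            using C(2)[OF ass] Cr ad B(1) by (intro mult_right_mono mult_left_mono)
              (auto simp: z_def z'_def y_def a_def d_def)
          finally show "2 * \<gamma> (z t) (z' t) \<le> - k * a\<^sup>2 + (2 * B) * a * (m * (a + d))"
            using k(2)[OF \<alpha>, of "p t - q t"] by (simp add: a_def z_def algebra_simps)
          have "y t \<bullet> y' t \<le> d * norm (y' t)" using norm_cauchy_schwarz[of "y t" "y' t"] by (simp add: d_def)
          also have "\<dots> \<le> d * (2 * a + m * (a + d))"
            using C(3)[OF ass] Cr ad by (intro mult_left_mono) (auto simp: z_def y'_def y_def a_def d_def)
          finally show "y t \<bullet> y' t \<le> d * (2 * a + m * (a + d))" .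
          have "- \<gamma> (z t) (z t) \<le> a * a * B" using B(2)[of "z t" "z t"] by (simp add: a_def)
          also have "\<dots> \<le> (2 * B) * a\<^sup>2" using B(1) by (simp add: power2_eq_square algebra_simps)
          finally show "- \<gamma> (z t) (z t) \<le> (2 * B) * a\<^sup>2" .
        qed
        thus "- 2 * \<gamma> (z t) (z' t) - 2 * \<epsilon> * (y t \<bullet> y' t) \<ge> \<kappa> * Q t"
          by (simp add: Q_def d_def power2_norm_eq_inner)
        have "norm (z t) \<le> (Kp + Kq) * Bz"
        proof -
          have "norm (p t - q t) \<le> Kp + Kq"
            using norm_triangle_ineq4[of "p t" "q t"] Kp[OF t0] Kq[OF t0] by linarith
          thus ?thesis using Bz(2)[of "p t - q t"] Bz(1) unfolding z_def
            by (meson mult_right_mono less_imp_le order_trans)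
        qed
        moreover have "Q t \<le> norm (z t) * norm (z t) * B"
        proof -
          have "0 \<le> \<epsilon> * (y t \<bullet> y t)" using c(1) by simp
          moreover have "- \<gamma> (z t) (z t) \<le> norm (z t) * norm (z t) * B"
            using B(2)[of "z t" "z t"] by simp
          ultimately show ?thesis unfolding Q_def by linarith
        qed
        moreover have "norm (z t) * norm (z t) * B \<le> ((Kp + Kq) * Bz) * ((Kp + Kq) * Bz) * B"
          using calculation(1) B(1) by (intro mult_right_mono mult_mono) (auto intro: order_trans[OF norm_ge_zero])
        ultimately show "Q t \<le> ((Kp + Kq) * Bz) * ((Kp + Kq) * Bz) * B" by linarith
      qed
    qed
    thus "- \<gamma> (Zloc \<alpha> (p n - q n)) (Zloc \<alpha> (p n - q n)) \<le> \<epsilon> * (norm (Cloc \<alpha> (p n - q n)))\<^sup>2"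
      by (simp add: Q_def z_def y_def power2_norm_eq_inner)
  qed
qed

text \<open>Outside the cone the \<open>\<alpha>\<close>-component is controlled by the remaining ones: the trapped states form a
  Lipschitz graph over a hyperplane.\<close>

definition proj :: "real^3 \<Rightarrow> (real^3^3) \<times> (real^3) \<times> (real^'n) \<Rightarrow> (real^3) \<times> (real^3) \<times> (real^'n)" where
  "proj \<alpha> p = (Cloc \<alpha> p, snd p)"

lemma trapped_lipschitz_graph:
  obtains r C where "r > 0" "C > 0"
    "\<And>\<alpha> p q n. norm \<alpha> = 1 \<Longrightarrow> sol p \<Longrightarrow> sol q \<Longrightarrow> n \<ge> 0 \<Longrightarrow>
      (\<And>t. t \<ge> n \<Longrightarrow> near r \<alpha> (p t)) \<Longrightarrow> (\<And>t. t \<ge> n \<Longrightarrow> near r \<alpha> (q t)) \<Longrightarrow>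
      norm (p n - q n) \<le> C * norm (proj \<alpha> (p n) - proj \<alpha> (q n))"
proof -
  obtain r \<epsilon> where r: "r > 0" "r \<le> 1/2" "\<epsilon> > 0"
    "\<And>\<alpha> p q n. norm \<alpha> = 1 \<Longrightarrow> sol p \<Longrightarrow> sol q \<Longrightarrow> n \<ge> 0 \<Longrightarrow>
      (\<And>t. t \<ge> n \<Longrightarrow> near r \<alpha> (p t)) \<Longrightarrow> (\<And>t. t \<ge> n \<Longrightarrow> near r \<alpha> (q t)) \<Longrightarrow>
      - \<gamma> (Zloc \<alpha> (p n - q n)) (Zloc \<alpha> (p n - q n)) \<le> \<epsilon> * (norm (Cloc \<alpha> (p n - q n)))\<^sup>2"
    using trapped_outside_cone by blast
  obtain B where B: "B > 0" "\<And>z z'. norm (\<beta> z z') \<le> norm z * norm z' * B"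
    using bounded_bilinear.pos_bounded[OF bounded_bilinear_\<beta>] by blast
  \<comment> \<open>Chosen so that the final inequality for \<open>s\<^sup>2\<close>, with half of
    \<open>p11\<close> spent on the cross term, reads
    \<open>s\<^sup>2 \<le> (G * N)\<^sup>2\<close>.\<close>
  define G where "G = sqrt ((2 / p11) * (\<epsilon> + 2 * B\<^sup>2 / p11 + B))"
  have "0 \<le> 2 * B\<^sup>2 / p11" using p11_pos by simp
  hence "0 < \<epsilon> + 2 * B\<^sup>2 / p11 + B" using B(1) r(3) by linarith
  hence "G > 0" using p11_pos unfolding G_def by (intro real_sqrt_gt_zero mult_pos_pos) auto
  show ?thesis
  proof (rule that[OF r(1), of "4 * G + 5"])
    show "4 * G + 5 > 0" using \<open>G > 0\<close> by simp
    fix \<alpha> :: "real^3" and p q and n :: real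
    assume \<alpha>: "norm \<alpha> = 1" and sols: "sol p" "sol q" and n: "n \<ge> 0"
      and nearp: "\<And>t. t \<ge> n \<Longrightarrow> near r \<alpha> (p t)" and nearq: "\<And>t. t \<ge> n \<Longrightarrow> near r \<alpha> (q t)"
    define D where "D = p n - q n"
    define s where "s = \<bar>\<alpha> \<bullet> loc \<alpha> (fst D)\<bar>"
    define e where "e = - (\<alpha> \<bullet> loc \<alpha> (fst D)) *\<^sub>R \<alpha>"
    define y where "y = norm (snd D)"
    define d where "d = norm (Cloc \<alpha> D)"
    define N where "N = norm (proj \<alpha> (p n) - proj \<alpha> (q n))"
    have pD: "proj \<alpha> (p n) - proj \<alpha> (q n) = (Cloc \<alpha> D, snd D)"
      by (simp add: proj_def D_def linear_diff[OF linear_Cloc])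
    have N: "N\<^sup>2 = d\<^sup>2 + y\<^sup>2" by (simp add: N_def pD norm_Pair d_def y_def)
    have dN: "d \<le> N" and yN: "y \<le> N"
      unfolding N_def pD d_def y_def by (rule norm_fst_le, rule norm_snd_le)
    have e: "norm e = s" using \<alpha> by (simp add: e_def s_def)
    have Z: "Zloc \<alpha> D = (e, 0) + (0, snd D)" by (simp add: Zloc_def e_def)
    \<comment> \<open>\<open>\<beta>\<close> has no pure attitude block, so the term
      \<open>p11 * s\<^sup>2\<close> in \<open>- \<gamma>\<close> is opposed only by terms
      containing the w, x part \<open>y\<close>. This is why \<open>s\<close> can be solved
      for.\<close>
    have "\<beta> (Zloc \<alpha> D) (Zloc \<alpha> D) = 2 * \<beta> (e, 0) (0, snd D) + \<beta> (0, snd D) (0, snd D)"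
    proof -
      have "\<beta> (e, 0) (e, 0) = 0" by (simp add: \<beta>_def zero_prod_def)
      thus ?thesis
        unfolding Z bounded_bilinear.add_left[OF bounded_bilinear_\<beta>] bounded_bilinear.add_right[OF bounded_bilinear_\<beta>]
        by (simp add: \<beta>_commute[of "(0, snd D)" "(e, 0)"])
    qed
    also have "\<dots> \<le> 2 * (s * y * B) + y * y * B"
    proof -
      have "\<bar>s\<bar> = s" by (simp add: s_def)
      hence "norm (e, 0 :: (real^3) \<times> (real^'n)) = s" "norm (0 :: real^3, snd D) = y"
        by (simp_all add: norm_Pair e y_def)
      thus ?thesis
        using B(2)[of "(e, 0)" "(0, snd D)"] B(2)[of "(0, snd D)" "(0, snd D)"]
        by (simp add: abs_le_iff)
    qed
    finally have \<beta>_le: "\<beta> (Zloc \<alpha> D) (Zloc \<alpha> D) \<le> 2 * (s * y * B) + y * y * B" .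
    have yy: "y * y * B = B * y\<^sup>2" by (simp add: power2_eq_square)
    have "p11 * s\<^sup>2 - \<beta> (Zloc \<alpha> D) (Zloc \<alpha> D) \<le> \<epsilon> * d\<^sup>2"
    proof -
      have "fst (Zloc \<alpha> D) \<bullet> fst (Zloc \<alpha> D) = s\<^sup>2"
        by (simp only: Zloc_def e_def[symmetric] fst_conv power2_norm_eq_inner[symmetric] e)
      thus ?thesis
        using r(4)[OF \<alpha> sols n nearp nearq] by (simp add: \<gamma>_def D_def[symmetric] d_def)
    qed
    moreover have "2 * (s * y * B) \<le> p11 / 2 * s\<^sup>2 + 2 * B\<^sup>2 / p11 * y\<^sup>2"
    proof -
      have "0 \<le> (p11 * s - 2 * B * y)\<^sup>2 / (2 * p11)" using p11_pos by simp
      also have "\<dots> = p11 / 2 * s\<^sup>2 + 2 * B\<^sup>2 / p11 * y\<^sup>2 - 2 * (s * y * B)"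
        using p11_pos by (simp add: power2_eq_square field_simps)
      finally show ?thesis by simp
    qed
    ultimately have "p11 / 2 * s\<^sup>2 \<le> \<epsilon> * d\<^sup>2 + 2 * B\<^sup>2 / p11 * y\<^sup>2 + B * y\<^sup>2"
      using \<beta>_le yy by linarith
    also have "\<dots> \<le> \<epsilon> * N\<^sup>2 + 2 * B\<^sup>2 / p11 * N\<^sup>2 + B * N\<^sup>2"
      using r(3) B(1) p11_pos by (intro add_mono mult_left_mono) (auto simp: N)
    finally have "s\<^sup>2 \<le> (2 / p11) * ((\<epsilon> + 2 * B\<^sup>2 / p11 + B) * N\<^sup>2)"
      using p11_pos by (simp add: field_simps)
    also have "\<dots> = (G * N)\<^sup>2"
    proof -
      have "0 \<le> (2 / p11) * (\<epsilon> + 2 * B\<^sup>2 / p11 + B)" using r(3) B(1) p11_pos by auto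
      thus ?thesis by (simp add: G_def power_mult_distrib)
    qed
    finally have sN: "s \<le> G * N"
      by (rule power2_le_imp_le) (use \<open>G > 0\<close> in \<open>simp add: N_def\<close>)
    have "norm (loc \<alpha> (fst D)) \<le> s + d"
    proof -
      have "loc \<alpha> (fst D) = (\<alpha> \<bullet> loc \<alpha> (fst D)) *\<^sub>R \<alpha> + Cloc \<alpha> D" by (simp add: Cloc_def)
      hence "norm (loc \<alpha> (fst D)) \<le> norm ((\<alpha> \<bullet> loc \<alpha> (fst D)) *\<^sub>R \<alpha>) + norm (Cloc \<alpha> D)"
        by (metis norm_triangle_ineq)
      thus ?thesis using \<alpha> by (simp add: s_def d_def)
    qed
    moreover have "norm (fst D) \<le> 4 * norm (loc \<alpha> (fst D))"
      using norm_diff_le_loc[OF \<alpha> less_imp_le[OF r(1)] r(2) nearp[OF order_refl] nearq[OF order_refl]]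
      by (simp add: D_def)
    moreover have "norm D \<le> norm (fst D) + y"
      using norm_Pair_le[of "fst D" "snd D"] by (simp add: y_def)
    ultimately have "norm D \<le> 4 * (s + d) + y" by simp
    also have "\<dots> \<le> 4 * (G * N + N) + N"
      using sN dN yN by (intro add_mono mult_left_mono) auto
    finally have "norm D \<le> 4 * (G * N + N) + N" .
    thus "norm (p n - q n) \<le> (4 * G + 5) * norm (proj \<alpha> (p n) - proj \<alpha> (q n))"
      by (simp add: D_def N_def[symmetric] algebra_simps)
  qed
qed

end

subsection \<open>The exponential chart\<close>

lemma norm_sgn_1: "v \<noteq> 0 \<Longrightarrow> norm (sgn v) = 1" for v :: "'a::real_normed_vector"
  by (simp add: norm_sgn)

text \<open>On the shell \<open>k \<pi> < \<bar>v\<bar> < (k + 1) \<pi>\<close> the exponential is inverted by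
  \<open>\<theta> / sin \<theta> * e\<^sub>R\<close>, where \<open>\<theta> = \<bar>v\<bar>\<close> is recovered from \<open>cos \<theta> = 1 - \<Psi>\<close>.\<close>

lemma expso3_inverse_lipschitz:
  fixes v :: "real^3" and k :: nat
  assumes v: "real k * pi < norm v" "norm v < (real k + 1) * pi"
  obtains d B where "d > 0" "B > 0"
    "\<And>u. real k * pi < norm u \<Longrightarrow> norm u < (real k + 1) * pi \<Longrightarrow>
      norm (expso3 u - expso3 v) < d \<Longrightarrow> norm (u - v) \<le> B * norm (expso3 u - expso3 v)"
proof -
  \<comment> \<open>The common sign relating cosine and sine of \<bar>u\<bar> to those of
    \<bar>u\<bar> - k pi, which lies in the range where \<open>arccos\<close> inverts the
    cosine.\<close>
  define \<sigma> :: real where "\<sigma> = (-1) ^ k"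
  define g where "g c = (real k * pi + arccos (\<sigma> * c)) / (\<sigma> * sqrt (1 - c\<^sup>2))" for c
  define H where "H M = g (1 - Psi M) *\<^sub>R eR M" for M
  have \<sigma>: "\<sigma> = 1 \<or> \<sigma> = -1" by (cases "even k") (auto simp: \<sigma>_def)
  have shell: "\<bar>cos (norm u)\<bar> < 1 \<and> H (expso3 u) = u \<and> 1 - Psi (expso3 u) = cos (norm u)"
    if u: "real k * pi < norm u" "norm u < (real k + 1) * pi" for u
  proof -
    define \<phi> where "\<phi> = norm u - real k * pi"
    have \<phi>: "0 < \<phi>" "\<phi> < pi" using u by (auto simp: \<phi>_def algebra_simps)
    have n: "norm u = \<phi> + real k * pi" by (simp add: \<phi>_def)
    have cs: "cos (norm u) = \<sigma> * cos \<phi>" "sin (norm u) = \<sigma> * sin \<phi>"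
      unfolding n \<sigma>_def by (simp_all add: cos_add sin_add cos_npi sin_npi)
    have "u \<noteq> 0" using u(1) pi_gt_zero by (metis mult_nonneg_nonneg norm_zero not_less of_nat_0_le_iff pi_ge_zero)
    have "\<bar>cos \<phi>\<bar> < 1"
      using \<phi> cos_monotone_0_pi[of 0 \<phi>] cos_monotone_0_pi[of \<phi> pi] by simp
    hence c1: "\<bar>cos (norm u)\<bar> < 1" using \<sigma> unfolding cs by auto
    have Ps: "1 - Psi (expso3 u) = cos (norm u)"
      by (simp add: expso3_def Psi_rodrigues[OF norm_sgn_1[OF \<open>u \<noteq> 0\<close>]])
    have s: "sin \<phi> > 0" using \<phi> by (rule sin_gt_zero)
    have "sqrt (1 - (cos (norm u))\<^sup>2) = sin \<phi>"
    proof -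
      have "1 - (cos (norm u))\<^sup>2 = (sin \<phi>)\<^sup>2"
        using \<sigma> by (auto simp: cs power_mult_distrib sin_squared_eq)
      thus ?thesis using s by simp
    qed
    moreover have "arccos (\<sigma> * cos (norm u)) = \<phi>"
      using \<sigma> \<phi> arccos_cos[of \<phi>] by (auto simp: cs)
    ultimately have "g (cos (norm u)) = (real k * pi + \<phi>) / (\<sigma> * sin \<phi>)" by (simp add: g_def)
    hence "g (cos (norm u)) = norm u / sin (norm u)" unfolding cs(2) by (simp add: \<phi>_def)
    moreover have "sin (norm u) \<noteq> 0" using s \<sigma> by (auto simp: cs)
    ultimately have "H (expso3 u) = u"
      unfolding H_def Ps by (simp add: expso3_def eR_rodrigues sgn_div_norm \<open>u \<noteq> 0\<close>)
    thus ?thesis using c1 Ps by blast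
  qed
  define c0 where "c0 = 1 - Psi (expso3 v)"
  have c0: "\<bar>c0\<bar> < 1" using shell[OF v] by (simp add: c0_def)
  have "\<bar>\<sigma> * c0\<bar> < 1" using c0 \<sigma> by auto
  hence ar: "-1 < \<sigma> * c0" "\<sigma> * c0 < 1" by auto
  have pos: "1 - c0\<^sup>2 > 0" using c0 by (simp add: abs_square_less_1)
  have "((\<lambda>c. real k * pi + arccos (\<sigma> * c)) has_real_derivative (inverse (- sqrt (1 - (\<sigma> * c0)\<^sup>2)) * \<sigma>)) (at c0)"
    using ar by (auto intro!: derivative_eq_intros)
  hence "(\<lambda>c. real k * pi + arccos (\<sigma> * c)) differentiable (at c0)"
    by (rule real_differentiable_def[THEN iffD2, OF exI])
  moreover have "(\<lambda>c. \<sigma> * sqrt (1 - c\<^sup>2)) differentiable (at c0)"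
  proof -
    have "((\<lambda>c. sqrt (1 - c\<^sup>2)) has_real_derivative (inverse (sqrt (1 - c0\<^sup>2)) / 2 * (- 2 * c0))) (at c0)"
      using pos by (auto intro!: derivative_eq_intros)
    hence "(\<lambda>c. sqrt (1 - c\<^sup>2)) differentiable (at c0)" by (rule real_differentiable_def[THEN iffD2, OF exI])
    thus ?thesis by simp
  qed
  moreover have "\<sigma> * sqrt (1 - c0\<^sup>2) \<noteq> 0" using pos \<sigma> by auto
  ultimately have g: "g differentiable (at c0)"
    unfolding g_def[abs_def] by (intro differentiable_divide)
  have Psi: "(\<lambda>M. 1 - Psi M) differentiable (at (expso3 v))"
  proof -
    define l :: "real^3^3 \<Rightarrow> real" where "l M = (M$1$1 + M$2$2 + M$3$3) / 2" for M
    have "linear l" by (rule linearI) (simp_all add: l_def field_simps)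
    hence "l differentiable (at (expso3 v))"
      by (intro bounded_linear_imp_differentiable) (simp add: linear_conv_bounded_linear)
    hence "(\<lambda>M. l M - 1 / 2) differentiable (at (expso3 v))" by simp
    moreover have "(\<lambda>M. l M - 1 / 2) = (\<lambda>M. 1 - Psi M)"
      by (rule ext) (simp add: l_def Psi_eq field_simps)
    ultimately show ?thesis by simp
  qed
  have "(\<lambda>M. g (1 - Psi M)) differentiable (at (expso3 v))"
    using differentiable_chain_at[OF Psi, of g] g by (simp add: c0_def o_def)
  \<comment> \<open>\<open>H\<close> is defined on all matrices near \<open>expso3 v\<close>, so
    ordinary differentiability in the ambient space suffices and no calculus on the group is
    involved.\<close>
  hence "H differentiable (at (expso3 v))"
    unfolding H_def[abs_def]
    by (intro differentiable_scaleR bounded_linear_imp_differentiable[OF bounded_linear_eR])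
  then obtain d B where "d > 0" "B > 0"
    "\<And>M. norm (M - expso3 v) < d \<Longrightarrow> norm (H M - H (expso3 v)) \<le> B * norm (M - expso3 v)"
    using differentiable_imp_pointwise_lipschitz by blast
  thus ?thesis using that[of d B] shell v by metis
qed

text \<open>A sphere times a vector space lies in the frontier of a convex cylinder. Radius 0 is the
  degenerate shell boundary \<open>k = 0\<close>; there the set lies in a hyperplane.\<close>

lemma negligible_fst_sphere:
  fixes r :: real
  shows "negligible {p :: 'a::euclidean_space \<times> 'b::euclidean_space. norm (fst p) = r}"
proof (cases "r > 0")
  case True
  define S where "S = cball (0::'a) r \<times> (UNIV :: 'b set)"
  have "convex S" unfolding S_def by (intro convex_Times) auto
  hence "negligible (frontier S)" by (rule negligible_convex_frontier)
  moreover have "{p :: 'a \<times> 'b. norm (fst p) = r} \<subseteq> frontier S"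
    using True by (auto simp: frontier_def S_def closure_Times interior_Times)
  ultimately show ?thesis by (rule negligible_subset)
next
  case False
  obtain b :: 'a where "b \<in> Basis" using nonempty_Basis by blast
  hence "(b, 0 :: 'b) \<noteq> 0" using nonzero_Basis by (auto simp: prod_eq_iff)
  hence "negligible {p. (b, 0 :: 'b) \<bullet> p = 0}" by (intro negligible_hyperplane) simp
  moreover have "{p. norm (fst p) = r} \<subseteq> {p. (b, 0 :: 'b) \<bullet> p = 0}"
  proof
    fix p :: "'a \<times> 'b" assume "p \<in> {p. norm (fst p) = r}"
    hence "norm (fst p) \<le> 0" using False by simp
    hence "fst p = 0" by simp
    thus "p \<in> {p. (b, 0 :: 'b) \<bullet> p = 0}" by (simp add: inner_prod_def)
  qed
  ultimately show ?thesis by (rule negligible_subset)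
qed

context tracking
begin

subsection \<open>The exceptional set is null\<close>

lemma F_norm_fst_le: "fst p \<in> SO3 \<Longrightarrow> norm (fst (F p)) \<le> 2 * norm (Z p)"
proof -
  assume p: "fst p \<in> SO3"
  have "norm (fst (F p)) \<le> 2 * norm (fst (snd p))"
    using norm_skew_le by (simp add: F_def norm_orthogonal_mult[OF SO3_D(1)[OF p]])
  also have "norm (fst (snd p)) \<le> norm (Z p)"
    using norm_fst_snd_le[of "Z p"] by (simp add: Z_def)
  finally show ?thesis by simp
qed

text \<open>If \<open>V \<ge> 4 p\<^sub>1\<^sub>1\<close> along a solution then \<open>W = V - 4 p\<^sub>1\<^sub>1\<close> is at most quadratic in the errors and hence decays
  exponentially; weighting the dissipation by \<open>exp (\<kappa> t)\<close> shows that \<open>R\<^sub>e\<close> has finite length.\<close>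

lemma nonconvergent_rotation_cauchy:
  assumes p: "sol p" and V_ge: "\<And>t. t \<ge> 0 \<Longrightarrow> 4 * p11 \<le> V (p t)" and "\<eta> > 0"
  obtains T where "T \<ge> 0" "\<And>t s. T \<le> s \<Longrightarrow> s \<le> t \<Longrightarrow> norm (fst (p t) - fst (p s)) < \<eta>"
proof -
  obtain k where k: "k > 0" "\<And>p. fst p \<in> SO3 \<Longrightarrow> dV p \<le> - k * (norm (Z p))\<^sup>2"
    using dV_le by blast
  obtain B where B: "B > 0" "\<And>z z'. norm (\<beta> z z') \<le> norm z * norm z' * B"
    using bounded_bilinear.pos_bounded[OF bounded_bilinear_\<beta>] by blast
  define W where "W t = V (p t) - 4 * p11" for t
  define \<kappa> where "\<kappa> = k / (2 * B)"
  have "\<kappa> > 0" using k B by (simp add: \<kappa>_def)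
  \<comment> \<open>Since Psi \<le> 2, the attitude part of \<open>V\<close> never exceeds
    \<open>4 * p11\<close>, and only \<open>\<beta>\<close> is left.\<close>
  have W_le: "W t \<le> B * (norm (Z (p t)))\<^sup>2" if "t \<ge> 0" for t
  proof -
    have "2 * p11 * Psi (fst (p t)) \<le> 4 * p11"
      using SO3_Psi_bounds[OF sol_D(1)[OF p that]] p11_pos by simp
    moreover have "\<beta> (Z (p t)) (Z (p t)) \<le> B * (norm (Z (p t)))\<^sup>2"
      using B(2)[of "Z (p t)" "Z (p t)"] by (simp add: power2_eq_square algebra_simps)
    ultimately show ?thesis by (simp add: W_def V_def)
  qed
  \<comment> \<open>A potential for arc length: with E = exp (\<kappa> t), the inequality 2 a \<le>
    a^2 E + 1 / E trades the exponentially weighted square of a = \<bar>Z\<bar> for \<open>a\<close>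
    itself, and \<open>2 * a\<close> bounds the speed of R_e.\<close>
  define \<phi> where "\<phi> t = - W t * exp (\<kappa> * t) * (2 / k) - exp (- \<kappa> * t) / \<kappa>" for t
  define \<phi>' where "\<phi>' t = - (dV (p t) + \<kappa> * W t) * exp (\<kappa> * t) * (2 / k) + exp (- \<kappa> * t)" for t
  have \<phi>_der: "(\<phi> has_real_derivative \<phi>' t) (at t within {0..})" if "t \<ge> 0" for t
    unfolding \<phi>_def[abs_def] \<phi>'_def W_def[abs_def]
    using V_has_derivative[OF sol_D(2)[OF p that]] \<open>\<kappa> > 0\<close> k(1)
    by (auto intro!: derivative_eq_intros simp: field_simps)
  have \<phi>'_ge: "2 * norm (Z (p t)) \<le> \<phi>' t" if "t \<ge> 0" for t
  proof -
    define a where "a = norm (Z (p t))"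
    define E where "E = exp (\<kappa> * t)"
    have "E > 0" by (simp add: E_def)
    have "\<kappa> * W t \<le> k / 2 * a\<^sup>2"
      using mult_left_mono[OF W_le[OF that], of \<kappa>] \<open>\<kappa> > 0\<close> B(1) by (simp add: a_def \<kappa>_def)
    hence "k / 2 * a\<^sup>2 \<le> - (dV (p t) + \<kappa> * W t)"
      using k(2)[OF sol_D(1)[OF p that]] by (simp add: a_def)
    hence "k / 2 * a\<^sup>2 * (E * (2 / k)) \<le> - (dV (p t) + \<kappa> * W t) * (E * (2 / k))"
      using \<open>E > 0\<close> k(1) by (intro mult_right_mono) auto
    hence "a\<^sup>2 * E + inverse E \<le> \<phi>' t"
      using k(1) by (simp add: \<phi>'_def E_def exp_minus)
    moreover have "2 * a \<le> a\<^sup>2 * E + inverse E"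
    proof -
      have "0 \<le> (a * E - 1)\<^sup>2 / E" using \<open>E > 0\<close> by simp
      also have "\<dots> = a\<^sup>2 * E + inverse E - 2 * a"
        using \<open>E > 0\<close> by (simp add: power2_eq_square field_simps)
      finally show ?thesis by simp
    qed
    ultimately show ?thesis by (simp add: a_def)
  qed
  have R_le: "norm (fst (p t) - fst (p s)) \<le> \<phi> t - \<phi> s" if "0 \<le> s" "s \<le> t" for s t
  proof (cases "s = t")
    case False
    show ?thesis
    proof (rule differentiable_bound_general[where f' = "\<lambda>t. fst (F (p t))" and \<phi>' = \<phi>'])
      show "s < t" using False that by simp
      have R_der: "((\<lambda>t. fst (p t)) has_vector_derivative fst (F (p x))) (at x within {0..})" if "x \<ge> 0" for x
        by (rule bounded_linear.has_vector_derivative[OF bounded_linear_fst sol_D(2)[OF p that]])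
      show "continuous_on {s..t} (\<lambda>t. fst (p t))"
        using \<open>0 \<le> s\<close> has_vector_derivative_continuous[OF has_vector_derivative_within_subset[OF R_der, of _ "{s..t}"]]
        by (auto simp: continuous_on_eq_continuous_within)
      show "continuous_on {s..t} \<phi>"
        using \<open>0 \<le> s\<close> DERIV_continuous[OF DERIV_subset[OF \<phi>_der, of _ "{s..t}"]]
        by (auto simp: continuous_on_eq_continuous_within)
      fix x assume x: "s < x" "x < t"
      have at: "at x within {0..} = at x" using x \<open>0 \<le> s\<close> by (intro at_within_interior) auto
      show "((\<lambda>t. fst (p t)) has_vector_derivative fst (F (p x))) (at x)"
        using R_der[of x] x \<open>0 \<le> s\<close> by (simp add: at)
      show "(\<phi> has_vector_derivative \<phi>' x) (at x)"
        using \<phi>_der[of x] x \<open>0 \<le> s\<close> by (simp add: at has_real_derivative_iff_has_vector_derivative)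
      show "norm (fst (F (p x))) \<le> \<phi>' x"
        using F_norm_fst_le[OF sol_D(1)[OF p]] \<phi>'_ge x \<open>0 \<le> s\<close> by (meson less_imp_le order_trans)
    qed
  qed simp
  \<comment> \<open>Here V \<ge> 4 p11 enters: it bounds the nondecreasing \<phi> from above, so the
    increments of \<phi>, and with them those of R_e, become arbitrarily small.\<close>
  have \<phi>_le0: "\<phi> t \<le> 0" if "t \<ge> 0" for t
  proof -
    have "0 \<le> W t * exp (\<kappa> * t) * (2 / k)" using V_ge[OF that] k(1) by (simp add: W_def)
    moreover have "0 \<le> exp (- \<kappa> * t) / \<kappa>" using \<open>\<kappa> > 0\<close> by simp
    ultimately show ?thesis by (simp add: \<phi>_def)
  qed
  have bdd: "bdd_above (\<phi> ` {0..})" using \<phi>_le0 by (auto intro!: bdd_aboveI[of _ 0])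
  have "\<exists>T\<ge>0. Sup (\<phi> ` {0..}) - \<eta> < \<phi> T"
    using less_cSupD[of "\<phi> ` {0..}" "Sup (\<phi> ` {0..}) - \<eta>"] \<open>\<eta> > 0\<close> by auto
  then obtain T where T: "T \<ge> 0" "Sup (\<phi> ` {0..}) - \<eta> < \<phi> T" by blast
  show ?thesis
  proof (rule that[OF T(1)])
    fix s t assume st: "T \<le> s" "s \<le> t"
    have "0 \<le> \<phi> s - \<phi> T" using R_le[OF T(1) st(1)] by (meson norm_ge_zero order_trans)
    moreover have "\<phi> t \<le> Sup (\<phi> ` {0..})" using st T(1) bdd by (intro cSup_upper) auto
    ultimately show "norm (fst (p t) - fst (p s)) < \<eta>" using R_le[of s t] st T by linarith
  qed
qed

text \<open>Closeness to the critical set selects a half-turn at one single time; the Cauchy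
  property then keeps the orbit near that same half-turn. The entry time is an integer for the sake
  of countability.\<close>

lemma nonconvergent_trapped:
  assumes p: "sol p" and nc: "\<not> (p \<longlongrightarrow> peq) at_top" and "r > 0"
  obtains \<alpha> n where "norm \<alpha> = 1" "\<And>t. t \<ge> real n \<Longrightarrow> near r \<alpha> (p t)"
proof -
  define r' where "r' = min r 1"
  have r': "r' > 0" "r' \<le> r" "r' \<le> 1" using \<open>r > 0\<close> by (auto simp: r'_def)
  have psi: "((\<lambda>t. Psi (fst (p t))) \<longlongrightarrow> 2) at_top" and V_ge: "\<And>t. t \<ge> 0 \<Longrightarrow> 4 * p11 \<le> V (p t)"
    using sol_dichotomy[OF p] nc by auto
  obtain T where T: "T \<ge> 0" "\<And>t s. T \<le> s \<Longrightarrow> s \<le> t \<Longrightarrow> norm (fst (p t) - fst (p s)) < r' / 2"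
    using nonconvergent_rotation_cauchy[OF p V_ge, of "r' / 2"] r'(1) by auto
  define S where "S = {mat 1} \<union> {rodrigues \<alpha> pi | \<alpha>. norm \<alpha> = 1}"
  have "\<forall>\<^sub>F t in at_top. infdist (fst (p t)) S < r' / 2"
    using order_tendstoD(2)[OF sol_infdist_tendsto[OF p], of "r' / 2"] r'(1) by (simp add: S_def)
  moreover have "\<forall>\<^sub>F t in at_top. Psi (fst (p t)) > 1"
    using order_tendstoD(1)[OF psi, of 1] by simp
  moreover have "\<forall>\<^sub>F t in at_top. dist (Z (p t)) 0 < r'"
    using tendstoD[OF sol_Z_tendsto(1)[OF p] r'(1)] .
  moreover have "\<forall>\<^sub>F t in at_top. t \<ge> T" by (rule eventually_ge_at_top)
  ultimately have "\<forall>\<^sub>F t in at_top. infdist (fst (p t)) S < r' / 2 \<and> Psi (fst (p t)) > 1 \<and>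
      dist (Z (p t)) 0 < r' \<and> t \<ge> T"
    by eventually_elim simp
  then obtain T' where T': "\<And>t. t \<ge> T' \<Longrightarrow> infdist (fst (p t)) S < r' / 2 \<and> Psi (fst (p t)) > 1 \<and>
      dist (Z (p t)) 0 < r' \<and> t \<ge> T"
    unfolding eventually_at_top_linorder by blast
  obtain n where n: "real n \<ge> T'" using real_arch_simple by blast
  note Tn = T'[OF n]
  have SO3n: "fst (p (real n)) \<in> SO3" by (rule sol_D(1)[OF p]) simp
  have "S \<noteq> {}" by (simp add: S_def)
  obtain y where y: "y \<in> S" "dist (fst (p (real n))) y < r' / 2"
    using Tn cINF_less_iff[of S "dist (fst (p (real n)))" "r' / 2"] \<open>S \<noteq> {}\<close>
    by (auto simp: infdist_notempty)
  \<comment> \<open>Psi > 1 puts R_e at distance more than 2 from the identity, which rules it out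
    as the nearby critical point.\<close>
  have "y \<noteq> mat 1"
  proof
    assume "y = mat 1"
    hence "(norm (fst (p (real n)) - mat 1))\<^sup>2 < 1\<^sup>2"
      using y(2) r' by (intro power_strict_mono) (auto simp: dist_norm)
    thus False using SO3_norm_diff[OF SO3n] Tn by simp
  qed
  then obtain \<alpha> where \<alpha>: "norm \<alpha> = 1" "y = rodrigues \<alpha> pi" using y(1) by (auto simp: S_def)
  show ?thesis
  proof (rule that[OF \<alpha>(1)])
    fix t assume t: "t \<ge> real n"
    have "norm (fst (p t) - rodrigues \<alpha> pi) \<le> norm (fst (p t) - fst (p (real n))) + norm (fst (p (real n)) - rodrigues \<alpha> pi)"
      using norm_triangle_ineq[of "fst (p t) - fst (p (real n))" "fst (p (real n)) - rodrigues \<alpha> pi"] by simp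
    also have "\<dots> < r' / 2 + r' / 2"
      using T(2)[of "real n" t] Tn t y(2) by (intro add_strict_mono) (auto simp: \<alpha>(2) dist_norm)
    finally have 1: "norm (fst (p t) - rodrigues \<alpha> pi) \<le> r" using r' by simp
    have "norm (fst (snd (p t))) \<le> norm (Z (p t))"
      using norm_fst_snd_le[of "Z (p t)"] by (simp add: Z_def)
    hence 2: "norm (fst (snd (p t))) \<le> r" using T'[of t] n t r' by auto
    have "t \<ge> 0" using t by (meson of_nat_0_le_iff order_trans)
    thus "near r \<alpha> (p t)" using 1 2 sol_D(1)[OF p] by (simp add: near_def)
  qed
qed

text \<open>\<open>k\<close> is the shell on which the exponential is inverted, \<open>n\<close> the
  entry time, \<open>m\<close> an orbit bound that fixes one Lipschitz constant of \<open>F\<close>.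
  All are naturals, so that a countable union exhausts the exceptional data.\<close>

definition trapped_data :: "nat \<Rightarrow> nat \<Rightarrow> nat \<Rightarrow> real \<Rightarrow> real^3 \<Rightarrow> ((real^3) \<times> (real^3) \<times> (real^'n)) set" where
  "trapped_data k n m r \<alpha> = {y. real k * pi < norm (fst y) \<and> norm (fst y) < (real k + 1) * pi \<and>
     (\<exists>p. sol p \<and> p 0 = (expso3 (fst y), snd y) \<and> (\<forall>t\<ge>0. norm (p t) \<le> real m) \<and>
       (\<forall>t\<ge>real n. near r \<alpha> (p t)))}"

text \<open>Three inverse estimates are chained: the projected state at time \<open>n\<close>
  controls the state (graph), this controls the state at time 0 (backward Lipschitz), and this
  controls the exponential coordinates (chart).\<close>

lemma negligible_trapped_data:
  assumes "C > 0" and \<alpha>: "norm \<alpha> = 1"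
    and graph: "\<And>p q n. sol p \<Longrightarrow> sol q \<Longrightarrow> n \<ge> 0 \<Longrightarrow>
      (\<And>t. t \<ge> n \<Longrightarrow> near r \<alpha> (p t)) \<Longrightarrow> (\<And>t. t \<ge> n \<Longrightarrow> near r \<alpha> (q t)) \<Longrightarrow>
      norm (p n - q n) \<le> C * norm (proj \<alpha> (p n) - proj \<alpha> (q n))"
  shows "negligible (trapped_data k n m r \<alpha>)"
proof -
  let ?S = "trapped_data k n m r \<alpha>"
  obtain L where L: "L > 0"
    "\<And>p q. norm p \<le> real m \<Longrightarrow> norm q \<le> real m \<Longrightarrow> norm (F p - F q) \<le> L * norm (p - q)"
    using F_lipschitz_on_balls[of "real m"] by blast
  have "\<forall>y\<in>?S. \<exists>p. sol p \<and> p 0 = (expso3 (fst y), snd y) \<and> (\<forall>t\<ge>0. norm (p t) \<le> real m) \<and>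
       (\<forall>t\<ge>real n. near r \<alpha> (p t))"
    by (simp add: trapped_data_def)
  then obtain P where P: "\<And>y. y \<in> ?S \<Longrightarrow> sol (P y)" "\<And>y. y \<in> ?S \<Longrightarrow> P y 0 = (expso3 (fst y), snd y)"
    "\<And>y t. y \<in> ?S \<Longrightarrow> t \<ge> 0 \<Longrightarrow> norm (P y t) \<le> real m"
    "\<And>y t. y \<in> ?S \<Longrightarrow> t \<ge> real n \<Longrightarrow> near r \<alpha> (P y t)"
    by metis
  define g where "g y = proj \<alpha> (P y (real n))" for y
  define G where "G = exp (L * real n) * C"
  have "G > 0" using \<open>C > 0\<close> by (simp add: G_def)
  have le: "norm (P y 0 - P x 0) \<le> G * norm (g y - g x)" if "x \<in> ?S" "y \<in> ?S" for x y
  proof -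
    have "norm (P y 0 - P x 0) \<le> exp (L * real n) * norm (P y (real n) - P x (real n))"
      using L(2) sol_D(2)[OF P(1)[OF that(2)]] P(3)[OF that(2)] sol_D(2)[OF P(1)[OF that(1)]] P(3)[OF that(1)]
      by (rule backward_lipschitz) auto
    also have "\<dots> \<le> exp (L * real n) * (C * norm (g y - g x))"
      unfolding g_def using P that by (intro mult_left_mono graph) auto
    finally show ?thesis by (simp add: G_def)
  qed
  show ?thesis
  proof (rule negligible_if_locally_bilipschitz_into_negligible)
    \<comment> \<open>\<open>proj\<close> keeps the center part as a vector of R^3 orthogonal to
      \<alpha>. Its values thus lie in a hyperplane of a space of the same type as the data, as the
      transport of null sets requires.\<close>
    show "negligible {z :: (real^3) \<times> (real^3) \<times> (real^'n). (\<alpha>, 0) \<bullet> z = 0}"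
      using \<alpha> by (intro negligible_hyperplane) (auto simp: prod_eq_iff)
    have "\<alpha> \<bullet> \<alpha> = 1" using \<alpha> by (simp add: norm_eq_1)
    thus "g ` ?S \<subseteq> {z. (\<alpha>, 0) \<bullet> z = 0}"
      by (auto simp: g_def proj_def Cloc_def inner_prod_def inner_diff_right)
    fix x assume x: "x \<in> ?S"
    hence kx: "real k * pi < norm (fst x)" "norm (fst x) < (real k + 1) * pi" by (auto simp: trapped_data_def)
    obtain d B where dB: "d > 0" "B > 0"
      "\<And>u. real k * pi < norm u \<Longrightarrow> norm u < (real k + 1) * pi \<Longrightarrow>
        norm (expso3 u - expso3 (fst x)) < d \<Longrightarrow> norm (u - fst x) \<le> B * norm (expso3 u - expso3 (fst x))"
      using expso3_inverse_lipschitz[OF kx] by blast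
    show "\<exists>d B. d > 0 \<and> (\<forall>y\<in>?S. norm (g y - g x) < d \<longrightarrow> norm (y - x) \<le> B * norm (g y - g x))"
    \<comment> \<open>Distance below \<open>d / G\<close> keeps the rotations within the radius
      \<open>d\<close> of the chart; \<open>B * G\<close> bounds the exponential coordinate and
      \<open>G\<close> the other two.\<close>
    proof (rule exI[of _ "d / G"], rule exI[of _ "B * G + G"], intro conjI ballI impI)
      show "d / G > 0" using dB \<open>G > 0\<close> by simp
      fix y assume y: "y \<in> ?S" and near: "norm (g y - g x) < d / G"
      have ky: "real k * pi < norm (fst y)" "norm (fst y) < (real k + 1) * pi" using y by (auto simp: trapped_data_def)
      have D: "P y 0 - P x 0 = (expso3 (fst y) - expso3 (fst x), snd y - snd x)"
        by (simp add: P(2)[OF x] P(2)[OF y])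
      have E: "norm (expso3 (fst y) - expso3 (fst x)) \<le> G * norm (g y - g x)"
        using le[OF x y] norm_fst_le order_trans unfolding D by blast
      have w: "norm (snd y - snd x) \<le> G * norm (g y - g x)"
        using le[OF x y] norm_snd_le order_trans unfolding D by blast
      have "G * norm (g y - g x) < d" using near \<open>G > 0\<close> by (simp add: field_simps)
      hence "norm (fst y - fst x) \<le> B * norm (expso3 (fst y) - expso3 (fst x))"
        using E ky by (intro dB) auto
      also have "\<dots> \<le> B * (G * norm (g y - g x))" using E dB(2) by (intro mult_left_mono) auto
      finally have v: "norm (fst y - fst x) \<le> B * (G * norm (g y - g x))" .
      have "norm (y - x) \<le> norm (fst y - fst x) + norm (snd y - snd x)"
      proof -
        have "y - x = (fst y - fst x, snd y - snd x)" by (simp add: prod_eq_iff)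
        thus ?thesis using norm_Pair_le by metis
      qed
      thus "norm (y - x) \<le> (B * G + G) * norm (g y - g x)" using v w by (simp add: algebra_simps)
    qed
  qed
qed

text \<open>Half-turns form an uncountable family. Being trapped within \<open>r / 2\<close> of one
  of them implies being trapped within \<open>r\<close> of a member of a countable dense subfamily,
  and \<open>r\<close> does not depend on \<alpha>.\<close>

lemma negligible_nonconvergent_data:
  "negligible {y. \<exists>p. sol p \<and> p 0 = (expso3 (fst y), snd y) \<and> \<not> (p \<longlongrightarrow> peq) at_top}"
proof -
  obtain r C where r: "r > 0" "C > 0"
    "\<And>\<alpha> p q n. norm \<alpha> = 1 \<Longrightarrow> sol p \<Longrightarrow> sol q \<Longrightarrow> n \<ge> 0 \<Longrightarrow>
      (\<And>t. t \<ge> n \<Longrightarrow> near r \<alpha> (p t)) \<Longrightarrow> (\<And>t. t \<ge> n \<Longrightarrow> near r \<alpha> (q t)) \<Longrightarrow>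
      norm (p n - q n) \<le> C * norm (proj \<alpha> (p n) - proj \<alpha> (q n))"
    using trapped_lipschitz_graph by blast
  define crit where "crit = (\<lambda>\<alpha>. rodrigues \<alpha> pi) ` {\<alpha>. norm \<alpha> = 1}"
  obtain D where D: "countable D" "D \<subseteq> crit" "crit \<subseteq> closure D"
    using separable[of crit] by blast
  obtain A where A: "countable A" "A \<subseteq> {\<alpha>. norm \<alpha> = 1}" "D = (\<lambda>\<alpha>. rodrigues \<alpha> pi) ` A"
    using D(1,2) countable_subset_image[of D "\<lambda>\<alpha>. rodrigues \<alpha> pi" "{\<alpha>. norm \<alpha> = 1}"]
    unfolding crit_def by auto
  define T where "T = (\<Union>k. {y :: (real^3) \<times> (real^3) \<times> (real^'n). norm (fst y) = real k * pi})
    \<union> (\<Union>k. \<Union>n. \<Union>m. \<Union>\<alpha>\<in>A. trapped_data k n m r \<alpha>)"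
  have neg: "negligible (trapped_data k n m r \<alpha>)" if "\<alpha> \<in> A" for k n m \<alpha>
  proof -
    have "norm \<alpha> = 1" using A(2) that by auto
    thus ?thesis by (rule negligible_trapped_data[OF r(2)]) (rule r(3)[OF \<open>norm \<alpha> = 1\<close>])
  qed
  have negA: "negligible (\<Union>\<alpha>\<in>A. trapped_data k n m r \<alpha>)" for k n m
    using A(1) neg unfolding negligible_iff_null_sets by (intro null_sets_UN') auto
  have "negligible (\<Union>k. \<Union>n. \<Union>m. \<Union>\<alpha>\<in>A. trapped_data k n m r \<alpha>)"
    by (rule negligible_Union_nat)+ (rule negA)
  hence "negligible T"
    unfolding T_def by (rule negligible_Un[OF negligible_Union_nat[OF negligible_fst_sphere]])
  moreover have "{y. \<exists>p. sol p \<and> p 0 = (expso3 (fst y), snd y) \<and> \<not> (p \<longlongrightarrow> peq) at_top} \<subseteq> T"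
  proof safe
    fix v w x p assume p: "sol p" "p 0 = (expso3 (fst (v, w, x)), snd (v, w, x))"
      and nc: "\<not> (p \<longlongrightarrow> peq) at_top"
    obtain \<alpha> n where \<alpha>: "norm \<alpha> = 1" "\<And>t. t \<ge> real n \<Longrightarrow> near (r / 2) \<alpha> (p t)"
      using nonconvergent_trapped[OF p(1) nc, of "r / 2"] r(1) by auto
    have "rodrigues \<alpha> pi \<in> closure D" using D(3) \<alpha>(1) by (auto simp: crit_def)
    then obtain \<alpha>' where \<alpha>': "\<alpha>' \<in> A" "dist (rodrigues \<alpha>' pi) (rodrigues \<alpha> pi) < r / 2"
      using half_gt_zero[OF r(1)] unfolding closure_approachable A(3) by blast
    have near: "near r \<alpha>' (p t)" if "t \<ge> real n" for t
    proof -
      have "norm (fst (p t) - rodrigues \<alpha>' pi)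
          \<le> norm (fst (p t) - rodrigues \<alpha> pi) + norm (rodrigues \<alpha> pi - rodrigues \<alpha>' pi)"
        using norm_triangle_ineq[of "fst (p t) - rodrigues \<alpha> pi" "rodrigues \<alpha> pi - rodrigues \<alpha>' pi"] by simp
      also have "\<dots> \<le> r / 2 + r / 2"
        using \<alpha>(2)[OF that] \<alpha>'(2) by (intro add_mono) (auto simp: near_def dist_norm norm_minus_commute)
      finally show ?thesis using \<alpha>(2)[OF that] r(1) by (simp add: near_def)
    qed
    obtain K where K: "\<And>t. t \<ge> 0 \<Longrightarrow> norm (p t) \<le> K" using sol_bounded[OF p(1)] by blast
    obtain m where m: "K \<le> real m" using real_arch_simple by blast
    have bnd: "\<forall>t\<ge>0. norm (p t) \<le> real m" using K m order_trans by blast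
    define k where "k = nat \<lfloor>norm v / pi\<rfloor>"
    have "real k = of_int \<lfloor>norm v / pi\<rfloor>" by (simp add: k_def)
    hence "real k \<le> norm v / pi" "norm v / pi < real k + 1"
      using floor_correct[of "norm v / pi"] by linarith+
    hence k: "real k * pi \<le> norm v" "norm v < (real k + 1) * pi"
      using pi_gt_zero by (simp_all only: pos_le_divide_eq pos_divide_less_eq)
    show "(v, w, x) \<in> T"
    proof (cases "norm v = real k * pi")
      case True
      thus ?thesis by (auto simp: T_def)
    next
      case False
      hence "(v, w, x) \<in> trapped_data k n m r \<alpha>'"
        using k p bnd near unfolding trapped_data_def by auto
      thus ?thesis using \<alpha>'(1) unfolding T_def by blast
    qed
  qed
  ultimately show ?thesis by (rule negligible_subset)
qed

end

theorem theorem1: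
  fixes J :: "real^3^3"
    and AK :: "real^'n^'n" and B\<theta> B\<omega> :: "real^3^'n" and CK :: "real^'n^3"
    and D\<theta> D\<omega> :: "real^3^3"
    and p11 :: real and P21 P22 :: "real^3^3" and P31 P32 :: "real^3^'n"
    and P33 :: "real^'n^'n"
  assumes J_pd: "pos_def J"
    and minimal: "minimal_realization AK B\<theta> B\<omega> CK"
    and P22_sym: "sym_mat P22" and P33_sym: "sym_mat P33"
    and P22_J: "P22 ** J = J ** P22"
    and P_pd: "pos_def (Pmat J p11 P21 P22 P31 P32 P33)"
    and M1_nd: "\<exists>\<tau>1 \<tau>2. \<tau>1 > 0 \<and> \<tau>2 > 0
                 \<and> neg_def (M1mat J AK B\<theta> B\<omega> CK D\<theta> D\<omega> p11 P21 P22 P31 P32 P33 \<tau>1 \<tau>2)"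
  shows
    \<comment> \<open>(1) stability of the zero equilibrium of the errors (e_R, omega_e, x_K)\<close>
    "(\<forall>\<epsilon>>0. \<exists>\<delta>>0. \<forall>Rm w xK. is_sol J AK B\<theta> B\<omega> CK D\<theta> D\<omega> Rm w xK
        \<and> dist (Rm 0, w 0, xK 0) (mat 1, 0, 0) < \<delta>
        \<longrightarrow> (\<forall>t\<ge>0. norm (eR (Rm t), w t, xK t) < \<epsilon>))
     \<comment> \<open>(2) convergence of the errors for every solution\<close>
   \<and> (\<forall>Rm w xK. is_sol J AK B\<theta> B\<omega> CK D\<theta> D\<omega> Rm w xK \<longrightarrow>
        ((\<lambda>t. (eR (Rm t), w t, xK t)) \<longlongrightarrow> 0) at_top
      \<and> ((\<lambda>t. infdist (Rm t) ({mat 1} \<union> {rodrigues \<alpha> pi | \<alpha>. norm \<alpha> = 1})) \<longlongrightarrow> 0) at_top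
      \<and> ((\<lambda>t. (w t, xK t)) \<longlongrightarrow> 0) at_top)
     \<comment> \<open>(3) the undesired equilibria are unstable\<close>
   \<and> (\<forall>\<alpha>::real^3. norm \<alpha> = 1 \<longrightarrow>
        \<not> lyap_stable J AK B\<theta> B\<omega> CK D\<theta> D\<omega> (rodrigues \<alpha> pi) 0 0)
     \<comment> \<open>(4) almost global asymptotic stability of (I, 0, 0)\<close>
   \<and> lyap_stable J AK B\<theta> B\<omega> CK D\<theta> D\<omega> (mat 1) 0 0
   \<and> {(v::real^3, w0::real^3, x0::real^'n).
        \<exists>Rm w xK. is_sol J AK B\<theta> B\<omega> CK D\<theta> D\<omega> Rm w xK
          \<and> Rm 0 = expso3 v \<and> w 0 = w0 \<and> xK 0 = x0
          \<and> \<not> ((\<lambda>t. (Rm t, w t, xK t)) \<longlongrightarrow> (mat 1, 0, 0)) at_top}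
      \<in> null_sets lebesgue"
proof -
  interpret tracking J AK B\<theta> B\<omega> CK D\<theta> D\<omega> p11 P21 P22 P31 P32 P33
    by unfold_locales fact+
  have stable: "\<exists>\<delta>>0. \<forall>Rm w xK. is_sol J AK B\<theta> B\<omega> CK D\<theta> D\<omega> Rm w xK
      \<and> dist (Rm 0, w 0, xK 0) (mat 1, 0, 0) < \<delta>
      \<longrightarrow> (\<forall>t\<ge>0. dist (Rm t, w t, xK t) (mat 1, 0, 0) < \<epsilon>)" if pos: "\<epsilon> > 0" for \<epsilon>
  proof -
    obtain \<delta> where \<delta>: "\<delta> > 0"
      "\<And>p t. sol p \<Longrightarrow> dist (p 0) peq < \<delta> \<Longrightarrow> t \<ge> 0 \<Longrightarrow> dist (p t) peq < \<epsilon>"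
      using sol_stable[OF pos] by blast
    show ?thesis
    proof (intro exI[of _ \<delta>] conjI \<delta>(1) allI impI)
      fix Rm w xK and t :: real
      assume *: "is_sol J AK B\<theta> B\<omega> CK D\<theta> D\<omega> Rm w xK \<and> dist (Rm 0, w 0, xK 0) (mat 1, 0, 0) < \<delta>" "t \<ge> 0"
      thus "dist (Rm t, w t, xK t) (mat 1, 0, 0) < \<epsilon>"
        using \<delta>(2)[of "\<lambda>t. (Rm t, w t, xK t)" t] by (simp add: is_sol_iff peq_def)
    qed
  qed
  \<comment> \<open>e_R is linear, vanishes at the identity and does not increase norms, so
    stability of the state carries over to the errors.\<close>
  have eR_le: "norm (eR M, w, x) \<le> dist (M, w, x) (mat 1, 0, 0)" for M and w :: "real^3" and x :: "real^'n"
  proof -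
    have "Z ((M, w, x) - peq) = (eR M, w, x)"
      by (simp add: Z_def peq_def linear_diff[OF linear_eR])
    thus ?thesis using norm_Z_le[of "(M, w, x) - peq"] by (simp add: dist_norm peq_def)
  qed
  show ?thesis
  proof (intro conjI allI impI)
    fix \<epsilon> :: real assume "\<epsilon> > 0"
    from stable[OF this] obtain \<delta> where \<delta>: "\<delta> > 0"
      "\<And>Rm w xK t. is_sol J AK B\<theta> B\<omega> CK D\<theta> D\<omega> Rm w xK \<Longrightarrow> dist (Rm 0, w 0, xK 0) (mat 1, 0, 0) < \<delta>
        \<Longrightarrow> t \<ge> 0 \<Longrightarrow> dist (Rm t, w t, xK t) (mat 1, 0, 0) < \<epsilon>"
      by blast
    show "\<exists>\<delta>>0. \<forall>Rm w xK. is_sol J AK B\<theta> B\<omega> CK D\<theta> D\<omega> Rm w xK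
        \<and> dist (Rm 0, w 0, xK 0) (mat 1, 0, 0) < \<delta>
        \<longrightarrow> (\<forall>t\<ge>0. norm (eR (Rm t), w t, xK t) < \<epsilon>)"
      using \<delta>(1) le_less_trans[OF eR_le \<delta>(2)] by (intro exI[of _ \<delta>]) simp
  next
    fix Rm w xK assume "is_sol J AK B\<theta> B\<omega> CK D\<theta> D\<omega> Rm w xK"
    hence s: "sol (\<lambda>t. (Rm t, w t, xK t))" by (simp add: is_sol_iff)
    show z: "((\<lambda>t. (eR (Rm t), w t, xK t)) \<longlongrightarrow> 0) at_top"
      using sol_Z_tendsto(1)[OF s] by (simp add: Z_def)
    show "((\<lambda>t. infdist (Rm t) ({mat 1} \<union> {rodrigues \<alpha> pi | \<alpha>. norm \<alpha> = 1})) \<longlongrightarrow> 0) at_top"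
      using sol_infdist_tendsto[OF s] by simp
    show "((\<lambda>t. (w t, xK t)) \<longlongrightarrow> 0) at_top" using tendsto_snd[OF z] by simp
  next
    fix \<alpha> :: "real^3" assume "norm \<alpha> = 1"
    obtain \<epsilon> where \<epsilon>: "\<epsilon> > 0"
      "\<And>\<delta>. \<delta> > 0 \<Longrightarrow> \<exists>p. sol p \<and> dist (p 0) (rodrigues \<alpha> pi, 0, 0) < \<delta>
        \<and> \<not> (\<forall>t\<ge>0. dist (p t) (rodrigues \<alpha> pi, 0, 0) < \<epsilon>)"
      using critical_point_unstable[OF \<open>norm \<alpha> = 1\<close>] by blast
    show "\<not> lyap_stable J AK B\<theta> B\<omega> CK D\<theta> D\<omega> (rodrigues \<alpha> pi) 0 0"
    proof
      assume "lyap_stable J AK B\<theta> B\<omega> CK D\<theta> D\<omega> (rodrigues \<alpha> pi) 0 0"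
      from this[unfolded lyap_stable_def, THEN spec, THEN mp, OF \<epsilon>(1)]
      obtain \<delta> where \<delta>: "\<delta> > 0" "\<And>Rm w xK. is_sol J AK B\<theta> B\<omega> CK D\<theta> D\<omega> Rm w xK \<Longrightarrow>
          dist (Rm 0, w 0, xK 0) (rodrigues \<alpha> pi, 0, 0) < \<delta> \<Longrightarrow>
          \<forall>t\<ge>0. dist (Rm t, w t, xK t) (rodrigues \<alpha> pi, 0, 0) < \<epsilon>"
        by blast
      obtain p where p: "sol p" "dist (p 0) (rodrigues \<alpha> pi, 0, 0) < \<delta>"
        "\<not> (\<forall>t\<ge>0. dist (p t) (rodrigues \<alpha> pi, 0, 0) < \<epsilon>)"
        using \<epsilon>(2)[OF \<delta>(1)] by blast
      show False
        using \<delta>(2)[of "\<lambda>t. fst (p t)" "\<lambda>t. fst (snd (p t))" "\<lambda>t. snd (snd (p t))"] p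
        by (simp add: is_sol_iff)
    qed
  next
    show "lyap_stable J AK B\<theta> B\<omega> CK D\<theta> D\<omega> (mat 1) 0 0"
      unfolding lyap_stable_def by (intro allI impI) (rule stable)
  next
    have "{(v::real^3, w0::real^3, x0::real^'n).
        \<exists>Rm w xK. is_sol J AK B\<theta> B\<omega> CK D\<theta> D\<omega> Rm w xK
          \<and> Rm 0 = expso3 v \<and> w 0 = w0 \<and> xK 0 = x0
          \<and> \<not> ((\<lambda>t. (Rm t, w t, xK t)) \<longlongrightarrow> (mat 1, 0, 0)) at_top}
      \<subseteq> {y. \<exists>p. sol p \<and> p 0 = (expso3 (fst y), snd y) \<and> \<not> (p \<longlongrightarrow> peq) at_top}"
    proof clarify
      fix v w0 x0 Rm w xK
      assume "is_sol J AK B\<theta> B\<omega> CK D\<theta> D\<omega> Rm w xK" "Rm 0 = expso3 v"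
        "\<not> ((\<lambda>t. (Rm t, w t, xK t)) \<longlongrightarrow> (mat 1, 0, 0)) at_top"
      thus "\<exists>p. sol p \<and> p 0 = (expso3 (fst (v, w 0, xK 0)), snd (v, w 0, xK 0)) \<and> \<not> (p \<longlongrightarrow> peq) at_top"
        unfolding is_sol_iff peq_def by (intro exI[of _ "\<lambda>t. (Rm t, w t, xK t)"]) simp
    qed
    with negligible_nonconvergent_data show "{(v::real^3, w0::real^3, x0::real^'n).
        \<exists>Rm w xK. is_sol J AK B\<theta> B\<omega> CK D\<theta> D\<omega> Rm w xK
          \<and> Rm 0 = expso3 v \<and> w 0 = w0 \<and> xK 0 = x0
          \<and> \<not> ((\<lambda>t. (Rm t, w t, xK t)) \<longlongrightarrow> (mat 1, 0, 0)) at_top}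
      \<in> null_sets lebesgue"
      unfolding negligible_iff_null_sets[symmetric] by (rule negligible_subset)
  qed
qed

end
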